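(* Let $k$ be an algebraically closed field of characteristic $0$, and let $A = k[[\Gamma]]$ be the complete local ring of a monomial curve singularity over $k$. Then the canonical $A$-module $\omega_A$ admits a connection if and only if $A$ is Gorenstein.
   Context: A numerical semigroup is a sub-semigroup $\Gamma \subseteq \mathbf{N}_0$ (containing $0$) such that $\mathbf{N}_0 \setminus \Gamma$ is finite. If $\{a_1, \dots, a_r\}$ is the minimal set of generators of $\Gamma$, the complete local ring of the corresponding monomial curve singularity is the subalgebra $k[[\Gamma]] = k[[t^{a_1}, \dots, t^{a_r}]] \subseteq k[[t]]$. The canonical module $\omega_A$ of the one-dimensional complete local Cohen-Macaulay ring $A$ is the (unique up to isomorphism) maximal Cohen-Macaulay $A$-module of finite injective dimension with $\dim_k \operatorname{Ext}^1_A(k, \omega_A) = 1$. A connection on an $A$-module $M$ is an $A$-linear map $\nabla: \operatorname{Der}_k(A) \to \operatorname{End}_k(M)$, $D \mapsto \nabla_D$, such that $\nabla_D(am) = a \nabla_D(m) + D(a) m$ for all $D \in \operatorname{Der}_k(A)$, $a \in A$, $m \in M$. *)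

theory Defs
  imports
    "HOL-Library.Extended_Nat"
    "HOL-Computational_Algebra.Formal_Power_Series"
    "HOL-Computational_Algebra.Polynomial"
    "HOL-Algebra.Ideal"
    "HOL-Algebra.Module"
begin

section \<open>Modules over a commutative ring\<close>

text \<open>
  The library record for modules extends the one for rings; the fields \<^term>\<open>mult\<close> and
  \<^term>\<open>one\<close> of a module are never used.
\<close>

definition regular_module :: "'a ring \<Rightarrow> ('a, 'a) module" where
  "regular_module R =
     \<lparr>carrier = carrier R, mult = (\<otimes>\<^bsub>R\<^esub>), one = \<one>\<^bsub>R\<^esub>, zero = \<zero>\<^bsub>R\<^esub>, add = add R, smult = (\<otimes>\<^bsub>R\<^esub>)\<rparr>"

definition module_hom :: "'a ring \<Rightarrow> ('a, 'b) module \<Rightarrow> ('a, 'c) module \<Rightarrow> ('b \<Rightarrow> 'c) set" where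
  "module_hom R M N =
     {f \<in> carrier M \<rightarrow> carrier N.
        (\<forall>x\<in>carrier M. \<forall>y\<in>carrier M. f (x \<oplus>\<^bsub>M\<^esub> y) = f x \<oplus>\<^bsub>N\<^esub> f y) \<and>
        (\<forall>a\<in>carrier R. \<forall>x\<in>carrier M. f (a \<odot>\<^bsub>M\<^esub> x) = a \<odot>\<^bsub>N\<^esub> f x)}"

text \<open>
  The scalar multiplication of \<open>hom_module R M N\<close> makes sense for all scalars acting on \<open>N\<close>.
  Hence, for a subring \<open>K\<close> of \<open>R\<close> and \<open>R\<close>-modules \<open>M\<close> and \<open>N\<close>, the record
  \<open>hom_module (R\<lparr>carrier := K\<rparr>) M N\<close> is the \<open>R\<close>-module of \<open>K\<close>-linear maps.
\<close>

definition hom_module :: "'a ring \<Rightarrow> ('a, 'b) module \<Rightarrow> ('a, 'c) module \<Rightarrow> ('a, 'b \<Rightarrow> 'c) module" where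
  "hom_module R M N =
     \<lparr>carrier = module_hom R M N \<inter> extensional (carrier M),
      mult = undefined, one = undefined,
      zero = (\<lambda>x\<in>carrier M. \<zero>\<^bsub>N\<^esub>),
      add = (\<lambda>f g. \<lambda>x\<in>carrier M. f x \<oplus>\<^bsub>N\<^esub> g x),
      smult = (\<lambda>a f. \<lambda>x\<in>carrier M. a \<odot>\<^bsub>N\<^esub> f x)\<rparr>"

definition quotient_module :: "('a, 'b) module \<Rightarrow> 'b set \<Rightarrow> ('a, 'b set) module" where
  "quotient_module M N =
     \<lparr>carrier = a_rcosets\<^bsub>M\<^esub> N,
      mult = undefined, one = undefined,
      zero = N,
      add = (\<lambda>X Y. X <+>\<^bsub>M\<^esub> Y),
      smult = (\<lambda>a X. N <+>\<^bsub>M\<^esub> ((\<lambda>x. a \<odot>\<^bsub>M\<^esub> x) ` X))\<rparr>"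

definition finitely_generated :: "'a ring \<Rightarrow> ('a, 'b) module \<Rightarrow> bool" where
  "finitely_generated R M \<longleftrightarrow>
     (\<exists>S. finite S \<and> S \<subseteq> carrier M \<and> (\<forall>N. submodule N R M \<and> S \<subseteq> N \<longrightarrow> N = carrier M))"

definition has_dimension :: "'a ring \<Rightarrow> ('a, 'b) module \<Rightarrow> nat \<Rightarrow> bool" where
  "has_dimension K V n \<longleftrightarrow>
     (\<exists>B. B \<subseteq> carrier V \<and> finite B \<and> card B = n \<and>
        (\<forall>v\<in>carrier V. \<exists>!c. c \<in> B \<rightarrow>\<^sub>E carrier K \<and> v = finsum V (\<lambda>b. c b \<odot>\<^bsub>V\<^esub> b) B))"


section \<open>Injective dimension and Ext\<close>

text \<open>
  Injectivity of \<open>E\<close> is tested on all modules whose carrier lies in the type of the elements of \<open>R\<close>.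
  These include \<open>R\<close> and its ideals, so by Baer's criterion this is injectivity with
  respect to all \<open>R\<close>-modules.
\<close>

definition injective_module :: "'a ring \<Rightarrow> ('a, 'b) module \<Rightarrow> bool" where
  "injective_module R E \<longleftrightarrow> module R E \<and>
     (\<forall>(M :: ('a, 'a) module) (N :: ('a, 'a) module) f g.
        module R M \<and> module R N \<and> f \<in> module_hom R M N \<and> inj_on f (carrier M) \<and>
        g \<in> module_hom R M E \<longrightarrow>
        (\<exists>h\<in>module_hom R N E. \<forall>x\<in>carrier M. h (f x) = g x))"

text \<open>
  The terms of a resolution of a module with elements of type \<open>'b\<close> live in the type
  \<open>nat \<times> 'a \<Rightarrow> nat \<times> 'b\<close>. This type is large enough for any \<open>R\<close> and \<open>M\<close>:
  every \<open>M\<close> embeds into the injective module \<open>Hom\<^sub>\<int>(R, D)\<close>, where \<open>D \<supseteq> M\<close> is a divisible group with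
  \<open>|D| \<le> \<aleph>\<^sub>0|M|\<close>, and \<open>\<kappa> = (\<aleph>\<^sub>0|M|)^(\<aleph>\<^sub>0|R|)\<close> satisfies \<open>(\<aleph>\<^sub>0\<kappa>)^|R| \<le> \<kappa>\<close>. So cokernels, and injective
  modules containing them, fit in again. As injective hulls are direct summands of such
  modules, a minimal injective resolution of \<open>M\<close> can be found here as well.
\<close>

type_synonym ('a, 'b) universe = "nat \<times> 'a \<Rightarrow> nat \<times> 'b"

definition injective_resolution ::
  "'a ring \<Rightarrow> ('a, 'b) module \<Rightarrow> ('b \<Rightarrow> 'u) \<Rightarrow> (nat \<Rightarrow> ('a, 'u) module) \<Rightarrow> (nat \<Rightarrow> 'u \<Rightarrow> 'u) \<Rightarrow> bool" where
  "injective_resolution R M \<epsilon> I d \<longleftrightarrow>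
     (\<forall>i. injective_module R (I i)) \<and>
     \<epsilon> \<in> module_hom R M (I 0) \<and> inj_on \<epsilon> (carrier M) \<and>
     (\<forall>i. d i \<in> module_hom R (I i) (I (Suc i))) \<and>
     \<epsilon> ` carrier M = {x \<in> carrier (I 0). d 0 x = \<zero>\<^bsub>I 1\<^esub>} \<and>
     (\<forall>i. d i ` carrier (I i) = {x \<in> carrier (I (Suc i)). d (Suc i) x = \<zero>\<^bsub>I (Suc (Suc i))\<^esub>})"

definition finite_injective_dimension :: "'a ring \<Rightarrow> ('a, 'b) module \<Rightarrow> bool" where
  "finite_injective_dimension R M \<longleftrightarrow>
     (\<exists>\<epsilon> (I :: nat \<Rightarrow> ('a, ('a, 'b) universe) module) d n.
        injective_resolution R M \<epsilon> I d \<and> (\<forall>i>n. carrier (I i) = {\<zero>\<^bsub>I i\<^esub>}))"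

definition some_injective_resolution ::
  "'a ring \<Rightarrow> ('a, 'b) module \<Rightarrow>
    (nat \<Rightarrow> ('a, ('a, 'b) universe) module) \<times> (nat \<Rightarrow> ('a, 'b) universe \<Rightarrow> ('a, 'b) universe)" where
  "some_injective_resolution R M = (SOME (I, d). \<exists>\<epsilon>. injective_resolution R M \<epsilon> I d)"

definition hom_cocycles ::
  "'a ring \<Rightarrow> ('a, 'n) module \<Rightarrow> (nat \<Rightarrow> ('a, 'u) module) \<Rightarrow> (nat \<Rightarrow> 'u \<Rightarrow> 'u) \<Rightarrow> nat \<Rightarrow> ('n \<Rightarrow> 'u) set" where
  "hom_cocycles R N I d i =
     {\<phi> \<in> carrier (hom_module R N (I i)). \<forall>x\<in>carrier N. d i (\<phi> x) = \<zero>\<^bsub>I (Suc i)\<^esub>}"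

fun hom_coboundaries ::
  "'a ring \<Rightarrow> ('a, 'n) module \<Rightarrow> (nat \<Rightarrow> ('a, 'u) module) \<Rightarrow> (nat \<Rightarrow> 'u \<Rightarrow> 'u) \<Rightarrow> nat \<Rightarrow> ('n \<Rightarrow> 'u) set" where
  "hom_coboundaries R N I d 0 = {\<zero>\<^bsub>hom_module R N (I 0)\<^esub>}"
| "hom_coboundaries R N I d (Suc i) =
     (\<lambda>\<psi>. \<lambda>x\<in>carrier N. d i (\<psi> x)) ` carrier (hom_module R N (I i))"

definition Ext ::
  "'a ring \<Rightarrow> nat \<Rightarrow> ('a, 'n) module \<Rightarrow> ('a, 'b) module \<Rightarrow> ('a, ('n \<Rightarrow> ('a, 'b) universe) set) module" where
  "Ext R i N M =
     (case some_injective_resolution R M of (I, d) \<Rightarrow>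
        quotient_module ((hom_module R N (I i))\<lparr>carrier := hom_cocycles R N I d i\<rparr>)
          (hom_coboundaries R N I d i))"


section \<open>Cohen-Macaulay modules and Gorenstein rings\<close>

definition krull_dim :: "'a ring \<Rightarrow> enat" where
  "krull_dim R =
     Sup {enat n | n. \<exists>P. (\<forall>i\<le>n. primeideal (P i) R) \<and> (\<forall>i<n. P i \<subset> P (Suc i))}"

fun seq_smult :: "'a list \<Rightarrow> ('a, 'b) module \<Rightarrow> 'b set" where
  "seq_smult [] M = {\<zero>\<^bsub>M\<^esub>}"
| "seq_smult (x # xs) M = {x \<odot>\<^bsub>M\<^esub> m \<oplus>\<^bsub>M\<^esub> n | m n. m \<in> carrier M \<and> n \<in> seq_smult xs M}"

definition regular_sequence :: "('a, 'b) module \<Rightarrow> 'a list \<Rightarrow> bool" where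
  "regular_sequence M xs \<longleftrightarrow>
     (\<forall>i<length xs. \<forall>m\<in>carrier M.
        xs ! i \<odot>\<^bsub>M\<^esub> m \<in> seq_smult (take i xs) M \<longrightarrow> m \<in> seq_smult (take i xs) M) \<and>
     seq_smult xs M \<noteq> carrier M"

text \<open>
  In a local ring, which is the only case in which the following notions are used,
  the non-units form the maximal ideal.
\<close>

definition depth :: "'a ring \<Rightarrow> ('a, 'b) module \<Rightarrow> enat" where
  "depth R M =
     Sup {enat (length xs) | xs. set xs \<subseteq> carrier R - Units R \<and> regular_sequence M xs}"

definition maximal_cohen_macaulay :: "'a ring \<Rightarrow> ('a, 'b) module \<Rightarrow> bool" where
  "maximal_cohen_macaulay R M \<longleftrightarrow>
     module R M \<and> finitely_generated R M \<and> depth R M = krull_dim R"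

text \<open>Definition for Noetherian local rings.\<close>

definition gorenstein :: "'a ring \<Rightarrow> bool" where
  "gorenstein R \<longleftrightarrow> finite_injective_dimension R (regular_module R)"


section \<open>Derivations and connections\<close>

definition derivation_module :: "'a set \<Rightarrow> 'a ring \<Rightarrow> ('a, 'a \<Rightarrow> 'a) module" where
  "derivation_module K R =
     (let H = hom_module (R\<lparr>carrier := K\<rparr>) (regular_module R) (regular_module R)
      in H\<lparr>carrier := {D \<in> carrier H. \<forall>a\<in>carrier R. \<forall>b\<in>carrier R.
                         D (a \<otimes>\<^bsub>R\<^esub> b) = (a \<otimes>\<^bsub>R\<^esub> D b) \<oplus>\<^bsub>R\<^esub> (D a \<otimes>\<^bsub>R\<^esub> b)}\<rparr>)"

definition end_module :: "'a set \<Rightarrow> 'a ring \<Rightarrow> ('a, 'b) module \<Rightarrow> ('a, 'b \<Rightarrow> 'b) module" where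
  "end_module K R M = hom_module (R\<lparr>carrier := K\<rparr>) M M"

definition connection ::
  "'a set \<Rightarrow> 'a ring \<Rightarrow> ('a, 'b) module \<Rightarrow> (('a \<Rightarrow> 'a) \<Rightarrow> 'b \<Rightarrow> 'b) \<Rightarrow> bool" where
  "connection K R M cov \<longleftrightarrow>
     cov \<in> module_hom R (derivation_module K R) (end_module K R M) \<and>
     (\<forall>D\<in>carrier (derivation_module K R). \<forall>a\<in>carrier R. \<forall>m\<in>carrier M.
        cov D (a \<odot>\<^bsub>M\<^esub> m) = (a \<odot>\<^bsub>M\<^esub> cov D m) \<oplus>\<^bsub>M\<^esub> (D a \<odot>\<^bsub>M\<^esub> m))"


section \<open>Monomial curve singularities\<close>

definition numerical_semigroup :: "nat set \<Rightarrow> bool" where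
  "numerical_semigroup \<Gamma> \<longleftrightarrow>
     0 \<in> \<Gamma> \<and> (\<forall>a\<in>\<Gamma>. \<forall>b\<in>\<Gamma>. a + b \<in> \<Gamma>) \<and> finite (- \<Gamma>)"

text \<open>
  The elements of \<open>k[[t^a\<^sub>1, \<dots>, t^a\<^sub>r]]\<close> are the power series in the monomials \<open>t^a\<^sub>i\<close>. If the \<open>a\<^sub>i\<close>
  generate \<open>\<Gamma>\<close>, these are the power series in \<open>t\<close> all of whose exponents lie in \<open>\<Gamma>\<close>.
\<close>

definition semigroup_ring :: "nat set \<Rightarrow> 'k::field fps ring" where
  "semigroup_ring \<Gamma> =
     \<lparr>carrier = {f. \<forall>n. fps_nth f n \<noteq> 0 \<longrightarrow> n \<in> \<Gamma>},
      mult = (*), one = 1, zero = 0, add = (+)\<rparr>"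

definition base_field :: "'k::field fps set" where
  "base_field = range fps_const"

text \<open>
  The residue field \<open>k\<close> as a module over a local subalgebra of \<open>k[[t]]\<close>: a power series acts
  through its constant coefficient.
\<close>

definition residue_module :: "('k::field fps, 'k) module" where
  "residue_module =
     \<lparr>carrier = UNIV, mult = (*), one = 1, zero = 0, add = (+), smult = (\<lambda>f c. fps_nth f 0 * c)\<rparr>"

definition canonical_module :: "'k::field fps ring \<Rightarrow> ('k fps, 'm) module \<Rightarrow> bool" where
  "canonical_module A \<omega> \<longleftrightarrow>
     maximal_cohen_macaulay A \<omega> \<and>
     finite_injective_dimension A \<omega> \<and>
     has_dimension (A\<lparr>carrier := base_field\<rparr>) (Ext A 1 residue_module \<omega>) 1"

end

theory Submission
  imports Defs "HOL-Computational_Algebra.Formal_Laurent_Series"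
begin

text \<open>
  Let \<open>F\<close> be the largest integer outside \<open>\<Gamma>\<close>, and call an integer \<open>s \<notin> \<Gamma>\<close> pseudo-Frobenius if
  \<open>s + g \<in> \<Gamma>\<close> for all \<open>0 < g \<in> \<Gamma>\<close>. Both conditions of the theorem turn out to be equivalent to
  \<open>F\<close> being the only pseudo-Frobenius number, that is, to \<open>\<Gamma>\<close> being symmetric.

  The canonical module: it is torsion free, and the hypothesis on \<open>Ext\<close> says that its socle modulo a
  high power \<open>x\<close> of \<open>t\<close> is one-dimensional. A functional on \<open>\<omega>[1/x]\<close> that vanishes on \<open>\<omega>\<close> but
  not on the socle element yields a linear map to \<open>k((t))\<close>; the one-dimensional socle forces it to be
  an isomorphism of \<open>\<omega>\<close> onto the span of the \<open>t^j\<close> with \<open>-j \<notin> \<Gamma>\<close>.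

  Connections: for pseudo-Frobenius \<open>s\<close>, the derivation \<open>t^s E\<close> with \<open>E = t d/dt\<close> preserves \<open>A\<close>. On
  the fractional ideal a connection is \<open>t^s E \<mapsto> t^s (E + h)\<close> for a fixed \<open>h\<close>. It sends \<open>t^(-s)\<close> to
  \<open>h - s\<close>, whose constant coefficient has to vanish; so \<open>s\<close> is determined by \<open>h\<close>. Conversely, if \<open>\<Gamma>\<close> is
  symmetric, the fractional ideal is a shift of \<open>A\<close>.

  Gorenstein rings: if \<open>\<Gamma>\<close> is symmetric, \<open>0 \<rightarrow> A \<rightarrow> k((t)) \<rightarrow> k((t))/A \<rightarrow> 0\<close> is an injective
  resolution. Conversely, descending along a finite injective resolution gives \<open>Ext^2(A/J, A) = 0\<close> for
  all monomial ideals \<open>J\<close>; two pseudo-Frobenius numbers \<open>p \<noteq> q\<close> would contradict this for an ideal \<open>J\<close>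
  isomorphic to \<open>A + k t^p + k t^q\<close>.
\<close>

section \<open>Extension of homomorphisms\<close>

text \<open>The canonical module is given only by its defining properties, on an arbitrary carrier,
  so a concrete model has to be extracted from the \<open>Ext\<close> hypothesis before derivations
  can be compared on it. The model comes from duality: taking the constant coefficient of a f pairs
  \<open>A\<close> with k((t)); the annihilator of \<open>A\<close> is \<open>dual\<close>, and
  k((t))/dual is the continuous k-dual of \<open>A\<close>, the injective hull of k.

  A power series is an infinite sum, whereas functionals respect only finite ones. This is why
  everything is measured by \<open>xc = t^cnd\<close>, a non-unit beyond the conductor: series of
  high order are \<open>A\<close>-multiples of it, so that truncations suffice.

  A finite injective resolution need not be minimal, so nothing can be read off from its terms.
  Instead put B = A + k t^p + k t^q. Vanishing of Ext^2(A/J, A) = Ext^1(B, A) makes A = Hom(A, A)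
  \<rightarrow> Ext^1(B/A, A) onto. This map kills the maximal ideal, so its image has dimension at
  most 1; but B/A = k^2, and t^p and t^q already give independent classes in Ext^1(k, A).\<close>

lemma module_homI:
  assumes "\<And>x. x \<in> carrier M \<Longrightarrow> f x \<in> carrier N"
    and "\<And>x y. x \<in> carrier M \<Longrightarrow> y \<in> carrier M \<Longrightarrow> f (x \<oplus>\<^bsub>M\<^esub> y) = f x \<oplus>\<^bsub>N\<^esub> f y"
    and "\<And>a x. a \<in> carrier R \<Longrightarrow> x \<in> carrier M \<Longrightarrow> f (a \<odot>\<^bsub>M\<^esub> x) = a \<odot>\<^bsub>N\<^esub> f x"
  shows "f \<in> module_hom R M N"
  using assms by (auto simp: module_hom_def)

lemma module_homD:
  assumes "f \<in> module_hom R M N"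
  shows "x \<in> carrier M \<Longrightarrow> f x \<in> carrier N"
    and "x \<in> carrier M \<Longrightarrow> y \<in> carrier M \<Longrightarrow> f (x \<oplus>\<^bsub>M\<^esub> y) = f x \<oplus>\<^bsub>N\<^esub> f y"
    and "a \<in> carrier R \<Longrightarrow> x \<in> carrier M \<Longrightarrow> f (a \<odot>\<^bsub>M\<^esub> x) = a \<odot>\<^bsub>N\<^esub> f x"
  using assms by (auto simp: module_hom_def)

lemma module_hom_compose:
  assumes "f \<in> module_hom R M N" "g \<in> module_hom R N L"
  shows "(\<lambda>x. g (f x)) \<in> module_hom R M L"
  using assms by (auto simp: module_hom_def Pi_iff)

lemma module_hom_zero:
  assumes "module R M" "module R N" "f \<in> module_hom R M N"
  shows "f \<zero>\<^bsub>M\<^esub> = \<zero>\<^bsub>N\<^esub>"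
proof -
  interpret M: module R M by fact
  interpret N: module R N by fact
  have "f \<zero>\<^bsub>M\<^esub> = f (\<zero>\<^bsub>R\<^esub> \<odot>\<^bsub>M\<^esub> \<zero>\<^bsub>M\<^esub>)"
    by simp
  also have "\<dots> = \<zero>\<^bsub>R\<^esub> \<odot>\<^bsub>N\<^esub> f \<zero>\<^bsub>M\<^esub>"
    using module_homD(3)[OF assms(3)] by blast
  also have "\<dots> = \<zero>\<^bsub>N\<^esub>"
    using module_homD(1)[OF assms(3)] by simp
  finally show ?thesis .
qed

lemma module_hom_uminus:
  assumes "module R M" "module R N" "f \<in> module_hom R M N" "x \<in> carrier M"
  shows "f (\<ominus>\<^bsub>M\<^esub> x) = \<ominus>\<^bsub>N\<^esub> f x"
proof -
  interpret M: module R M by fact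
  interpret N: module R N by fact
  have fx: "f x \<in> carrier N" "f (\<ominus>\<^bsub>M\<^esub> x) \<in> carrier N"
    using module_homD(1)[OF assms(3)] assms(4) by auto
  have "f (\<ominus>\<^bsub>M\<^esub> x) \<oplus>\<^bsub>N\<^esub> f x = f (\<ominus>\<^bsub>M\<^esub> x \<oplus>\<^bsub>M\<^esub> x)"
    using module_homD(2)[OF assms(3)] assms(4) by simp
  also have "\<dots> = \<zero>\<^bsub>N\<^esub>"
    using assms(4) module_hom_zero[OF assms(1-3)] by (simp add: M.M.l_neg)
  finally show ?thesis
    using fx by (metis N.M.minus_equality)
qed

lemma module_hom_minus:
  assumes "module R M" "module R N" "f \<in> module_hom R M N" "x \<in> carrier M" "y \<in> carrier M"
  shows "f (x \<ominus>\<^bsub>M\<^esub> y) = f x \<ominus>\<^bsub>N\<^esub> f y"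
proof -
  interpret M: module R M by fact
  show ?thesis
    using module_homD(2)[OF assms(3)] module_hom_uminus[OF assms(1-3)] assms(4,5)
    by (simp add: a_minus_def)
qed

lemma (in abelian_group) sum_eq_imp_minus_eq:
  assumes "a \<in> carrier G" "b \<in> carrier G" "c \<in> carrier G" "d \<in> carrier G" "a \<oplus> b = c \<oplus> d"
  shows "b \<ominus> d = c \<ominus> a"
proof -
  have "b \<ominus> d = (\<ominus> a \<oplus> (a \<oplus> b)) \<ominus> d"
    using assms(1-4) by (simp add: a_assoc[symmetric] l_neg)
  also have "\<dots> = (\<ominus> a \<oplus> (c \<oplus> d)) \<ominus> d"
    using assms(5) by simp
  also have "\<dots> = (\<ominus> a \<oplus> c) \<oplus> (d \<oplus> \<ominus> d)"
    using assms(1-4) by (simp add: a_minus_def a_assoc)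
  also have "\<dots> = c \<ominus> a"
    using assms(1-4) by (simp add: a_minus_def r_neg a_comm)
  finally show ?thesis .
qed

lemma (in abelian_group) minus_eq_imp_sum_eq:
  assumes "a \<in> carrier G" "b \<in> carrier G" "c \<in> carrier G" "d \<in> carrier G" "b \<ominus> d = c \<ominus> a"
  shows "a \<oplus> b = c \<oplus> d"
proof -
  have "a \<oplus> b = a \<oplus> (b \<ominus> d) \<oplus> d"
    using assms(1-4) by (simp add: a_minus_def a_assoc l_neg)
  also have "\<dots> = a \<oplus> (c \<ominus> a) \<oplus> d"
    using assms(5) by simp
  also have "\<dots> = (a \<oplus> \<ominus> a) \<oplus> (c \<oplus> d)"
    using assms(1-4) by (simp add: a_minus_def a_ac)
  also have "\<dots> = c \<oplus> d"
    using assms(1-4) by (simp add: r_neg)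
  finally show ?thesis .
qed

lemma (in module) smult_minus_l:
  "a \<in> carrier R \<Longrightarrow> b \<in> carrier R \<Longrightarrow> x \<in> carrier M \<Longrightarrow>
    (a \<ominus> b) \<odot>\<^bsub>M\<^esub> x = a \<odot>\<^bsub>M\<^esub> x \<ominus>\<^bsub>M\<^esub> b \<odot>\<^bsub>M\<^esub> x"
  by (simp add: a_minus_def smult_l_distr smult_l_minus)

lemma (in module) smult_minus_r:
  "a \<in> carrier R \<Longrightarrow> x \<in> carrier M \<Longrightarrow> y \<in> carrier M \<Longrightarrow>
    a \<odot>\<^bsub>M\<^esub> (x \<ominus>\<^bsub>M\<^esub> y) = a \<odot>\<^bsub>M\<^esub> x \<ominus>\<^bsub>M\<^esub> a \<odot>\<^bsub>M\<^esub> y"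
  by (simp add: a_minus_def smult_r_distr smult_r_minus)

section \<open>Extension of homomorphisms by Zorn's lemma\<close>

definition linear_graph :: "'a ring \<Rightarrow> ('a, 'b) module \<Rightarrow> ('a, 'c) module \<Rightarrow> ('b \<times> 'c) set \<Rightarrow> bool" where
  "linear_graph R M N G \<longleftrightarrow> G \<subseteq> carrier M \<times> carrier N \<and> single_valued G \<and>
     (\<forall>u v u' v'. (u, v) \<in> G \<longrightarrow> (u', v') \<in> G \<longrightarrow> (u \<oplus>\<^bsub>M\<^esub> u', v \<oplus>\<^bsub>N\<^esub> v') \<in> G) \<and>
     (\<forall>a u v. a \<in> carrier R \<longrightarrow> (u, v) \<in> G \<longrightarrow> (a \<odot>\<^bsub>M\<^esub> u, a \<odot>\<^bsub>N\<^esub> v) \<in> G)"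

text \<open>Partial homomorphisms are encoded as graphs, so that extension is inclusion and the
  upper bound of a chain is its union: any two pairs already lie in a common member.\<close>

lemma linear_graph_Union:
  assumes "\<C> \<noteq> {}" "\<And>G. G \<in> \<C> \<Longrightarrow> linear_graph R M N G"
    and ch: "\<And>G G'. G \<in> \<C> \<Longrightarrow> G' \<in> \<C> \<Longrightarrow> G \<subseteq> G' \<or> G' \<subseteq> G"
  shows "linear_graph R M N (\<Union>\<C>)"
proof -
  have common: "\<exists>G\<in>\<C>. p \<in> G \<and> q \<in> G" if "p \<in> \<Union>\<C>" "q \<in> \<Union>\<C>" for p q
    using that ch by blast
  have sv: "single_valued (\<Union>\<C>)"
    unfolding single_valued_def
  proof (intro allI impI)
    fix u v w assume "(u, v) \<in> \<Union>\<C>" "(u, w) \<in> \<Union>\<C>"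
    then obtain G where "G \<in> \<C>" "(u, v) \<in> G" "(u, w) \<in> G"
      using common by blast
    then show "v = w"
      using assms(2)[of G] unfolding linear_graph_def single_valued_def by blast
  qed
  have "(u \<oplus>\<^bsub>M\<^esub> u', v \<oplus>\<^bsub>N\<^esub> v') \<in> \<Union>\<C>" if uv: "(u, v) \<in> \<Union>\<C>" "(u', v') \<in> \<Union>\<C>" for u v u' v'
  proof -
    obtain G where "G \<in> \<C>" "(u, v) \<in> G" "(u', v') \<in> G"
      using common uv by blast
    then show ?thesis
      using assms(2)[of G] unfolding linear_graph_def by blast
  qed
  moreover have "(a \<odot>\<^bsub>M\<^esub> u, a \<odot>\<^bsub>N\<^esub> v) \<in> \<Union>\<C>" if "a \<in> carrier R" "(u, v) \<in> \<Union>\<C>" for a u v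
    using that assms(2) unfolding linear_graph_def by blast
  moreover have "\<Union>\<C> \<subseteq> carrier M \<times> carrier N"
    using assms(2) unfolding linear_graph_def by blast
  ultimately show ?thesis
    using sv unfolding linear_graph_def by blast
qed

text \<open>The scalars that move \<open>n\<close> into the domain of \<open>G\<close> form an
  ideal, and following \<open>G\<close> gives a homomorphism on it. An element \<open>z\<close> that
  represents this homomorphism is a consistent value at \<open>n\<close>.\<close>

lemma linear_graph_extend:
  assumes "module R M" "module R E" and G: "linear_graph R M E G" "G \<noteq> {}" and n: "n \<in> carrier M"
    and baer: "\<And>I f. ideal I R \<Longrightarrow> f \<in> module_hom R (regular_module R\<lparr>carrier := I\<rparr>) E \<Longrightarrow>
       \<exists>z\<in>carrier E. \<forall>a\<in>I. f a = a \<odot>\<^bsub>E\<^esub> z"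
  shows "\<exists>G' e. linear_graph R M E G' \<and> G \<subseteq> G' \<and> (n, e) \<in> G'"
proof -
  interpret M: module R M by fact
  interpret E: module R E by fact
  have GM: "u \<in> carrier M" and GE: "v \<in> carrier E" if "(u, v) \<in> G" for u v
    using G that unfolding linear_graph_def by auto
  have sv: "v = v'" if "(u, v) \<in> G" "(u, v') \<in> G" for u v v'
    using G that unfolding linear_graph_def single_valued_def by blast
  have Gadd: "(u \<oplus>\<^bsub>M\<^esub> u', v \<oplus>\<^bsub>E\<^esub> v') \<in> G" if "(u, v) \<in> G" "(u', v') \<in> G" for u v u' v'
    using G that unfolding linear_graph_def by blast
  have Gsm: "(a \<odot>\<^bsub>M\<^esub> u, a \<odot>\<^bsub>E\<^esub> v) \<in> G" if "a \<in> carrier R" "(u, v) \<in> G" for a u v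
    using G that unfolding linear_graph_def by blast
  have G0: "(\<zero>\<^bsub>M\<^esub>, \<zero>\<^bsub>E\<^esub>) \<in> G"
  proof -
    obtain u v where uv: "(u, v) \<in> G"
      using G(2) by (metis ex_in_conv surj_pair)
    show ?thesis
      using Gsm[OF M.R.zero_closed uv] GM[OF uv] GE[OF uv] by simp
  qed
  have Gneg: "(\<ominus>\<^bsub>M\<^esub> u, \<ominus>\<^bsub>E\<^esub> v) \<in> G" if "(u, v) \<in> G" for u v
    using Gsm[of "\<ominus>\<^bsub>R\<^esub> \<one>\<^bsub>R\<^esub>" u v] that GM[OF that] GE[OF that]
    by (simp add: M.smult_l_minus E.smult_l_minus)
  have Gmin: "(u \<ominus>\<^bsub>M\<^esub> u', v \<ominus>\<^bsub>E\<^esub> v') \<in> G" if "(u, v) \<in> G" "(u', v') \<in> G" for u v u' v'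
    unfolding a_minus_def using that Gneg Gadd by blast
  define I where "I = {a \<in> carrier R. \<exists>e. (a \<odot>\<^bsub>M\<^esub> n, e) \<in> G}"
  define f where "f a = (THE e. (a \<odot>\<^bsub>M\<^esub> n, e) \<in> G)" for a
  have f: "f a = e" if "(a \<odot>\<^bsub>M\<^esub> n, e) \<in> G" for a e
    unfolding f_def using that sv by blast
  have fI: "(a \<odot>\<^bsub>M\<^esub> n, f a) \<in> G" if "a \<in> I" for a
    using that f unfolding I_def by blast
  have IR: "a \<in> carrier R" if "a \<in> I" for a
    using that unfolding I_def by blast
  have Iadd: "a \<oplus>\<^bsub>R\<^esub> b \<in> I \<and> f (a \<oplus>\<^bsub>R\<^esub> b) = f a \<oplus>\<^bsub>E\<^esub> f b" if "a \<in> I" "b \<in> I" for a b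
  proof -
    have "((a \<oplus>\<^bsub>R\<^esub> b) \<odot>\<^bsub>M\<^esub> n, f a \<oplus>\<^bsub>E\<^esub> f b) \<in> G"
      using Gadd[OF fI fI, OF that] IR that n by (simp add: M.smult_l_distr)
    then show ?thesis
      using f IR that unfolding I_def by blast
  qed
  have Imult: "b \<otimes>\<^bsub>R\<^esub> a \<in> I \<and> f (b \<otimes>\<^bsub>R\<^esub> a) = b \<odot>\<^bsub>E\<^esub> f a" if "a \<in> I" "b \<in> carrier R" for a b
  proof -
    have "((b \<otimes>\<^bsub>R\<^esub> a) \<odot>\<^bsub>M\<^esub> n, b \<odot>\<^bsub>E\<^esub> f a) \<in> G"
      using Gsm[OF that(2) fI[OF that(1)]] IR that n by (simp add: M.smult_assoc1)
    then show ?thesis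
      using f IR that unfolding I_def by blast
  qed
  have I0: "\<zero>\<^bsub>R\<^esub> \<in> I"
    unfolding I_def using G0 n by auto
  have Imin: "\<ominus>\<^bsub>R\<^esub> a \<in> I" if "a \<in> I" for a
    using Imult[OF that, of "\<ominus>\<^bsub>R\<^esub> \<one>\<^bsub>R\<^esub>"] IR[OF that] by (simp add: M.R.l_minus)
  have "ideal I R"
  proof (rule idealI)
    show "ring R" by (rule M.R.ring_axioms)
    show "subgroup I (add_monoid R)"
    proof (rule group.subgroupI[OF M.R.add.group_axioms])
      show "I \<subseteq> carrier (add_monoid R)" "I \<noteq> {}"
        using IR I0 by auto
      show "inv\<^bsub>add_monoid R\<^esub> a \<in> I" if "a \<in> I" for a
        using Imin[OF that] by (simp add: a_inv_def)
      show "a \<otimes>\<^bsub>add_monoid R\<^esub> b \<in> I" if "a \<in> I" "b \<in> I" for a b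
        using Iadd[OF that] by simp
    qed
    show "x \<otimes>\<^bsub>R\<^esub> a \<in> I" if "a \<in> I" "x \<in> carrier R" for a x
      using Imult that by blast
    then show "a \<otimes>\<^bsub>R\<^esub> x \<in> I" if "a \<in> I" "x \<in> carrier R" for a x
      using M.R.m_comm IR that by metis
  qed
  moreover have "f \<in> module_hom R (regular_module R\<lparr>carrier := I\<rparr>) E"
    using fI GE Iadd Imult by (intro module_homI) (auto simp: regular_module_def)
  ultimately obtain z where z: "z \<in> carrier E" "\<And>a. a \<in> I \<Longrightarrow> f a = a \<odot>\<^bsub>E\<^esub> z"
    using baer by blast
  \<comment> \<open>The sum of \<open>G\<close> and the graph of a n \<mapsto> a z. It is
    single-valued because a coincidence between two of its points produces a scalar of
    \<open>I\<close>, where \<open>z\<close> agrees with \<open>G\<close>.\<close>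
  define G' where "G' = {(u \<oplus>\<^bsub>M\<^esub> a \<odot>\<^bsub>M\<^esub> n, v \<oplus>\<^bsub>E\<^esub> a \<odot>\<^bsub>E\<^esub> z) | u v a. (u, v) \<in> G \<and> a \<in> carrier R}"
  have G'I: "(u \<oplus>\<^bsub>M\<^esub> a \<odot>\<^bsub>M\<^esub> n, v \<oplus>\<^bsub>E\<^esub> a \<odot>\<^bsub>E\<^esub> z) \<in> G'" if "(u, v) \<in> G" "a \<in> carrier R" for u v a
    unfolding G'_def using that by blast
  have "single_valued G'"
    unfolding single_valued_def
  proof (intro allI impI)
    fix w e e' assume "(w, e) \<in> G'" "(w, e') \<in> G'"
    then obtain u v a u' v' a' where *:
      "(u, v) \<in> G" "a \<in> carrier R" "w = u \<oplus>\<^bsub>M\<^esub> a \<odot>\<^bsub>M\<^esub> n" "e = v \<oplus>\<^bsub>E\<^esub> a \<odot>\<^bsub>E\<^esub> z"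
      "(u', v') \<in> G" "a' \<in> carrier R" "w = u' \<oplus>\<^bsub>M\<^esub> a' \<odot>\<^bsub>M\<^esub> n" "e' = v' \<oplus>\<^bsub>E\<^esub> a' \<odot>\<^bsub>E\<^esub> z"
      unfolding G'_def by blast
    have "a \<odot>\<^bsub>M\<^esub> n \<ominus>\<^bsub>M\<^esub> a' \<odot>\<^bsub>M\<^esub> n = u' \<ominus>\<^bsub>M\<^esub> u"
      by (rule M.M.sum_eq_imp_minus_eq) (use * GM n in auto)
    then have "((a \<ominus>\<^bsub>R\<^esub> a') \<odot>\<^bsub>M\<^esub> n, v' \<ominus>\<^bsub>E\<^esub> v) \<in> G"
      using Gmin[OF *(5,1)] * n by (simp add: M.smult_minus_l)
    then have "v' \<ominus>\<^bsub>E\<^esub> v = (a \<ominus>\<^bsub>R\<^esub> a') \<odot>\<^bsub>E\<^esub> z"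
      using f[of "a \<ominus>\<^bsub>R\<^esub> a'"] z(2)[of "a \<ominus>\<^bsub>R\<^esub> a'"] *(2,6) unfolding I_def by auto
    then have "a \<odot>\<^bsub>E\<^esub> z \<ominus>\<^bsub>E\<^esub> a' \<odot>\<^bsub>E\<^esub> z = v' \<ominus>\<^bsub>E\<^esub> v"
      using * z(1) by (simp add: E.smult_minus_l)
    then show "e = e'"
      unfolding * by (intro E.M.minus_eq_imp_sum_eq) (use * GE z in auto)
  qed
  moreover have "(w \<oplus>\<^bsub>M\<^esub> w', e \<oplus>\<^bsub>E\<^esub> e') \<in> G'" if we: "(w, e) \<in> G'" "(w', e') \<in> G'" for w e w' e'
  proof -
    obtain u v a u' v' a' where *:
      "(u, v) \<in> G" "a \<in> carrier R" "w = u \<oplus>\<^bsub>M\<^esub> a \<odot>\<^bsub>M\<^esub> n" "e = v \<oplus>\<^bsub>E\<^esub> a \<odot>\<^bsub>E\<^esub> z"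
      "(u', v') \<in> G" "a' \<in> carrier R" "w' = u' \<oplus>\<^bsub>M\<^esub> a' \<odot>\<^bsub>M\<^esub> n" "e' = v' \<oplus>\<^bsub>E\<^esub> a' \<odot>\<^bsub>E\<^esub> z"
      using we unfolding G'_def by blast
    have "w \<oplus>\<^bsub>M\<^esub> w' = (u \<oplus>\<^bsub>M\<^esub> u') \<oplus>\<^bsub>M\<^esub> (a \<oplus>\<^bsub>R\<^esub> a') \<odot>\<^bsub>M\<^esub> n"
      using * GM n by (simp add: M.smult_l_distr M.M.a_ac)
    moreover have "e \<oplus>\<^bsub>E\<^esub> e' = (v \<oplus>\<^bsub>E\<^esub> v') \<oplus>\<^bsub>E\<^esub> (a \<oplus>\<^bsub>R\<^esub> a') \<odot>\<^bsub>E\<^esub> z"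
      using * GE z by (simp add: E.smult_l_distr E.M.a_ac)
    ultimately show ?thesis
      using G'I[OF Gadd[OF *(1,5)]] * by simp
  qed
  moreover have "(b \<odot>\<^bsub>M\<^esub> w, b \<odot>\<^bsub>E\<^esub> e) \<in> G'" if we: "(w, e) \<in> G'" "b \<in> carrier R" for w e b
  proof -
    obtain u v a where *:
      "(u, v) \<in> G" "a \<in> carrier R" "w = u \<oplus>\<^bsub>M\<^esub> a \<odot>\<^bsub>M\<^esub> n" "e = v \<oplus>\<^bsub>E\<^esub> a \<odot>\<^bsub>E\<^esub> z"
      using we unfolding G'_def by blast
    have "b \<odot>\<^bsub>M\<^esub> w = b \<odot>\<^bsub>M\<^esub> u \<oplus>\<^bsub>M\<^esub> (b \<otimes>\<^bsub>R\<^esub> a) \<odot>\<^bsub>M\<^esub> n"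
      using * we GM n by (simp add: M.smult_r_distr M.smult_assoc1)
    moreover have "b \<odot>\<^bsub>E\<^esub> e = b \<odot>\<^bsub>E\<^esub> v \<oplus>\<^bsub>E\<^esub> (b \<otimes>\<^bsub>R\<^esub> a) \<odot>\<^bsub>E\<^esub> z"
      using * we GE z by (simp add: E.smult_r_distr E.smult_assoc1)
    ultimately show ?thesis
      using G'I[OF Gsm[OF we(2) *(1)]] * we by simp
  qed
  moreover have "G' \<subseteq> carrier M \<times> carrier E"
    unfolding G'_def using GM GE n z by auto
  ultimately have "linear_graph R M E G'"
    unfolding linear_graph_def by blast
  moreover have "G \<subseteq> G'"
  proof
    fix p assume "p \<in> G"
    then obtain u v where p: "p = (u, v)" "(u, v) \<in> G"
      by (cases p) auto
    show "p \<in> G'"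
      using G'I[OF p(2) M.R.zero_closed] GM[OF p(2)] GE[OF p(2)] n z p by simp
  qed
  moreover have "(n, z) \<in> G'"
    using G'I[OF G0 M.R.one_closed] n z by simp
  ultimately show ?thesis
    by blast
qed

text \<open>Zorn's lemma on the graphs that contain \<open>g\<close>; a maximal one is total by the
  one-step extension. The carrier of \<open>M\<close> has an arbitrary type, so the lemma serves
  both for injectivity over \<open>A\<close> and for linear functionals over the base field.\<close>

lemma baer_extension:
  assumes M: "module R M" and E: "module R E" and H: "submodule H R M"
    and g: "g \<in> module_hom R (M\<lparr>carrier := H\<rparr>) E"
    and baer: "\<And>I f. ideal I R \<Longrightarrow> f \<in> module_hom R (regular_module R\<lparr>carrier := I\<rparr>) E \<Longrightarrow>
       \<exists>z\<in>carrier E. \<forall>a\<in>I. f a = a \<odot>\<^bsub>E\<^esub> z"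
  shows "\<exists>h\<in>module_hom R M E. \<forall>x\<in>H. h x = g x"
proof -
  interpret M: module R M by fact
  define G0 where "G0 = {(x, g x) | x. x \<in> H}"
  note HE = M.submoduleE[OF H]
  have G0: "linear_graph R M E G0"
    unfolding linear_graph_def G0_def single_valued_def
    using HE(1,4,5) module_homD[OF g] by auto
  define \<A> where "\<A> = {G. linear_graph R M E G \<and> G0 \<subseteq> G}"
  have "\<exists>G\<in>\<A>. \<forall>G'\<in>\<A>. G \<subseteq> G' \<longrightarrow> G' = G"
  proof (rule subset_Zorn_nonempty)
    show "\<A> \<noteq> {}"
      unfolding \<A>_def using G0 by blast
    fix \<C> assume C: "\<C> \<noteq> {}" "subset.chain \<A> \<C>"
    have "linear_graph R M E (\<Union>\<C>)"
      by (rule linear_graph_Union) (use C in \<open>auto simp: \<A>_def subset_chain_def\<close>)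
    moreover have "G0 \<subseteq> \<Union>\<C>"
      using C unfolding \<A>_def subset_chain_def by blast
    ultimately show "\<Union>\<C> \<in> \<A>"
      unfolding \<A>_def by blast
  qed
  then obtain G where G: "linear_graph R M E G" "G0 \<subseteq> G"
    and max: "\<And>G'. linear_graph R M E G' \<Longrightarrow> G0 \<subseteq> G' \<Longrightarrow> G \<subseteq> G' \<Longrightarrow> G' = G"
    unfolding \<A>_def by (auto simp only: mem_Collect_eq)
  have ne: "G \<noteq> {}"
    using G(2) HE(2) unfolding G0_def by blast
  have total: "\<exists>e. (n, e) \<in> G" if n: "n \<in> carrier M" for n
  proof -
    obtain G' e where G': "linear_graph R M E G'" "G \<subseteq> G'" "(n, e) \<in> G'"
      using linear_graph_extend[OF M E G(1) ne n baer] by blast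
    then have "G' = G"
      using max G(2) by blast
    then show ?thesis
      using G' by blast
  qed
  define h where "h n = (THE e. (n, e) \<in> G)" for n
  have sv: "v = v'" if "(u, v) \<in> G" "(u, v') \<in> G" for u v v'
    using G that unfolding linear_graph_def single_valued_def by blast
  have heq: "h n = e" if "(n, e) \<in> G" for n e
    unfolding h_def using sv that by blast
  have h: "(n, h n) \<in> G" if "n \<in> carrier M" for n
    using total[OF that] heq by blast
  have "h \<in> module_hom R M E"
  proof (rule module_homI)
    show "h x \<in> carrier E" if "x \<in> carrier M" for x
      using h[OF that] G(1) unfolding linear_graph_def by blast
    show "h (x \<oplus>\<^bsub>M\<^esub> y) = h x \<oplus>\<^bsub>E\<^esub> h y" if "x \<in> carrier M" "y \<in> carrier M" for x y
      using h[OF that(1)] h[OF that(2)] G(1) heq unfolding linear_graph_def by blast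
    show "h (a \<odot>\<^bsub>M\<^esub> x) = a \<odot>\<^bsub>E\<^esub> h x" if "a \<in> carrier R" "x \<in> carrier M" for a x
      using h[OF that(2)] that(1) G(1) heq unfolding linear_graph_def by blast
  qed
  moreover have "\<forall>x\<in>H. h x = g x"
    using heq G(2) unfolding G0_def by blast
  ultimately show ?thesis by blast
qed

section \<open>The ring of a numerical semigroup\<close>

lemma enat_Sup_ge_1E:
  assumes "Sup S \<ge> (1::enat)" obtains n where "n \<in> S" "n \<ge> 1"
proof -
  have "\<exists>n\<in>S. n \<ge> 1"
  proof (rule ccontr)
    assume "\<not> ?thesis"
    then have "\<forall>n\<in>S. n = 0"
      using ileI1 by (metis iless_eSuc0 linorder_not_le one_eSuc)
    then have "Sup S \<le> 0"
      by (intro Sup_least) simp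
    then show False
      using assms by simp
  qed
  then show thesis using that by blast
qed

lemma high_order_divide:
  fixes y f :: "'a::field fps"
  assumes "y \<noteq> 0" and "\<And>i. i < subdegree y + n \<Longrightarrow> fps_nth f i = 0"
  obtains b where "f = b * y" "\<And>i. i < n \<Longrightarrow> fps_nth b i = 0"
proof (cases "f = 0")
  case True
  then have "f = 0 * y" by simp
  then show ?thesis by (rule that) simp
next
  case False
  then have sub: "subdegree y + n \<le> subdegree f"
    using assms(2) by (meson linorder_not_le nth_subdegree_nonzero)
  then obtain b where b: "f = y * b"
    using fps_dvd_iff[OF assms(1) False] by (auto elim: dvdE)
  have "n \<le> subdegree b"
    using sub False by (simp add: b)
  then have "fps_nth b i = 0" if "i < n" for i
    using that by (intro nth_less_subdegree_zero) simp
  moreover have "f = b * y"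
    by (simp add: b mult.commute)
  ultimately show ?thesis
    using that by blast
qed

lemma power_nth_below:
  fixes f :: "'a::comm_ring_1 fps"
  assumes "fps_nth f 0 = 0" "i < n" shows "fps_nth (f ^ n) i = 0"
  using assms startsby_zero_power_prefix by blast

lemma fps_mult_nth_nonzeroE:
  fixes f g :: "'a::semiring_0 fps"
  assumes "fps_nth (f * g) n \<noteq> 0"
  obtains i j where "i + j = n" "fps_nth f i \<noteq> 0" "fps_nth g j \<noteq> 0"
proof -
  have "(\<Sum>i=0..n. fps_nth f i * fps_nth g (n - i)) \<noteq> 0"
    using assms by (simp add: fps_mult_nth)
  then obtain i where "i \<in> {0..n}" "fps_nth f i * fps_nth g (n - i) \<noteq> 0"
    by (rule sum.not_neutral_contains_not_neutral)
  then show thesis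
    using that[of i "n - i"] by (metis add_diff_inverse_nat atLeastAtMost_iff mult_zero_left mult_zero_right not_le)
qed

lemma fps_truncation_nth:
  "fps_nth (\<Sum>i<N. fps_const (fps_nth a i) * fps_X ^ i) n = (if n < N then fps_nth a n else 0)" for a :: "'a::comm_ring_1 fps"
  by (induction N) (auto simp: less_Suc_eq)

lemma fls_times_nth_nonzeroE:
  fixes f g :: "'a::semiring_0 fls"
  assumes "fls_nth (f * g) n \<noteq> 0"
  obtains i where "fls_nth f i \<noteq> 0" "fls_nth g (n - i) \<noteq> 0"
proof -
  have "(\<Sum>i=fls_subdegree f..n - fls_subdegree g. fls_nth f i * fls_nth g (n - i)) \<noteq> 0"
    using assms fls_times_nth(2)[of f g n] by simp
  then obtain i where "fls_nth f i * fls_nth g (n - i) \<noteq> 0"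
    by (rule sum.not_neutral_contains_not_neutral)
  then show thesis
    using that[of i] by (metis mult_zero_left mult_zero_right)
qed

section \<open>Semigroup, conductor and Frobenius number\<close>

locale monomial_ring =
  fixes \<Gamma> :: "nat set" and A :: "'k::field fps ring"
  assumes numsg: "numerical_semigroup \<Gamma>" and A_def: "A = semigroup_ring \<Gamma>"
begin

lemma zero_in: "0 \<in> \<Gamma>"
  and add_in: "m \<in> \<Gamma> \<Longrightarrow> n \<in> \<Gamma> \<Longrightarrow> m + n \<in> \<Gamma>"
  and finite_gaps: "finite (- \<Gamma>)"
  using numsg by (auto simp: numerical_semigroup_def)

definition gap_bound :: nat where
  "gap_bound = (LEAST n. \<forall>m\<ge>n. m \<in> \<Gamma>)"

text \<open>\<open>gap_bound\<close> is the conductor itself, which is 0 for \<Gamma> = \<nat>. One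
  more makes \<open>t^cnd\<close> a non-unit in every case, while all exponents from
  \<open>cnd\<close> on still lie in \<Gamma>.\<close>

definition cnd :: nat where
  "cnd = Suc gap_bound"

definition frob :: int where
  "frob = int gap_bound - 1"

abbreviation GZ :: "int set" where
  "GZ \<equiv> int ` \<Gamma>"

lemma gap_bound: "m \<ge> gap_bound \<Longrightarrow> m \<in> \<Gamma>"
proof -
  obtain N where "\<forall>n\<in>-\<Gamma>. n \<le> N"
    using finite_gaps by (meson finite_nat_set_iff_bounded_le)
  then have "\<forall>m\<ge>Suc N. m \<in> \<Gamma>"
    by (metis ComplI not_less_eq_eq)
  then have "\<forall>m\<ge>gap_bound. m \<in> \<Gamma>"
    unfolding gap_bound_def by (rule LeastI)
  then show "m \<ge> gap_bound \<Longrightarrow> m \<in> \<Gamma>"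
    by blast
qed

lemma cnd_pos: "cnd > 0"
  and ge_cnd_in: "m \<ge> cnd \<Longrightarrow> m \<in> \<Gamma>"
  using gap_bound by (auto simp: cnd_def)

lemma GZ_iff: "j \<in> GZ \<longleftrightarrow> j \<ge> 0 \<and> nat j \<in> \<Gamma>"
  by (auto simp: image_iff intro: bexI[of _ "nat j"])

lemma GZ_add: "i \<in> GZ \<Longrightarrow> j \<in> GZ \<Longrightarrow> i + j \<in> GZ"
  using add_in by (force simp flip: of_nat_add)

lemma GZ_zero: "0 \<in> GZ"
  using zero_in by force

lemma gt_frob_in_GZ: "j > frob \<Longrightarrow> j \<in> GZ"
  using gap_bound by (auto simp: GZ_iff frob_def)

lemma frob_notin_GZ: "frob \<notin> GZ"
proof
  assume a: "frob \<in> GZ"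
  then obtain c where c: "gap_bound = Suc c" "c \<in> \<Gamma>"
    by (cases gap_bound) (auto simp: frob_def)
  then have "\<forall>m\<ge>c. m \<in> \<Gamma>"
    using gap_bound by (metis le_eq_less_or_eq Suc_leI)
  then have "gap_bound \<le> c"
    unfolding gap_bound_def by (rule Least_le)
  then show False
    using c by simp
qed

section \<open>Arithmetic, units and ideals of the semigroup ring\<close>

lemma carrier_A: "f \<in> carrier A \<longleftrightarrow> (\<forall>n. fps_nth f n \<noteq> 0 \<longrightarrow> n \<in> \<Gamma>)"
  by (simp add: A_def semigroup_ring_def)

lemma carrier_AI: "(\<And>n. n \<notin> \<Gamma> \<Longrightarrow> fps_nth f n = 0) \<Longrightarrow> f \<in> carrier A"
  by (auto simp: carrier_A)

lemma A_simps [simp]: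
  "(\<otimes>\<^bsub>A\<^esub>) = (*)" "(\<oplus>\<^bsub>A\<^esub>) = (+)" "\<one>\<^bsub>A\<^esub> = 1" "\<zero>\<^bsub>A\<^esub> = 0"
  by (simp_all add: A_def semigroup_ring_def)

lemma A_closed [simp, intro]:
  "0 \<in> carrier A" "1 \<in> carrier A" "fps_const c \<in> carrier A"
  "f \<in> carrier A \<Longrightarrow> g \<in> carrier A \<Longrightarrow> f + g \<in> carrier A"
  "f \<in> carrier A \<Longrightarrow> - f \<in> carrier A"
  "f \<in> carrier A \<Longrightarrow> g \<in> carrier A \<Longrightarrow> f - g \<in> carrier A"
proof -
  show "0 \<in> carrier A" "1 \<in> carrier A" "fps_const c \<in> carrier A" "f \<in> carrier A \<Longrightarrow> - f \<in> carrier A"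
    using zero_in by (auto simp: carrier_A)
  show "f + g \<in> carrier A" "f - g \<in> carrier A" if "f \<in> carrier A" "g \<in> carrier A"
  proof -
    have fg: "fps_nth f n = 0 \<and> fps_nth g n = 0" if "n \<notin> \<Gamma>" for n
      using that \<open>f \<in> carrier A\<close> \<open>g \<in> carrier A\<close> by (auto simp: carrier_A)
    show "f + g \<in> carrier A" "f - g \<in> carrier A"
      by (rule carrier_AI, simp add: fg)+
  qed
qed

lemma A_mult_closed [simp, intro]:
  assumes "f \<in> carrier A" "g \<in> carrier A" shows "f * g \<in> carrier A"
  using assms add_in by (auto simp: carrier_A elim!: fps_mult_nth_nonzeroE)

lemma X_in_A [simp, intro]: "n \<in> \<Gamma> \<Longrightarrow> fps_X ^ n \<in> carrier A"
  by (auto simp: carrier_A split: if_splits)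

lemma A_power_closed [simp, intro]: "f \<in> carrier A \<Longrightarrow> f ^ n \<in> carrier A"
  by (induction n) auto

lemma high_order_in_A: "(\<And>i. i < cnd \<Longrightarrow> fps_nth f i = 0) \<Longrightarrow> f \<in> carrier A"
  using ge_cnd_in by (metis carrier_A linorder_not_le)

lemma cring_A: "cring A"
proof (rule cringI)
  show "abelian_group A"
  proof (rule abelian_groupI)
    show "\<exists>y\<in>carrier A. y \<oplus>\<^bsub>A\<^esub> x = \<zero>\<^bsub>A\<^esub>" if "x \<in> carrier A" for x
      using that by (intro bexI[of _ "- x"]) auto
  qed (auto simp: algebra_simps)
  show "Group.comm_monoid A"
    by (rule comm_monoidI) (auto simp: algebra_simps)
qed (auto simp: algebra_simps)

sublocale A: cring A
  by (rule cring_A)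

lemma A_uminus [simp]: "f \<in> carrier A \<Longrightarrow> \<ominus>\<^bsub>A\<^esub> f = - f"
  by (rule A.minus_equality) auto

lemma A_minus [simp]: "f \<in> carrier A \<Longrightarrow> g \<in> carrier A \<Longrightarrow> f \<ominus>\<^bsub>A\<^esub> g = f - g"
  by (simp add: a_minus_def)

text \<open>Strong induction on the exponent: for n outside \<Gamma>, a nonzero product in the
  coefficient of \<open>inverse f * f\<close> at n, other than the one with
  \<open>fps_nth f 0\<close>, would split n into two elements of \<Gamma>. So the coefficient of the
  inverse at n vanishes.\<close>

lemma inverse_in_A:
  assumes f: "f \<in> carrier A" and f0: "fps_nth f 0 \<noteq> 0"
  shows "inverse f \<in> carrier A"
proof -
  have "fps_nth (inverse f) n \<noteq> 0 \<longrightarrow> n \<in> \<Gamma>" for n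
  proof (induction n rule: less_induct)
    case (less n)
    show ?case
    proof (rule ccontr)
      assume n: "\<not> ?thesis"
      then have "n \<noteq> 0"
        using zero_in by metis
      have "fps_nth (inverse f * f) n = 0"
        using inverse_mult_eq_1[OF f0] \<open>n \<noteq> 0\<close> by simp
      moreover have "fps_nth (inverse f * f) n = fps_nth (inverse f) n * fps_nth f 0"
        unfolding fps_mult_nth
      proof (subst sum.remove[of _ n])
        show "fps_nth (inverse f) n * fps_nth f (n - n) +
            (\<Sum>i\<in>{0..n} - {n}. fps_nth (inverse f) i * fps_nth f (n - i)) =
            fps_nth (inverse f) n * fps_nth f 0"
        proof -
          have "fps_nth (inverse f) i * fps_nth f (n - i) = 0" if "i \<in> {0..n} - {n}" for i
          proof (rule ccontr)
            assume "fps_nth (inverse f) i * fps_nth f (n - i) \<noteq> 0"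
            then have "i \<in> \<Gamma>" "n - i \<in> \<Gamma>"
              using less[of i] that f by (auto simp: carrier_A)
            then have "n \<in> \<Gamma>"
              using add_in[of i "n - i"] that by simp
            then show False using n by simp
          qed
          then have "(\<Sum>i\<in>{0..n} - {n}. fps_nth (inverse f) i * fps_nth f (n - i)) = 0"
            by (intro sum.neutral) blast
          then show ?thesis by simp
        qed
      qed auto
      ultimately show False
        using n f0 by simp
    qed
  qed
  then show ?thesis by (simp add: carrier_A)
qed

lemma Units_A: "f \<in> carrier A \<Longrightarrow> fps_nth f 0 \<noteq> 0 \<Longrightarrow> f \<in> Units A"
  using inverse_in_A inverse_mult_eq_1 inverse_mult_eq_1'
  unfolding Units_def by auto

text \<open>Basis of the truncation arguments below: a nonzero \<open>y\<close> divides in k[[t]]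
  every series of large order, and a cofactor of order at least \<open>cnd\<close> lies in
  \<open>A\<close> automatically.\<close>

lemma high_order_multiple:
  fixes y f :: "'k fps"
  assumes "y \<noteq> 0" and "\<And>i. i < subdegree y + cnd \<Longrightarrow> fps_nth f i = 0"
  obtains b where "b \<in> carrier A" "f = b * y"
  using high_order_divide[OF assms] high_order_in_A by metis

lemma ideal_A_I:
  assumes "I \<subseteq> carrier A" "0 \<in> I" "\<And>a b. a \<in> I \<Longrightarrow> b \<in> I \<Longrightarrow> a + b \<in> I"
    "\<And>a b. a \<in> I \<Longrightarrow> b \<in> carrier A \<Longrightarrow> b * a \<in> I"
  shows "ideal I A"
proof (rule idealI)
  show "ring A" by (rule A.ring_axioms)
  show "subgroup I (add_monoid A)"
  proof (rule group.subgroupI[OF A.add.group_axioms])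
    show "I \<subseteq> carrier (add_monoid A)" "I \<noteq> {}"
      using assms by auto
    show "inv\<^bsub>add_monoid A\<^esub> a \<in> I" if "a \<in> I" for a
    proof -
      have "inv\<^bsub>add_monoid A\<^esub> a = (-1) * a"
        using assms(1) that A_uminus[of a] by (auto simp: a_inv_def)
      then show ?thesis
        using assms(4)[OF that, of "-1"] by auto
    qed
    show "a \<otimes>\<^bsub>add_monoid A\<^esub> b \<in> I" if "a \<in> I" "b \<in> I" for a b
      using assms(3)[OF that] by simp
  qed
qed (use assms(4) in \<open>auto simp: mult.commute\<close>)

section \<open>Krull dimension, depth and torsion\<close>

lemma primeideal_zero: "primeideal {0} A"
proof (intro primeidealI ideal_A_I)
  show "carrier A \<noteq> {0}"
    using A_closed(2) by (metis singletonD zero_neq_one)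
qed (auto simp: cring_A)

lemma primeideal_max: "primeideal {f \<in> carrier A. fps_nth f 0 = 0} A"
proof (intro primeidealI ideal_A_I)
  have "1 \<in> carrier A" "1 \<notin> {f \<in> carrier A. fps_nth f 0 = 0}"
    by auto
  then show "carrier A \<noteq> {f \<in> carrier A. fps_nth f 0 = 0}"
    by metis
qed (auto simp: cring_A)

lemma krull_dim_ge_1: "krull_dim A \<ge> 1"
proof -
  define P where "P i = (if i = 0 then {0} else {f \<in> carrier A. fps_nth f 0 = 0})" for i :: nat
  have "\<forall>i\<le>1. primeideal (P i) A"
    using primeideal_zero primeideal_max by (simp add: P_def)
  moreover have "P 0 \<subset> P 1"
  proof -
    have "fps_X ^ cnd \<in> P 1" "fps_X ^ cnd \<notin> P 0"
      using cnd_pos ge_cnd_in[of cnd] by (auto simp: P_def)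
    moreover have "P 0 \<subseteq> P 1"
      by (simp add: P_def)
    ultimately show ?thesis by blast
  qed
  ultimately have "enat 1 \<in> {enat n | n. \<exists>P. (\<forall>i\<le>n. primeideal (P i) A) \<and> (\<forall>i<n. P i \<subset> P (Suc i))}"
    by (intro CollectI exI[of _ "1::nat"] exI[of _ P] conjI) auto
  then show ?thesis
    unfolding krull_dim_def one_enat_def by (rule Sup_upper)
qed

text \<open>Depth at least 1 provides a non-unit \<open>x\<close> that is a nonzerodivisor on
  \<open>M\<close>. A high power of \<open>x\<close> is a multiple of \<open>y\<close>, so an
  element killed by \<open>y\<close> is killed by that power and hence zero.\<close>

lemma maximal_cohen_macaulay_torsion_free:
  assumes M: "maximal_cohen_macaulay A M" and y: "y \<in> carrier A" "y \<noteq> 0"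
    and m: "m \<in> carrier M" "y \<odot>\<^bsub>M\<^esub> m = \<zero>\<^bsub>M\<^esub>"
  shows "m = \<zero>\<^bsub>M\<^esub>"
proof -
  interpret M: module A M
    using M by (simp add: maximal_cohen_macaulay_def)
  have "depth A M \<ge> 1"
    using M krull_dim_ge_1 by (simp add: maximal_cohen_macaulay_def)
  then obtain xs where xs: "set xs \<subseteq> carrier A - Units A" "regular_sequence M xs" "length xs \<ge> 1"
    unfolding depth_def by (elim enat_Sup_ge_1E) (auto simp: one_enat_def)
  define x where "x = xs ! 0"
  have "x \<in> set xs"
    using xs(3) by (auto simp: x_def intro!: nth_mem)
  then have x: "x \<in> carrier A" "fps_nth x 0 = 0"
    using xs(1) Units_A by blast+
  have reg: "u = \<zero>\<^bsub>M\<^esub>" if "u \<in> carrier M" "x \<odot>\<^bsub>M\<^esub> u = \<zero>\<^bsub>M\<^esub>" for u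
    using xs(2,3) that unfolding regular_sequence_def x_def by fastforce
  have reg_power: "u = \<zero>\<^bsub>M\<^esub>" if "u \<in> carrier M" "x ^ n \<odot>\<^bsub>M\<^esub> u = \<zero>\<^bsub>M\<^esub>" for u n
    using that
  proof (induction n)
    case 0
    then show ?case using M.smult_one by simp
  next
    case (Suc n)
    then have "x \<odot>\<^bsub>M\<^esub> (x ^ n \<odot>\<^bsub>M\<^esub> u) = \<zero>\<^bsub>M\<^esub>"
      using x M.smult_assoc1[of x "x ^ n" u] by simp
    then have "x ^ n \<odot>\<^bsub>M\<^esub> u = \<zero>\<^bsub>M\<^esub>"
      by (rule reg[rotated]) (use Suc.prems x in auto)
    then show ?case
      using Suc.IH Suc.prems(1) by blast
  qed
  \<comment> \<open>\<open>x\<close> has no constant term, so its n-th power has order at least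
    n.\<close>
  obtain b where b: "b \<in> carrier A" "x ^ (subdegree y + cnd) = b * y"
    by (rule high_order_multiple[OF y(2), of "x ^ (subdegree y + cnd)"])
       (use power_nth_below[OF x(2)] in auto)
  have "x ^ (subdegree y + cnd) \<odot>\<^bsub>M\<^esub> m = \<zero>\<^bsub>M\<^esub>"
    using M.smult_assoc1[of b y m] b y m by simp
  then show ?thesis
    using reg_power m by blast
qed

end

section \<open>Ideals, quotients and homomorphisms as modules\<close>

lemma regular_module_simps [simp]:
  "carrier (regular_module R) = carrier R" "add (regular_module R) = add R"
  "\<zero>\<^bsub>regular_module R\<^esub> = \<zero>\<^bsub>R\<^esub>" "smult (regular_module R) = mult R"
  by (simp_all add: regular_module_def)

lemma regular_module:
  assumes "cring R" shows "module R (regular_module R)"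
proof -
  interpret cring R by fact
  show ?thesis
  proof (rule moduleI)
    show "cring R" by (rule is_cring)
    show "abelian_group (regular_module R)"
      by (rule abelian_groupI) (auto simp: a_ac intro: l_neg)
  qed (auto simp: m_assoc l_distr r_distr)
qed

lemma ideal_submodule:
  assumes "cring R" "ideal I R" shows "submodule I R (regular_module R)"
proof -
  interpret cring R by fact
  interpret I: ideal I R by fact
  interpret M: module R "regular_module R" by (rule regular_module[OF assms(1)])
  show ?thesis
  proof (rule M.submoduleI)
    have "\<ominus>\<^bsub>regular_module R\<^esub> a = \<ominus>\<^bsub>R\<^esub> a" if "a \<in> I" for a
      by (rule M.M.minus_equality) (use that in \<open>auto simp: l_neg\<close>)
    then show "\<ominus>\<^bsub>regular_module R\<^esub> a \<in> I" if "a \<in> I" for a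
      using that I.a_inv_closed by simp
  qed (use I.I_l_closed in auto)
qed

text \<open>Evaluating an extension to the whole ring at 1 gives the element. Later uses of
  injectivity all go through this ideal form.\<close>

lemma injective_module_extend_ideal:
  assumes E: "injective_module R E" and I: "ideal I R"
    and g: "g \<in> module_hom R (regular_module R\<lparr>carrier := I\<rparr>) E"
  shows "\<exists>z\<in>carrier E. \<forall>a\<in>I. g a = a \<odot>\<^bsub>E\<^esub> z"
proof -
  have "module R E"
    using E by (simp add: injective_module_def)
  then interpret E: module R E .
  have IR: "I \<subseteq> carrier R"
    using I by (meson additive_subgroup.a_subset ideal_def)
  have "module R (regular_module R\<lparr>carrier := I\<rparr>)"
    using submodule.submodule_is_module ideal_submodule[OF E.R.is_cring I] regular_module[OF E.R.is_cring] by blast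
  moreover have "id \<in> module_hom R (regular_module R\<lparr>carrier := I\<rparr>) (regular_module R)"
    using IR by (auto intro!: module_homI)
  ultimately have "\<exists>h\<in>module_hom R (regular_module R) E. \<forall>x\<in>carrier (regular_module R\<lparr>carrier := I\<rparr>). h (id x) = g x"
    using E g regular_module[OF E.R.is_cring] unfolding injective_module_def by (metis inj_on_id)
  then obtain h where h: "h \<in> module_hom R (regular_module R) E" "\<And>a. a \<in> I \<Longrightarrow> h a = g a"
    by auto
  have "g a = a \<odot>\<^bsub>E\<^esub> h \<one>\<^bsub>R\<^esub>" if "a \<in> I" for a
  proof -
    have "g a = h (a \<otimes>\<^bsub>R\<^esub> \<one>\<^bsub>R\<^esub>)"
      using h(2)[OF that] IR that by auto
    also have "\<dots> = a \<odot>\<^bsub>E\<^esub> h \<one>\<^bsub>R\<^esub>"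
      using module_homD(3)[OF h(1), of a "\<one>\<^bsub>R\<^esub>"] IR that by auto
    finally show ?thesis .
  qed
  moreover have "h \<one>\<^bsub>R\<^esub> \<in> carrier E"
    using module_homD(1)[OF h(1)] by simp
  ultimately show ?thesis by blast
qed

section \<open>Quotient modules of dimension one\<close>

lemma quotient_module_abelian_monoid:
  assumes "module R M" "submodule B R M"
  shows "abelian_monoid (quotient_module M B)"
proof -
  interpret M: module R M by fact
  have "additive_subgroup B M"
    using assms(2) by (simp add: additive_subgroup_def submodule_def)
  then have "abelian_subgroup B M"
    by (rule abelian_subgroupI3) (rule M.M.abelian_group_axioms)
  then have "comm_group (M A_Mod B)"
    by (rule abelian_subgroup.a_factorgroup_is_comm_group)
  then have "Group.comm_monoid (M A_Mod B)"
    by (simp add: comm_group_def)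
  then show ?thesis
    unfolding abelian_monoid_def
    by (simp add: quotient_module_def A_FactGroup_def FactGroup_def A_RCOSETS_def set_add_def
        Group.comm_monoid_def Group.monoid_def comm_monoid_axioms_def) metis
qed

lemma quotient_module_smult_coset:
  assumes "module R M" "submodule B R M" "c \<in> carrier R" "b \<in> carrier M"
  shows "c \<odot>\<^bsub>quotient_module M B\<^esub> (B +>\<^bsub>M\<^esub> b) = B +>\<^bsub>M\<^esub> (c \<odot>\<^bsub>M\<^esub> b)"
proof -
  interpret M: module R M by fact
  note BE = M.submoduleE[OF assms(2)]
  have B0: "\<zero>\<^bsub>M\<^esub> \<in> B"
    using BE(2,4) BE(1) M.R.zero_closed M.smult_l_null by (metis ex_in_conv subsetD)
  have coset: "X +>\<^bsub>M\<^esub> u = {v \<oplus>\<^bsub>M\<^esub> u | v. v \<in> X}" for X u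
    by (auto simp: a_r_coset_def r_coset_def)
  have sum: "X <+>\<^bsub>M\<^esub> Y = {u \<oplus>\<^bsub>M\<^esub> v | u v. u \<in> X \<and> v \<in> Y}" for X Y
    by (auto simp: set_add_def set_mult_def)
  have "B <+>\<^bsub>M\<^esub> (\<lambda>x. c \<odot>\<^bsub>M\<^esub> x) ` (B +>\<^bsub>M\<^esub> b) = B +>\<^bsub>M\<^esub> (c \<odot>\<^bsub>M\<^esub> b)"
  proof (intro equalityI subsetI)
    fix w assume "w \<in> B <+>\<^bsub>M\<^esub> (\<lambda>x. c \<odot>\<^bsub>M\<^esub> x) ` (B +>\<^bsub>M\<^esub> b)"
    then obtain u v where uv: "u \<in> B" "v \<in> B" "w = u \<oplus>\<^bsub>M\<^esub> c \<odot>\<^bsub>M\<^esub> (v \<oplus>\<^bsub>M\<^esub> b)"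
      unfolding sum coset by blast
    then have "w = (u \<oplus>\<^bsub>M\<^esub> c \<odot>\<^bsub>M\<^esub> v) \<oplus>\<^bsub>M\<^esub> c \<odot>\<^bsub>M\<^esub> b"
      using assms(3,4) subsetD[OF BE(1)] by (simp add: M.smult_r_distr M.M.a_assoc)
    then show "w \<in> B +>\<^bsub>M\<^esub> (c \<odot>\<^bsub>M\<^esub> b)"
      using uv BE(4,5) assms(3) unfolding coset by blast
  next
    fix w assume "w \<in> B +>\<^bsub>M\<^esub> (c \<odot>\<^bsub>M\<^esub> b)"
    then obtain u where "u \<in> B" "w = u \<oplus>\<^bsub>M\<^esub> c \<odot>\<^bsub>M\<^esub> b"
      unfolding coset by blast
    moreover have "b = \<zero>\<^bsub>M\<^esub> \<oplus>\<^bsub>M\<^esub> b"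
      using assms(4) by simp
    ultimately show "w \<in> B <+>\<^bsub>M\<^esub> (\<lambda>x. c \<odot>\<^bsub>M\<^esub> x) ` (B +>\<^bsub>M\<^esub> b)"
      using B0 unfolding sum coset by blast
  qed
  then show ?thesis
    by (simp add: quotient_module_def)
qed

text \<open>A one-element basis consists of a coset, and \<open>b\<close> represents it. It lies
  outside \<open>B\<close> because otherwise the coefficients 0 and 1 would both represent the zero
  coset, against uniqueness.\<close>

lemma has_dimension_one_quotient:
  assumes M: "module R M" and B: "submodule B R M"
    and K: "K \<subseteq> carrier R" "\<zero>\<^bsub>R\<^esub> \<in> K" "\<one>\<^bsub>R\<^esub> \<in> K" "\<zero>\<^bsub>R\<^esub> \<noteq> \<one>\<^bsub>R\<^esub>"
    and dim: "has_dimension (R\<lparr>carrier := K\<rparr>) (quotient_module M B) 1"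
  obtains b where "b \<in> carrier M" "b \<notin> B"
    "\<And>v. v \<in> carrier M \<Longrightarrow> \<exists>c\<in>K. \<exists>\<beta>\<in>B. v = \<beta> \<oplus>\<^bsub>M\<^esub> c \<odot>\<^bsub>M\<^esub> b"
proof -
  interpret M: module R M by fact
  interpret V: abelian_monoid "quotient_module M B"
    by (rule quotient_module_abelian_monoid[OF M B])
  note BE = M.submoduleE[OF B]
  have carV: "carrier (quotient_module M B) = {B +>\<^bsub>M\<^esub> u | u. u \<in> carrier M}"
    by (auto simp: quotient_module_def A_RCOSETS_def RCOSETS_def a_r_coset_def)
  have coset: "B +>\<^bsub>M\<^esub> u = {v \<oplus>\<^bsub>M\<^esub> u | v. v \<in> B}" for u
    by (auto simp: a_r_coset_def r_coset_def)
  have B0: "\<zero>\<^bsub>M\<^esub> \<in> B"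
    using BE(2,4) BE(1) M.R.zero_closed M.smult_l_null by (metis ex_in_conv subsetD)
  have self: "u \<in> B +>\<^bsub>M\<^esub> u" if "u \<in> carrier M" for u
    using that B0 M.M.l_zero[OF that] unfolding coset by (metis (mono_tags, lifting) mem_Collect_eq)
  obtain b0 where b0: "b0 \<in> carrier (quotient_module M B)"
    and ex1: "\<And>v. v \<in> carrier (quotient_module M B) \<Longrightarrow>
      \<exists>!c. c \<in> {b0} \<rightarrow>\<^sub>E K \<and> v = finsum (quotient_module M B) (\<lambda>b. c b \<odot>\<^bsub>quotient_module M B\<^esub> b) {b0}"
    using dim unfolding has_dimension_def by (auto simp: card_1_singleton_iff)
  define S where "S c = finsum (quotient_module M B) (\<lambda>b. c b \<odot>\<^bsub>quotient_module M B\<^esub> b) {b0}" for c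
  have ex: "\<exists>c. c \<in> {b0} \<rightarrow>\<^sub>E K \<and> v = S c" if "v \<in> carrier (quotient_module M B)" for v
    using ex1[OF that] unfolding S_def by (rule ex1_implies_ex)
  have uniq: "c = c'" if "v \<in> carrier (quotient_module M B)"
    "c \<in> {b0} \<rightarrow>\<^sub>E K" "v = S c" "c' \<in> {b0} \<rightarrow>\<^sub>E K" "v = S c'" for v c c'
    using ex1[OF that(1)] that(2-5) unfolding S_def[symmetric] by (metis (no_types))
  obtain b where b: "b \<in> carrier M" "b0 = B +>\<^bsub>M\<^esub> b"
    using b0 carV by blast
  have fs: "S c = B +>\<^bsub>M\<^esub> (c b0 \<odot>\<^bsub>M\<^esub> b)"
    if "c \<in> {b0} \<rightarrow>\<^sub>E K" for c
  proof -
    have c: "c b0 \<in> carrier R"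
      using that K(1) by auto
    have eq: "c b0 \<odot>\<^bsub>quotient_module M B\<^esub> b0 = B +>\<^bsub>M\<^esub> (c b0 \<odot>\<^bsub>M\<^esub> b)"
      unfolding b(2) by (rule quotient_module_smult_coset[OF M B]) (use c b in auto)
    moreover have "B +>\<^bsub>M\<^esub> (c b0 \<odot>\<^bsub>M\<^esub> b) \<in> carrier (quotient_module M B)"
      using carV c b(1) by blast
    ultimately show ?thesis
      unfolding S_def by (subst V.finsum_insert) auto
  qed
  show thesis
  proof (rule that)
    show "b \<in> carrier M" by fact
    show "b \<notin> B"
    proof
      assume "b \<in> B"
      have "B +>\<^bsub>M\<^esub> (c \<odot>\<^bsub>M\<^esub> b) = B +>\<^bsub>M\<^esub> \<zero>\<^bsub>M\<^esub>" if "c \<in> carrier R" for c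
      proof -
        have cb: "c \<odot>\<^bsub>M\<^esub> b \<in> B"
          using BE(4) that \<open>b \<in> B\<close> by blast
        show ?thesis
        proof (intro equalityI subsetI)
          fix w assume "w \<in> B +>\<^bsub>M\<^esub> (c \<odot>\<^bsub>M\<^esub> b)"
          then have "w \<in> B"
            using cb BE(5) unfolding coset by blast
          then show "w \<in> B +>\<^bsub>M\<^esub> \<zero>\<^bsub>M\<^esub>"
            using BE(1) unfolding coset by (auto intro!: exI[of _ w])
        next
          fix w assume "w \<in> B +>\<^bsub>M\<^esub> \<zero>\<^bsub>M\<^esub>"
          then have "w \<in> B"
            using B0 BE(5) unfolding coset by blast
          then have "w \<oplus>\<^bsub>M\<^esub> (\<ominus>\<^bsub>M\<^esub> (c \<odot>\<^bsub>M\<^esub> b)) \<in> B"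
            using cb BE(3,5) by blast
          moreover have "w = (w \<oplus>\<^bsub>M\<^esub> (\<ominus>\<^bsub>M\<^esub> (c \<odot>\<^bsub>M\<^esub> b))) \<oplus>\<^bsub>M\<^esub> (c \<odot>\<^bsub>M\<^esub> b)"
            using \<open>w \<in> B\<close> cb BE(1) by (simp add: M.M.a_assoc M.M.l_neg subset_iff)
          ultimately show "w \<in> B +>\<^bsub>M\<^esub> (c \<odot>\<^bsub>M\<^esub> b)"
            unfolding coset by blast
        qed
      qed
      then have "B +>\<^bsub>M\<^esub> \<zero>\<^bsub>M\<^esub> = S c"
        if "c \<in> {b0} \<rightarrow>\<^sub>E K" for c
        using fs[OF that] that K(1) by (auto simp: PiE_iff subset_iff)
      moreover have "B +>\<^bsub>M\<^esub> \<zero>\<^bsub>M\<^esub> \<in> carrier (quotient_module M B)"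
        unfolding carV by blast
      moreover have const_K: "(\<lambda>u\<in>{b0}. c) \<in> {b0} \<rightarrow>\<^sub>E K" if "c \<in> K" for c
        using that by auto
      ultimately have "(\<lambda>u\<in>{b0}. \<zero>\<^bsub>R\<^esub>) = (\<lambda>u\<in>{b0}. \<one>\<^bsub>R\<^esub>)"
        using uniq[of "B +>\<^bsub>M\<^esub> \<zero>\<^bsub>M\<^esub>", OF _ const_K[OF K(2)] _ const_K[OF K(3)]] const_K[OF K(2)] const_K[OF K(3)] by blast
      then show False
        using K(4) by (metis restrict_apply' singletonI)
    qed
    show "\<exists>c\<in>K. \<exists>\<beta>\<in>B. v = \<beta> \<oplus>\<^bsub>M\<^esub> c \<odot>\<^bsub>M\<^esub> b" if v: "v \<in> carrier M" for v
    proof -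
      have "B +>\<^bsub>M\<^esub> v \<in> carrier (quotient_module M B)"
        using carV v by blast
      then obtain c where c: "c \<in> {b0} \<rightarrow>\<^sub>E K"
        "B +>\<^bsub>M\<^esub> v = S c"
        using ex by blast
      then have "v \<in> B +>\<^bsub>M\<^esub> (c b0 \<odot>\<^bsub>M\<^esub> b)"
        using self[OF v] fs by simp
      moreover have "c b0 \<in> K"
        using c(1) by auto
      ultimately show ?thesis
        unfolding coset by blast
    qed
  qed
qed

section \<open>Modules of homomorphisms\<close>

lemma hom_module_simps [simp]:
  "carrier (hom_module R M N) = module_hom R M N \<inter> extensional (carrier M)"
  "\<zero>\<^bsub>hom_module R M N\<^esub> = (\<lambda>x\<in>carrier M. \<zero>\<^bsub>N\<^esub>)"
  "f \<oplus>\<^bsub>hom_module R M N\<^esub> g = (\<lambda>x\<in>carrier M. f x \<oplus>\<^bsub>N\<^esub> g x)"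
  "a \<odot>\<^bsub>hom_module R M N\<^esub> f = (\<lambda>x\<in>carrier M. a \<odot>\<^bsub>N\<^esub> f x)"
  by (simp_all add: hom_module_def)

lemma module_hom_restrict:
  assumes "module R M" "f \<in> module_hom R M N"
  shows "restrict f (carrier M) \<in> module_hom R M N \<inter> extensional (carrier M)"
proof -
  interpret M: module R M by fact
  show ?thesis
    using module_homD[OF assms(2)] by (auto intro!: module_homI)
qed

lemma module_hom_combine:
  assumes "module R M" "module R N" "f \<in> module_hom R M N" "g \<in> module_hom R M N"
  shows "(\<lambda>x. f x \<oplus>\<^bsub>N\<^esub> g x) \<in> module_hom R M N"
    and "a \<in> carrier R \<Longrightarrow> (\<lambda>x. a \<odot>\<^bsub>N\<^esub> f x) \<in> module_hom R M N"
    and "(\<lambda>x. \<zero>\<^bsub>N\<^esub>) \<in> module_hom R M N"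
proof -
  interpret M: module R M by fact
  interpret N: module R N by fact
  note f = module_homD[OF assms(3)] and g = module_homD[OF assms(4)]
  show "(\<lambda>x. f x \<oplus>\<^bsub>N\<^esub> g x) \<in> module_hom R M N"
    using f g by (intro module_homI) (auto simp: N.M.a_ac N.smult_r_distr)
  show "(\<lambda>x. \<zero>\<^bsub>N\<^esub>) \<in> module_hom R M N"
    by (intro module_homI) auto
  assume a: "a \<in> carrier R"
  have "a \<odot>\<^bsub>N\<^esub> (b \<odot>\<^bsub>N\<^esub> u) = b \<odot>\<^bsub>N\<^esub> (a \<odot>\<^bsub>N\<^esub> u)" if "b \<in> carrier R" "u \<in> carrier N" for b u
    using a that by (metis M.R.m_comm N.smult_assoc1)
  then show "(\<lambda>x. a \<odot>\<^bsub>N\<^esub> f x) \<in> module_hom R M N"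
    using a f by (intro module_homI) (auto simp: N.smult_r_distr)
qed

lemma hom_module_module:
  assumes M: "module R M" and N: "module R N"
  shows "module R (hom_module R M N)"
proof -
  interpret M: module R M by fact
  interpret N: module R N by fact
  note comb = module_hom_combine[OF M N] and rs = module_hom_restrict[OF M]
  show ?thesis
  proof (rule moduleI)
    show "cring R" by (rule M.R.is_cring)
    show "abelian_group (hom_module R M N)"
    proof (rule abelian_groupI)
      fix f assume f: "f \<in> carrier (hom_module R M N)"
      then have fM: "f \<in> module_hom R M N" by simp
      show "\<exists>g\<in>carrier (hom_module R M N). g \<oplus>\<^bsub>hom_module R M N\<^esub> f = \<zero>\<^bsub>hom_module R M N\<^esub>"
      proof
        show "(\<lambda>x\<in>carrier M. (\<ominus>\<^bsub>R\<^esub> \<one>\<^bsub>R\<^esub>) \<odot>\<^bsub>N\<^esub> f x) \<in> carrier (hom_module R M N)"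
          using rs[OF comb(2)[OF fM fM]] by simp
        show "(\<lambda>x\<in>carrier M. (\<ominus>\<^bsub>R\<^esub> \<one>\<^bsub>R\<^esub>) \<odot>\<^bsub>N\<^esub> f x) \<oplus>\<^bsub>hom_module R M N\<^esub> f = \<zero>\<^bsub>hom_module R M N\<^esub>"
          using module_homD(1)[OF fM] by (auto simp: N.smult_l_minus N.M.l_neg)
      qed
      show "\<zero>\<^bsub>hom_module R M N\<^esub> \<oplus>\<^bsub>hom_module R M N\<^esub> f = f"
        using f module_homD(1)[OF fM] by (auto simp: extensional_def)
      fix g assume g: "g \<in> carrier (hom_module R M N)"
      then have gM: "g \<in> module_hom R M N" by simp
      show "f \<oplus>\<^bsub>hom_module R M N\<^esub> g \<in> carrier (hom_module R M N)"
        using rs[OF comb(1)[OF fM gM]] by simp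
      show "f \<oplus>\<^bsub>hom_module R M N\<^esub> g = g \<oplus>\<^bsub>hom_module R M N\<^esub> f"
        using module_homD(1)[OF fM] module_homD(1)[OF gM] by (auto simp: N.M.a_comm)
      fix h assume h: "h \<in> carrier (hom_module R M N)"
      then have hM: "h \<in> module_hom R M N" by simp
      show "f \<oplus>\<^bsub>hom_module R M N\<^esub> g \<oplus>\<^bsub>hom_module R M N\<^esub> h = f \<oplus>\<^bsub>hom_module R M N\<^esub> (g \<oplus>\<^bsub>hom_module R M N\<^esub> h)"
        using module_homD(1)[OF fM] module_homD(1)[OF gM] module_homD(1)[OF hM]
        by (auto simp: N.M.a_assoc)
    next
      show "\<zero>\<^bsub>hom_module R M N\<^esub> \<in> carrier (hom_module R M N)"
        by (auto intro!: module_homI)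
    qed
  next
    fix f assume "f \<in> carrier (hom_module R M N)"
    then show "\<one>\<^bsub>R\<^esub> \<odot>\<^bsub>hom_module R M N\<^esub> f = f"
      using module_homD(1)[of f R M N] by (auto simp: extensional_def)
  next
    fix a f assume a: "a \<in> carrier R" and f: "f \<in> carrier (hom_module R M N)"
    then have fM: "f \<in> module_hom R M N" by simp
    note f1 = module_homD(1)[OF fM]
    show "a \<odot>\<^bsub>hom_module R M N\<^esub> f \<in> carrier (hom_module R M N)"
      using rs[OF comb(2)[OF fM fM a]] by simp
    fix g assume g: "g \<in> carrier (hom_module R M N)"
    then have gM: "g \<in> module_hom R M N" by simp
    show "a \<odot>\<^bsub>hom_module R M N\<^esub> (f \<oplus>\<^bsub>hom_module R M N\<^esub> g) =
        a \<odot>\<^bsub>hom_module R M N\<^esub> f \<oplus>\<^bsub>hom_module R M N\<^esub> a \<odot>\<^bsub>hom_module R M N\<^esub> g"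
      using f1 module_homD(1)[OF gM] a by (auto simp: N.smult_r_distr)
  next
    fix a b f assume a: "a \<in> carrier R" "b \<in> carrier R" and f: "f \<in> carrier (hom_module R M N)"
    then have fM: "f \<in> module_hom R M N" by simp
    note f1 = module_homD(1)[OF fM]
    show "(a \<oplus>\<^bsub>R\<^esub> b) \<odot>\<^bsub>hom_module R M N\<^esub> f =
        a \<odot>\<^bsub>hom_module R M N\<^esub> f \<oplus>\<^bsub>hom_module R M N\<^esub> b \<odot>\<^bsub>hom_module R M N\<^esub> f"
      using f1 a by (auto simp: N.smult_l_distr)
    show "(a \<otimes>\<^bsub>R\<^esub> b) \<odot>\<^bsub>hom_module R M N\<^esub> f = a \<odot>\<^bsub>hom_module R M N\<^esub> (b \<odot>\<^bsub>hom_module R M N\<^esub> f)"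
      using f1 a by (auto simp: N.smult_assoc1)
  qed
qed

section \<open>The socle of the canonical module\<close>

lemma residue_module_simps [simp]:
  "carrier residue_module = UNIV" "add residue_module = (+)" "\<zero>\<^bsub>residue_module\<^esub> = 0"
  "a \<odot>\<^bsub>residue_module\<^esub> c = fps_nth a 0 * c"
  by (simp_all add: residue_module_def)

context monomial_ring
begin

abbreviation xc :: "'k fps" where "xc \<equiv> fps_X ^ cnd"

lemma xc: "xc \<in> carrier A" "fps_nth xc 0 = 0" "xc \<noteq> 0"
  using cnd_pos ge_cnd_in[of cnd] by auto

lemma residue_module: "module A residue_module"
proof (rule moduleI)
  show "abelian_group (residue_module :: ('k fps, 'k) module)"
  proof (rule abelian_groupI)
    show "\<exists>y\<in>carrier residue_module. y \<oplus>\<^bsub>residue_module\<^esub> x = \<zero>\<^bsub>residue_module\<^esub>" for x :: 'k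
      by (intro bexI[of _ "- x"]) auto
  qed (auto simp: add_ac)
qed (auto simp: cring_A algebra_simps)

definition torsion_free :: "('k fps, 'm) module \<Rightarrow> bool" where
  "torsion_free M \<longleftrightarrow>
     (\<forall>a\<in>carrier A. \<forall>m\<in>carrier M. a \<noteq> 0 \<longrightarrow> a \<odot>\<^bsub>M\<^esub> m = \<zero>\<^bsub>M\<^esub> \<longrightarrow> m = \<zero>\<^bsub>M\<^esub>)"

lemma torsion_free_cancel:
  assumes "module A M" "torsion_free M" "a \<in> carrier A" "a \<noteq> 0" "u \<in> carrier M" "v \<in> carrier M"
    "a \<odot>\<^bsub>M\<^esub> u = a \<odot>\<^bsub>M\<^esub> v"
  shows "u = v"
proof -
  interpret M: module A M by fact
  have "a \<odot>\<^bsub>M\<^esub> (u \<ominus>\<^bsub>M\<^esub> v) = \<zero>\<^bsub>M\<^esub>"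
    using assms by (simp add: M.smult_minus_r[unfolded a_minus_def] a_minus_def M.M.r_neg)
  then have "u \<ominus>\<^bsub>M\<^esub> v = \<zero>\<^bsub>M\<^esub>"
    using assms unfolding torsion_free_def by blast
  then have "u \<ominus>\<^bsub>M\<^esub> v = \<zero>\<^bsub>M\<^esub> \<ominus>\<^bsub>M\<^esub> \<zero>\<^bsub>M\<^esub>"
    by (simp add: a_minus_def M.M.r_neg)
  then have "\<zero>\<^bsub>M\<^esub> \<oplus>\<^bsub>M\<^esub> u = \<zero>\<^bsub>M\<^esub> \<oplus>\<^bsub>M\<^esub> v"
    using assms by (intro M.M.minus_eq_imp_sum_eq) auto
  then show ?thesis
    using assms by simp
qed

text \<open>The preimage in \<open>M\<close> of the socle of \<open>M / xc M\<close>.\<close>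

definition socle_mod_xc :: "('k fps, 'm) module \<Rightarrow> 'm set" where
  "socle_mod_xc M = {w \<in> carrier M. \<forall>a\<in>carrier A. fps_nth a 0 = 0 \<longrightarrow>
     (\<exists>u\<in>carrier M. a \<odot>\<^bsub>M\<^esub> w = xc \<odot>\<^bsub>M\<^esub> u)}"

text \<open>The class of \<open>w\<^sub>0\<close> is a basis of the socle of
  \<open>M / xc M\<close>; the second clause says that this class is nonzero.\<close>

definition socle_generator :: "('k fps, 'm) module \<Rightarrow> 'm \<Rightarrow> bool" where
  "socle_generator M w\<^sub>0 \<longleftrightarrow> w\<^sub>0 \<in> socle_mod_xc M \<and>
     (\<forall>u\<in>carrier M. w\<^sub>0 \<noteq> xc \<odot>\<^bsub>M\<^esub> u) \<and>
     (\<forall>w\<in>socle_mod_xc M. \<exists>c. \<exists>u\<in>carrier M. w = fps_const c \<odot>\<^bsub>M\<^esub> w\<^sub>0 \<oplus>\<^bsub>M\<^esub> xc \<odot>\<^bsub>M\<^esub> u)"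

lemma maximal_ideal: "ideal {f \<in> carrier A. fps_nth f 0 = 0} A"
  using primeideal_max by (simp add: primeideal_def)

lemma residue_hom_eq:
  assumes "\<phi> \<in> module_hom A residue_module N"
  shows "\<phi> c = fps_const c \<odot>\<^bsub>N\<^esub> \<phi> 1"
  using module_homD(3)[OF assms, of "fps_const c" 1] by simp

lemma residue_hom_killed:
  assumes "module A N" "\<phi> \<in> module_hom A residue_module N" "a \<in> carrier A" "fps_nth a 0 = 0"
  shows "a \<odot>\<^bsub>N\<^esub> \<phi> 1 = \<zero>\<^bsub>N\<^esub>"
  using module_homD(3)[OF assms(2,3), of 1] module_hom_zero[OF residue_module assms(1,2)] assms(4)
  by simp

text \<open>Elements killed by the maximal ideal are the images of 1 under homomorphisms from k,
  because a scalar differs from its constant term by an element of that ideal.\<close>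

lemma residue_homI:
  assumes N: "module A N" and s: "s \<in> carrier N"
    and kill: "\<And>a. a \<in> carrier A \<Longrightarrow> fps_nth a 0 = 0 \<Longrightarrow> a \<odot>\<^bsub>N\<^esub> s = \<zero>\<^bsub>N\<^esub>"
  shows "(\<lambda>c. fps_const c \<odot>\<^bsub>N\<^esub> s) \<in> module_hom A residue_module N"
proof -
  interpret N: module A N by fact
  show ?thesis
  proof (rule module_homI)
    fix c d :: 'k
    show "fps_const c \<odot>\<^bsub>N\<^esub> s \<in> carrier N"
      using s by simp
    show "fps_const (c \<oplus>\<^bsub>residue_module\<^esub> d) \<odot>\<^bsub>N\<^esub> s = fps_const c \<odot>\<^bsub>N\<^esub> s \<oplus>\<^bsub>N\<^esub> fps_const d \<odot>\<^bsub>N\<^esub> s"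
      using N.smult_l_distr[of "fps_const c" "fps_const d" s] s by simp
    fix a :: "'k fps" assume a: "a \<in> carrier A"
    define b where "b = (a - fps_const (fps_nth a 0)) * fps_const c"
    have b: "b \<in> carrier A" "fps_nth b 0 = 0"
      using a by (auto simp: b_def)
    have "a \<odot>\<^bsub>N\<^esub> (fps_const c \<odot>\<^bsub>N\<^esub> s) = (a * fps_const c) \<odot>\<^bsub>N\<^esub> s"
      using N.smult_assoc1[of a "fps_const c" s] a s by simp
    also have "a * fps_const c = b + fps_const (fps_nth a 0 * c)"
      by (simp add: b_def algebra_simps)
    also have "\<dots> \<odot>\<^bsub>N\<^esub> s = b \<odot>\<^bsub>N\<^esub> s \<oplus>\<^bsub>N\<^esub> fps_const (fps_nth a 0 * c) \<odot>\<^bsub>N\<^esub> s"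
      using N.smult_l_distr[of b "fps_const (fps_nth a 0 * c)" s] b s by simp
    also have "\<dots> = fps_const (fps_nth a 0 * c) \<odot>\<^bsub>N\<^esub> s"
      using kill[OF b] s by simp
    finally show "fps_const (a \<odot>\<^bsub>residue_module\<^esub> c) \<odot>\<^bsub>N\<^esub> s = a \<odot>\<^bsub>N\<^esub> (fps_const c \<odot>\<^bsub>N\<^esub> s)"
      by simp
  qed
qed

text \<open>\<open>has_dimension_one_quotient\<close> applies once cocycles and coboundaries are
  known to be submodules of Hom(k, I 1). The result is pointwise, so that quotients and Hom records
  need not be handled again.\<close>

lemma ext_one_dim_cocycle:
  assumes res: "injective_resolution A M \<epsilon> I d"
    and dim: "has_dimension (A\<lparr>carrier := base_field\<rparr>)
      (quotient_module ((hom_module A residue_module (I 1))\<lparr>carrier := hom_cocycles A residue_module I d 1\<rparr>)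
         (hom_coboundaries A residue_module I d 1)) 1"
  obtains \<phi> where "\<phi> \<in> hom_cocycles A residue_module I d 1"
    "\<phi> \<notin> hom_coboundaries A residue_module I d 1"
    "\<And>\<psi>. \<psi> \<in> hom_cocycles A residue_module I d 1 \<Longrightarrow>
      \<exists>c. \<exists>\<beta>\<in>hom_coboundaries A residue_module I d 1. \<forall>s. \<psi> s = \<beta> s \<oplus>\<^bsub>I 1\<^esub> fps_const c \<odot>\<^bsub>I 1\<^esub> \<phi> s"
proof -
  define H where "H = hom_module A residue_module (I 1)"
  define Z where "Z = hom_cocycles A residue_module I d 1"
  define B where "B = hom_coboundaries A residue_module I d 1"
  have inj: "injective_module A (I i)" for i
    using res by (simp add: injective_resolution_def)
  then have I: "module A (I i)" for i
    by (simp add: injective_module_def)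
  interpret I0: module A "I 0" by (rule I)
  interpret I1: module A "I 1" by (rule I)
  interpret I2: module A "I 2" by (rule I)
  have d: "d i \<in> module_hom A (I i) (I (Suc i))" for i
    using res by (simp add: injective_resolution_def)
  have d0: "d 0 \<in> module_hom A (I 0) (I 1)" and d1: "d 1 \<in> module_hom A (I 1) (I 2)"
    using d[of 0] d[of 1] by (simp_all add: numeral_2_eq_2)
  have "d 0 ` carrier (I 0) = {x \<in> carrier (I 1). d 1 x = \<zero>\<^bsub>I 2\<^esub>}"
    using res unfolding injective_resolution_def by (metis One_nat_def numeral_2_eq_2)
  then have dd: "d 1 (d 0 u) = \<zero>\<^bsub>I 2\<^esub>" if "u \<in> carrier (I 0)" for u
    using that by blast
  have HM: "module A H"
    unfolding H_def by (rule hom_module_module[OF residue_module I])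
  interpret H: module A H by (rule HM)
  have Zdef: "Z = {\<phi> \<in> module_hom A residue_module (I 1). \<forall>s. d 1 (\<phi> s) = \<zero>\<^bsub>I 2\<^esub>}"
    unfolding Z_def hom_cocycles_def by (simp add: numeral_2_eq_2 extensional_def)
  have Bdef: "B = {(\<lambda>s. d 0 (\<psi> s)) | \<psi>. \<psi> \<in> module_hom A residue_module (I 0)}"
  proof -
    have "(\<lambda>s\<in>UNIV. d 0 (\<psi> s)) = (\<lambda>s. d 0 (\<psi> s))" for \<psi> :: "'k \<Rightarrow> _"
      by auto
    then show ?thesis
      unfolding B_def by (auto simp: extensional_def)
  qed
  have BI: "(\<lambda>s. d 0 (\<psi> s)) \<in> B" if "\<psi> \<in> module_hom A residue_module (I 0)" for \<psi>
    unfolding Bdef mem_Collect_eq using that by (rule exI[of _ \<psi>, OF conjI[OF refl]])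
  have Hadd: "f \<oplus>\<^bsub>H\<^esub> g = (\<lambda>s. f s \<oplus>\<^bsub>I 1\<^esub> g s)" and Hsm: "a \<odot>\<^bsub>H\<^esub> f = (\<lambda>s. a \<odot>\<^bsub>I 1\<^esub> f s)"
    and Hz: "\<zero>\<^bsub>H\<^esub> = (\<lambda>s. \<zero>\<^bsub>I 1\<^esub>)" and Hc: "carrier H = module_hom A residue_module (I 1)" for f g a
    unfolding H_def by (auto simp: extensional_def)
  have Hinv: "\<ominus>\<^bsub>H\<^esub> f = (\<ominus>\<^bsub>A\<^esub> \<one>\<^bsub>A\<^esub>) \<odot>\<^bsub>H\<^esub> f" if "f \<in> carrier H" for f
    using H.smult_l_minus[of "\<one>\<^bsub>A\<^esub>" f] H.smult_one[OF that] that by simp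
  have m1: "(\<ominus>\<^bsub>A\<^esub> \<one>\<^bsub>A\<^esub>) \<in> carrier A" by (rule A.a_inv_closed) simp
  have Zsm: "a \<odot>\<^bsub>H\<^esub> f \<in> Z" if "a \<in> carrier A" "f \<in> Z" for a f
  proof -
    have "a \<odot>\<^bsub>H\<^esub> f \<in> carrier H"
      using that unfolding Zdef Hc[symmetric] by blast
    then show ?thesis
      using that module_homD(1)[of f A residue_module "I 1"] module_homD(3)[OF d1]
      unfolding Zdef Hc Hsm by simp
  qed
  have ZH: "submodule Z A H"
  proof (rule H.submoduleI)
    show "Z \<subseteq> carrier H"
      unfolding Zdef Hc by blast
    then show "\<ominus>\<^bsub>H\<^esub> f \<in> Z" if "f \<in> Z" for f
      using Hinv Zsm[OF m1] that by auto
    show "\<zero>\<^bsub>H\<^esub> \<in> Z"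
    proof -
      have "\<zero>\<^bsub>H\<^esub> \<in> module_hom A residue_module (I 1)"
        using H.M.zero_closed Hc by simp
      then show ?thesis
        unfolding Zdef Hz using module_hom_zero[OF I I d1] by simp
    qed
    show "f \<oplus>\<^bsub>H\<^esub> g \<in> Z" if "f \<in> Z" "g \<in> Z" for f g
    proof -
      have "f \<oplus>\<^bsub>H\<^esub> g \<in> carrier H"
        using that unfolding Zdef Hc[symmetric] by blast
      then show ?thesis
        using that module_homD(1)[of f A residue_module "I 1"] module_homD(1)[of g A residue_module "I 1"]
          module_homD(2)[OF d1]
        unfolding Zdef Hc Hadd by simp
    qed
  qed (use Zsm in auto)
  have ZM: "module A (H\<lparr>carrier := Z\<rparr>)"
    by (rule submodule.submodule_is_module[OF ZH HM])
  have Bsm: "a \<odot>\<^bsub>H\<^esub> f \<in> B" if a: "a \<in> carrier A" and f: "f \<in> B" for a f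
  proof -
    obtain \<psi> where psi: "\<psi> \<in> module_hom A residue_module (I 0)" "f = (\<lambda>s. d 0 (\<psi> s))"
      using f unfolding Bdef by blast
    have "(\<lambda>s. a \<odot>\<^bsub>I 0\<^esub> \<psi> s) \<in> module_hom A residue_module (I 0)"
      by (rule module_hom_combine(2)[OF residue_module I psi(1) psi(1) a])
    moreover have "a \<odot>\<^bsub>H\<^esub> f = (\<lambda>s. d 0 (a \<odot>\<^bsub>I 0\<^esub> \<psi> s))"
      unfolding Hsm psi(2) using module_homD(3)[OF d0 a] module_homD(1)[OF psi(1)] by simp
    ultimately show ?thesis
      using BI by simp
  qed
  have Badd: "f \<oplus>\<^bsub>H\<^esub> g \<in> B" if f: "f \<in> B" and g: "g \<in> B" for f g
  proof -
    obtain \<psi> where psi: "\<psi> \<in> module_hom A residue_module (I 0)" "f = (\<lambda>s. d 0 (\<psi> s))"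
      using f unfolding Bdef by blast
    obtain \<chi> where chi: "\<chi> \<in> module_hom A residue_module (I 0)" "g = (\<lambda>s. d 0 (\<chi> s))"
      using g unfolding Bdef by blast
    have "(\<lambda>s. \<psi> s \<oplus>\<^bsub>I 0\<^esub> \<chi> s) \<in> module_hom A residue_module (I 0)"
      by (rule module_hom_combine(1)[OF residue_module I psi(1) chi(1)])
    moreover have "f \<oplus>\<^bsub>H\<^esub> g = (\<lambda>s. d 0 (\<psi> s \<oplus>\<^bsub>I 0\<^esub> \<chi> s))"
      unfolding Hadd psi(2) chi(2) using module_homD(2)[OF d0] module_homD(1)[OF psi(1)]
        module_homD(1)[OF chi(1)] by simp
    ultimately show ?thesis
      using BI by simp
  qed
  have BZ: "B \<subseteq> Z"
  proof
    fix f assume "f \<in> B"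
    then obtain \<psi> where psi: "\<psi> \<in> module_hom A residue_module (I 0)" "f = (\<lambda>s. d 0 (\<psi> s))"
      unfolding Bdef by blast
    then show "f \<in> Z"
      using module_hom_compose[OF psi(1) d0] dd module_homD(1)[OF psi(1)] unfolding Zdef by simp
  qed
  have B0: "\<zero>\<^bsub>H\<^esub> \<in> B"
  proof -
    have "(\<lambda>s. \<zero>\<^bsub>I 0\<^esub>) \<in> module_hom A residue_module (I 0)"
      by (intro module_homI) auto
    moreover have "\<zero>\<^bsub>H\<^esub> = (\<lambda>s. d 0 \<zero>\<^bsub>I 0\<^esub>)"
      unfolding Hz using module_hom_zero[OF I I d0] by simp
    ultimately show ?thesis
      using BI by simp
  qed
  have BH: "submodule B A H"
  proof (rule H.submoduleI)
    show "B \<subseteq> carrier H"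
      using BZ H.submoduleE(1)[OF ZH] by blast
    then show "\<ominus>\<^bsub>H\<^esub> f \<in> B" if "f \<in> B" for f
      using Hinv Bsm[OF m1] that by auto
  qed (use B0 Bsm Badd in auto)
  have "module A (H\<lparr>carrier := Z, carrier := B\<rparr>)"
    using submodule.submodule_is_module[OF BH HM] by simp
  then have BZM: "submodule B A (H\<lparr>carrier := Z\<rparr>)"
    by (rule module.module_incl_imp_submodule[OF ZM, rotated]) (use BZ in simp)
  have dim': "has_dimension (A\<lparr>carrier := base_field\<rparr>) (quotient_module (H\<lparr>carrier := Z\<rparr>) B) 1"
    using dim unfolding H_def Z_def B_def .
  have K: "base_field \<subseteq> carrier A" "\<zero>\<^bsub>A\<^esub> \<in> base_field" "\<one>\<^bsub>A\<^esub> \<in> base_field" "\<zero>\<^bsub>A\<^esub> \<noteq> \<one>\<^bsub>A\<^esub>"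
    by (auto simp: base_field_def image_iff intro: exI[of _ 0] exI[of _ 1])
  obtain \<phi> where "\<phi> \<in> carrier (H\<lparr>carrier := Z\<rparr>)" "\<phi> \<notin> B"
    "\<And>\<psi>. \<psi> \<in> carrier (H\<lparr>carrier := Z\<rparr>) \<Longrightarrow>
      \<exists>c\<in>base_field. \<exists>\<beta>\<in>B. \<psi> = \<beta> \<oplus>\<^bsub>H\<lparr>carrier := Z\<rparr>\<^esub> c \<odot>\<^bsub>H\<lparr>carrier := Z\<rparr>\<^esub> \<phi>"
    by (rule has_dimension_one_quotient[OF ZM BZM K dim']) (rule that)
  then have phi: "\<phi> \<in> Z" "\<phi> \<notin> B"
    "\<And>\<psi>. \<psi> \<in> Z \<Longrightarrow> \<exists>c\<in>base_field. \<exists>\<beta>\<in>B. \<psi> = \<beta> \<oplus>\<^bsub>H\<^esub> c \<odot>\<^bsub>H\<^esub> \<phi>"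
    by simp_all
  show thesis
  proof (rule that)
    show "\<phi> \<in> hom_cocycles A residue_module I d 1" "\<phi> \<notin> hom_coboundaries A residue_module I d 1"
      using phi unfolding Z_def B_def by auto
    fix \<psi> assume "\<psi> \<in> hom_cocycles A residue_module I d 1"
    then obtain c \<beta> where "\<beta> \<in> B" "\<psi> = \<beta> \<oplus>\<^bsub>H\<^esub> fps_const c \<odot>\<^bsub>H\<^esub> \<phi>"
      using phi(3) unfolding Z_def[symmetric] base_field_def by blast
    then show "\<exists>c. \<exists>\<beta>\<in>hom_coboundaries A residue_module I d 1.
        \<forall>s. \<psi> s = \<beta> s \<oplus>\<^bsub>I 1\<^esub> fps_const c \<odot>\<^bsub>I 1\<^esub> \<phi> s"
      unfolding B_def[symmetric] Hadd Hsm by (intro exI[of _ c] bexI[of _ \<beta>]) simp_all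
  qed
qed

text \<open>For the regular element \<open>xc\<close>, Ext^1(k, M) is the socle of
  \<open>M / xc M\<close>. A cocycle sends 1 to some \<open>d 0 z\<^sub>0\<close>, and
  multiplication of \<open>z\<^sub>0\<close> by \<open>xc\<close> leads into \<open>M\<close>.
  Conversely, a socle element w gives the map a \<mapsto> a w / xc from the maximal ideal to
  \<open>M\<close>, which extends to a multiplication map into the injective module
  \<open>I 0\<close>.\<close>

lemma one_dim_ext_imp_socle_generator:
  assumes M: "module A M" and tf: "torsion_free M" and res: "injective_resolution A M \<epsilon> I d"
    and dim: "has_dimension (A\<lparr>carrier := base_field\<rparr>)
      (quotient_module ((hom_module A residue_module (I 1))\<lparr>carrier := hom_cocycles A residue_module I d 1\<rparr>)
         (hom_coboundaries A residue_module I d 1)) 1"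
  shows "\<exists>w\<^sub>0. socle_generator M w\<^sub>0"
proof -
  interpret M: module A M by (rule M)
  have inj: "injective_module A (I i)" for i
    using res by (simp add: injective_resolution_def)
  then have I: "module A (I i)" for i
    by (simp add: injective_module_def)
  interpret I0: module A "I 0" by (rule I)
  interpret I1: module A "I 1" by (rule I)
  interpret I2: module A "I 2" by (rule I)
  have d: "d i \<in> module_hom A (I i) (I (Suc i))" for i
    using res by (simp add: injective_resolution_def)
  have d0: "d 0 \<in> module_hom A (I 0) (I 1)" and d1: "d 1 \<in> module_hom A (I 1) (I 2)"
    using d[of 0] d[of 1] by (simp_all add: numeral_2_eq_2)
  have im0: "d 0 ` carrier (I 0) = {x \<in> carrier (I 1). d 1 x = \<zero>\<^bsub>I 2\<^esub>}"
    using res unfolding injective_resolution_def by (metis One_nat_def numeral_2_eq_2)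
  then have dd: "d 1 (d 0 u) = \<zero>\<^bsub>I 2\<^esub>" if "u \<in> carrier (I 0)" for u
    using that by blast
  have eps: "\<epsilon> \<in> module_hom A M (I 0)" and eps_inj: "inj_on \<epsilon> (carrier M)"
    and ker0: "\<epsilon> ` carrier M = {x \<in> carrier (I 0). d 0 x = \<zero>\<^bsub>I 1\<^esub>}"
    using res by (simp_all add: injective_resolution_def)
  have eps_eq: "u = v" if "\<epsilon> u = \<epsilon> v" "u \<in> carrier M" "v \<in> carrier M" for u v
    using that eps_inj by (simp add: inj_on_def)
  have eps_c: "\<epsilon> u \<in> carrier (I 0)" and d0_eps: "d 0 (\<epsilon> u) = \<zero>\<^bsub>I 1\<^esub>" if "u \<in> carrier M" for u
    using that ker0 by blast+
  have lift: "\<exists>u\<in>carrier M. t = \<epsilon> u" if "t \<in> carrier (I 0)" "d 0 t = \<zero>\<^bsub>I 1\<^esub>" for t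
    using that ker0 by blast
  have xcancel: "u = v" if "xc \<odot>\<^bsub>M\<^esub> u = xc \<odot>\<^bsub>M\<^esub> v" "u \<in> carrier M" "v \<in> carrier M" for u v
    using torsion_free_cancel[OF M tf xc(1,3)] that by blast
  have smc: "a \<odot>\<^bsub>N\<^esub> (b \<odot>\<^bsub>N\<^esub> u) = b \<odot>\<^bsub>N\<^esub> (a \<odot>\<^bsub>N\<^esub> u)"
    if "module A N" "a \<in> carrier A" "b \<in> carrier A" "u \<in> carrier N" for N :: "('k fps, 'x) module" and a b u
    using module.smult_assoc1[OF that(1)] that(2-4) A.m_comm by metis
  obtain \<phi> where phi: "\<phi> \<in> hom_cocycles A residue_module I d 1"
    "\<phi> \<notin> hom_coboundaries A residue_module I d 1"
    and gen: "\<And>\<psi>. \<psi> \<in> hom_cocycles A residue_module I d 1 \<Longrightarrow>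
      \<exists>c. \<exists>\<beta>\<in>hom_coboundaries A residue_module I d 1. \<forall>s. \<psi> s = \<beta> s \<oplus>\<^bsub>I 1\<^esub> fps_const c \<odot>\<^bsub>I 1\<^esub> \<phi> s"
    using ext_one_dim_cocycle[OF res dim] by blast
  have phi_hom: "\<phi> \<in> module_hom A residue_module (I 1)" and phi_d: "d 1 (\<phi> 1) = \<zero>\<^bsub>I 2\<^esub>"
    using phi(1) by (simp_all add: hom_cocycles_def numeral_2_eq_2)
  have "\<phi> 1 \<in> carrier (I 1)"
    using module_homD(1)[OF phi_hom] by simp
  then have "\<phi> 1 \<in> d 0 ` carrier (I 0)"
    unfolding im0 using phi_d by simp
  then obtain z\<^sub>0 where z0: "z\<^sub>0 \<in> carrier (I 0)" "d 0 z\<^sub>0 = \<phi> 1"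
    by auto
  \<comment> \<open>A scalar of the maximal ideal kills the image of \<open>z\<^sub>0\<close> in
    \<open>I 1\<close>, so it moves \<open>z\<^sub>0\<close> into the image of
    \<open>M\<close>.\<close>
  have kill: "\<exists>u\<in>carrier M. a \<odot>\<^bsub>I 0\<^esub> z\<^sub>0 = \<epsilon> u" if "a \<in> carrier A" "fps_nth a 0 = 0" for a
    using residue_hom_killed[OF I phi_hom that] that z0 module_homD(3)[OF d0, of a z\<^sub>0]
    by (intro lift) auto
  then obtain w\<^sub>0 where w0: "w\<^sub>0 \<in> carrier M" "xc \<odot>\<^bsub>I 0\<^esub> z\<^sub>0 = \<epsilon> w\<^sub>0"
    using xc by blast
  have mult: "a \<odot>\<^bsub>M\<^esub> w\<^sub>0 = xc \<odot>\<^bsub>M\<^esub> u" if "a \<in> carrier A" "u \<in> carrier M" "a \<odot>\<^bsub>I 0\<^esub> z\<^sub>0 = \<epsilon> u" for a u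
  proof -
    have "\<epsilon> (a \<odot>\<^bsub>M\<^esub> w\<^sub>0) = xc \<odot>\<^bsub>I 0\<^esub> (a \<odot>\<^bsub>I 0\<^esub> z\<^sub>0)"
      using module_homD(3)[OF eps that(1) w0(1)] w0(2) smc[OF I that(1) xc(1) z0(1)] by simp
    also have "\<dots> = \<epsilon> (xc \<odot>\<^bsub>M\<^esub> u)"
      using module_homD(3)[OF eps xc(1) that(2)] that(3) by simp
    finally show ?thesis
      by (rule eps_eq) (use that w0 xc in auto)
  qed
  have "w\<^sub>0 \<in> socle_mod_xc M"
    using w0(1) kill mult unfolding socle_mod_xc_def by blast
  moreover have "w\<^sub>0 \<noteq> xc \<odot>\<^bsub>M\<^esub> u" if u: "u \<in> carrier M" for u
  proof
    assume w0u: "w\<^sub>0 = xc \<odot>\<^bsub>M\<^esub> u"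
    \<comment> \<open>If \<open>w\<^sub>0\<close> were \<open>xc u\<close>, then
      \<open>z\<^sub>0\<close> minus the image of \<open>u\<close> would be killed by the maximal
      ideal and give a homomorphism from k to \<open>I 0\<close> with coboundary \<phi>.\<close>
    define s where "s = z\<^sub>0 \<ominus>\<^bsub>I 0\<^esub> \<epsilon> u"
    have s: "s \<in> carrier (I 0)"
      using z0 eps_c[OF u] by (simp add: s_def)
    have "a \<odot>\<^bsub>I 0\<^esub> s = \<zero>\<^bsub>I 0\<^esub>" if a: "a \<in> carrier A" "fps_nth a 0 = 0" for a
    proof -
      obtain v where v: "v \<in> carrier M" "a \<odot>\<^bsub>I 0\<^esub> z\<^sub>0 = \<epsilon> v"
        using kill a by blast
      have "xc \<odot>\<^bsub>M\<^esub> v = xc \<odot>\<^bsub>M\<^esub> (a \<odot>\<^bsub>M\<^esub> u)"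
        using mult[OF a(1) v] smc[OF M a(1) xc(1) u] w0u by simp
      then have "v = a \<odot>\<^bsub>M\<^esub> u"
        by (rule xcancel) (use a u v in auto)
      then show ?thesis
        using v a u z0(1) eps_c[OF u] module_homD(3)[OF eps a(1) u]
        by (simp add: s_def I0.smult_minus_r a_minus_def I0.M.r_neg I0.smult_r_minus I0.smult_r_distr)
    qed
    then have "(\<lambda>c. fps_const c \<odot>\<^bsub>I 0\<^esub> s) \<in> module_hom A residue_module (I 0)"
      using residue_homI[OF I s] by blast
    moreover have "\<phi> = (\<lambda>c\<in>carrier residue_module. d 0 (fps_const c \<odot>\<^bsub>I 0\<^esub> s))"
    proof
      fix c
      have "d 0 s = \<phi> 1"
        using module_hom_minus[OF I I d0 z0(1) eps_c[OF u]] d0_eps[OF u] z0(2) \<open>\<phi> 1 \<in> carrier (I 1)\<close>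
        by (simp add: s_def a_minus_def del: One_nat_def)
      then show "\<phi> c = (\<lambda>c\<in>carrier residue_module. d 0 (fps_const c \<odot>\<^bsub>I 0\<^esub> s)) c"
        using residue_hom_eq[OF phi_hom, of c] module_homD(3)[OF d0 _ s, of "fps_const c"] by simp
    qed
    ultimately have "\<phi> \<in> hom_coboundaries A residue_module I d 1"
      by (auto simp: extensional_def)
    then show False
      using phi(2) by simp
  qed
  moreover have "\<exists>c. \<exists>u\<in>carrier M. w = fps_const c \<odot>\<^bsub>M\<^esub> w\<^sub>0 \<oplus>\<^bsub>M\<^esub> xc \<odot>\<^bsub>M\<^esub> u" if w: "w \<in> socle_mod_xc M" for w
  proof -
    define J where "J = {f \<in> carrier A. fps_nth f 0 = 0}"
    have wM: "w \<in> carrier M"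
      using w by (simp add: socle_mod_xc_def)
    have "\<exists>u\<in>carrier M. a \<odot>\<^bsub>M\<^esub> w = xc \<odot>\<^bsub>M\<^esub> u" if "a \<in> J" for a
      using w that by (simp add: socle_mod_xc_def J_def)
    \<comment> \<open>\<open>q a\<close> is a w / xc; torsion-freeness makes it unique and hence
      linear in \<open>a\<close>.\<close>
    then obtain q where q: "\<And>a. a \<in> J \<Longrightarrow> q a \<in> carrier M" "\<And>a. a \<in> J \<Longrightarrow> a \<odot>\<^bsub>M\<^esub> w = xc \<odot>\<^bsub>M\<^esub> q a"
      by metis
    have J: "ideal J A"
      unfolding J_def by (rule maximal_ideal)
    have Jc: "a \<in> carrier A" if "a \<in> J" for a
      using that by (simp add: J_def)
    have "(\<lambda>a. \<epsilon> (q a)) \<in> module_hom A (regular_module A\<lparr>carrier := J\<rparr>) (I 0)"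
    proof (rule module_homI)
      fix a assume "a \<in> carrier (regular_module A\<lparr>carrier := J\<rparr>)"
      then have a: "a \<in> J" by simp
      show "\<epsilon> (q a) \<in> carrier (I 0)"
        using q(1)[OF a] eps_c by blast
      fix b assume "b \<in> carrier (regular_module A\<lparr>carrier := J\<rparr>)"
      then have b: "b \<in> J" by simp
      have ab: "a + b \<in> J"
        using a b by (auto simp: J_def)
      have "q (a + b) = q a \<oplus>\<^bsub>M\<^esub> q b"
      proof (rule xcancel)
        show "xc \<odot>\<^bsub>M\<^esub> q (a + b) = xc \<odot>\<^bsub>M\<^esub> (q a \<oplus>\<^bsub>M\<^esub> q b)"
          using q(2)[OF ab, symmetric] q(2)[OF a] q(2)[OF b] q(1)[OF a] q(1)[OF b] xc(1)
            M.smult_l_distr[of a b w] Jc[OF a] Jc[OF b] wM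
          by (simp add: M.smult_r_distr)
      qed (use q(1) a b ab in auto)
      then show "\<epsilon> (q (a \<oplus>\<^bsub>regular_module A\<lparr>carrier := J\<rparr>\<^esub> b)) = \<epsilon> (q a) \<oplus>\<^bsub>I 0\<^esub> \<epsilon> (q b)"
        using module_homD(2)[OF eps q(1)[OF a] q(1)[OF b]] by simp
    next
      fix b a assume b: "b \<in> carrier A" and "a \<in> carrier (regular_module A\<lparr>carrier := J\<rparr>)"
      then have a: "a \<in> J" by simp
      have ba: "b * a \<in> J"
        using a b by (auto simp: J_def)
      have "q (b * a) = b \<odot>\<^bsub>M\<^esub> q a"
      proof (rule xcancel)
        have "xc \<odot>\<^bsub>M\<^esub> q (b * a) = b \<odot>\<^bsub>M\<^esub> (a \<odot>\<^bsub>M\<^esub> w)"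
          using q(2)[OF ba, symmetric] M.smult_assoc1[OF b Jc[OF a] wM] by simp
        also have "\<dots> = xc \<odot>\<^bsub>M\<^esub> (b \<odot>\<^bsub>M\<^esub> q a)"
          using q(2)[OF a] smc[OF M b xc(1) q(1)[OF a]] by simp
        finally show "xc \<odot>\<^bsub>M\<^esub> q (b * a) = xc \<odot>\<^bsub>M\<^esub> (b \<odot>\<^bsub>M\<^esub> q a)" .
      qed (use q(1) a b ba in auto)
      then show "\<epsilon> (q (b \<odot>\<^bsub>regular_module A\<lparr>carrier := J\<rparr>\<^esub> a)) = b \<odot>\<^bsub>I 0\<^esub> \<epsilon> (q a)"
        using module_homD(3)[OF eps b q(1)[OF a]] by simp
    qed
    from injective_module_extend_ideal[OF inj J this]
    obtain z where z: "z \<in> carrier (I 0)" "\<And>a. a \<in> J \<Longrightarrow> \<epsilon> (q a) = a \<odot>\<^bsub>I 0\<^esub> z"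
      by blast
    define y where "y = d 0 z"
    have y: "y \<in> carrier (I 1)"
      using z(1) module_homD(1)[OF d0] by (simp add: y_def)
    have ykill: "a \<odot>\<^bsub>I 1\<^esub> y = \<zero>\<^bsub>I 1\<^esub>" if "a \<in> carrier A" "fps_nth a 0 = 0" for a
      using module_homD(3)[OF d0 that(1) z(1)] z(2)[of a] d0_eps[OF q(1)[of a]] that
      by (simp add: y_def J_def)
    have "(\<lambda>c. fps_const c \<odot>\<^bsub>I 1\<^esub> y) \<in> hom_cocycles A residue_module I d 1"
    proof -
      have "d 1 (fps_const c \<odot>\<^bsub>I 1\<^esub> y) = \<zero>\<^bsub>I 2\<^esub>" for c
        using module_homD(3)[OF d1 _ y, of "fps_const c"] dd[OF z(1)] by (simp add: y_def)
      then show ?thesis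
        using residue_homI[OF I y ykill] by (simp add: hom_cocycles_def extensional_def numeral_2_eq_2)
    qed
    from gen[OF this] obtain c \<beta> where c: "\<beta> \<in> hom_coboundaries A residue_module I d 1"
      "fps_const 1 \<odot>\<^bsub>I 1\<^esub> y = \<beta> 1 \<oplus>\<^bsub>I 1\<^esub> fps_const c \<odot>\<^bsub>I 1\<^esub> \<phi> 1"
      by blast
    obtain \<psi> where psi: "\<psi> \<in> module_hom A residue_module (I 0)" "\<beta> 1 = d 0 (\<psi> 1)"
      using c(1) by auto
    have psi1: "\<psi> 1 \<in> carrier (I 0)"
      using module_homD(1)[OF psi(1)] by simp
    \<comment> \<open>\<open>p\<close> and \<open>z\<close> have the same image in
      \<open>I 1\<close>, so they differ by an element of \<open>M\<close>. Multiplication by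
      \<open>xc\<close> kills \<open>\<psi> 1\<close> and turns the other summand into a multiple of
      \<open>w\<^sub>0\<close>.\<close>
    define p where "p = \<psi> 1 \<oplus>\<^bsub>I 0\<^esub> fps_const c \<odot>\<^bsub>I 0\<^esub> z\<^sub>0"
    have p: "p \<in> carrier (I 0)"
      using psi1 z0 by (simp add: p_def)
    have "d 0 p = y"
      using c(2) module_homD(2)[OF d0 psi1, of "fps_const c \<odot>\<^bsub>I 0\<^esub> z\<^sub>0"]
        module_homD(3)[OF d0 _ z0(1), of "fps_const c"] z0 psi(2) I1.smult_one[OF y]
      by (simp add: p_def)
    then have "d 0 (z \<ominus>\<^bsub>I 0\<^esub> p) = \<zero>\<^bsub>I 1\<^esub>"
      using module_hom_minus[OF I I d0 z(1) p] y by (simp add: y_def a_minus_def I1.M.r_neg del: One_nat_def)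
    then obtain u where u: "u \<in> carrier M" "z \<ominus>\<^bsub>I 0\<^esub> p = \<epsilon> u"
      using lift[of "z \<ominus>\<^bsub>I 0\<^esub> p"] z(1) p by auto
    have "xc \<in> J"
      using xc by (simp add: J_def)
    have "q xc = w"
      by (rule xcancel) (use q[OF \<open>xc \<in> J\<close>] wM in auto)
    then have xz: "xc \<odot>\<^bsub>I 0\<^esub> z = \<epsilon> w"
      using z(2)[OF \<open>xc \<in> J\<close>] by simp
    have "xc \<odot>\<^bsub>I 0\<^esub> p = fps_const c \<odot>\<^bsub>I 0\<^esub> \<epsilon> w\<^sub>0"
      using residue_hom_killed[OF I psi(1) xc(1,2)] smc[OF I xc(1) _ z0(1), of "fps_const c"] w0(2) psi1 z0(1) xc(1)
        eps_c[OF w0(1)]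
      by (simp add: p_def I0.smult_r_distr)
    also have "\<dots> = \<epsilon> (fps_const c \<odot>\<^bsub>M\<^esub> w\<^sub>0)"
      using module_homD(3)[OF eps _ w0(1)] by simp
    finally have "\<epsilon> w \<ominus>\<^bsub>I 0\<^esub> \<epsilon> (fps_const c \<odot>\<^bsub>M\<^esub> w\<^sub>0) = \<epsilon> (xc \<odot>\<^bsub>M\<^esub> u)"
      using I0.smult_minus_r[OF xc(1) z(1) p] xz u module_homD(3)[OF eps xc(1) u(1)] by simp
    then have "\<epsilon> (w \<ominus>\<^bsub>M\<^esub> fps_const c \<odot>\<^bsub>M\<^esub> w\<^sub>0) = \<epsilon> (xc \<odot>\<^bsub>M\<^esub> u)"
      using module_hom_minus[OF M I eps wM, of "fps_const c \<odot>\<^bsub>M\<^esub> w\<^sub>0"] w0(1) by simp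
    then have "w \<ominus>\<^bsub>M\<^esub> fps_const c \<odot>\<^bsub>M\<^esub> w\<^sub>0 = xc \<odot>\<^bsub>M\<^esub> u"
      by (rule eps_eq) (use wM w0(1) u xc in auto)
    then have "w \<ominus>\<^bsub>M\<^esub> fps_const c \<odot>\<^bsub>M\<^esub> w\<^sub>0 = xc \<odot>\<^bsub>M\<^esub> u \<ominus>\<^bsub>M\<^esub> \<zero>\<^bsub>M\<^esub>"
      using u xc by (simp add: a_minus_def)
    then have "\<zero>\<^bsub>M\<^esub> \<oplus>\<^bsub>M\<^esub> w = xc \<odot>\<^bsub>M\<^esub> u \<oplus>\<^bsub>M\<^esub> fps_const c \<odot>\<^bsub>M\<^esub> w\<^sub>0"
      using wM w0(1) u xc by (intro M.M.minus_eq_imp_sum_eq) auto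
    then have "w = fps_const c \<odot>\<^bsub>M\<^esub> w\<^sub>0 \<oplus>\<^bsub>M\<^esub> xc \<odot>\<^bsub>M\<^esub> u"
      using wM w0(1) u xc M.M.a_comm by simp
    then show ?thesis
      using u by blast
  qed
  ultimately show ?thesis
    unfolding socle_generator_def by blast
qed

section \<open>The canonical module as a fractional ideal\<close>

abbreviation K :: "'k fps ring" where "K \<equiv> A\<lparr>carrier := base_field\<rparr>"

lemma base_field_subset: "base_field \<subseteq> carrier A"
  by (auto simp: base_field_def)

lemma cring_K: "cring K"
proof (rule cringI)
  have bf: "0 \<in> base_field" "1 \<in> base_field" "\<And>f. f \<in> base_field \<Longrightarrow> - f \<in> base_field"
    "\<And>f g. f \<in> base_field \<Longrightarrow> g \<in> base_field \<Longrightarrow> f + g \<in> base_field"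
    "\<And>f g. f \<in> base_field \<Longrightarrow> g \<in> base_field \<Longrightarrow> f * g \<in> base_field"
    by (auto simp: base_field_def image_iff intro: exI[of _ 0] exI[of _ 1])
  show "abelian_group K"
  proof (rule abelian_groupI)
    show "\<exists>y\<in>carrier K. y \<oplus>\<^bsub>K\<^esub> x = \<zero>\<^bsub>K\<^esub>" if "x \<in> carrier K" for x
      using that bf by (intro bexI[of _ "- x"]) auto
  qed (use bf in \<open>auto simp: add_ac\<close>)
  show "Group.comm_monoid K"
    by (rule comm_monoidI) (use bf in \<open>auto simp: mult_ac\<close>)
qed (auto simp: algebra_simps)

lemma module_K:
  assumes "module A M" shows "module K M"
proof -
  interpret M: module A M by fact
  show ?thesis
  proof (rule moduleI)
    show "cring K" by (rule cring_K)
    show "abelian_group M" by (rule M.M.abelian_group_axioms)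
  qed (auto intro: M.smult_l_distr M.smult_r_distr M.smult_assoc1 subsetD[OF base_field_subset] simp del: A_simps)
qed

definition functional :: "('k fps, 'm) module \<Rightarrow> 'm set \<Rightarrow> ('m \<Rightarrow> 'k) \<Rightarrow> bool" where
  "functional M U \<phi> \<longleftrightarrow> (\<forall>u\<in>U. \<forall>v\<in>U. \<phi> (u \<oplus>\<^bsub>M\<^esub> v) = \<phi> u + \<phi> v) \<and>
     (\<forall>c. \<forall>u\<in>U. \<phi> (fps_const c \<odot>\<^bsub>M\<^esub> u) = c * \<phi> u)"

text \<open>An ideal of a field is zero or contains a unit, so Baer's criterion over
  \<open>K\<close> is immediate for the one-dimensional space, and \<open>baer_extension\<close>
  extends functionals.\<close>

lemma functional_extend:
  assumes M: "module A M" and U: "U \<subseteq> carrier M" "U \<noteq> {}"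
    "\<And>u v. u \<in> U \<Longrightarrow> v \<in> U \<Longrightarrow> u \<oplus>\<^bsub>M\<^esub> v \<in> U" "\<And>c u. u \<in> U \<Longrightarrow> fps_const c \<odot>\<^bsub>M\<^esub> u \<in> U"
    and phi: "functional M U \<phi>"
  obtains h where "functional M (carrier M) h" "\<And>u. u \<in> U \<Longrightarrow> h u = \<phi> u"
proof -
  interpret M: module A M by (rule M)
  interpret KM: module K M by (rule module_K[OF M])
  have resK: "module K residue_module"
    by (rule module_K[OF residue_module])
  have neg: "\<ominus>\<^bsub>M\<^esub> u = fps_const (-1) \<odot>\<^bsub>M\<^esub> u" if "u \<in> carrier M" for u
  proof -
    have "- 1 = fps_const (- 1 :: 'k)"
      by (metis fps_const_1_eq_1 fps_const_neg)
    moreover have "(- 1) \<odot>\<^bsub>M\<^esub> u = \<ominus>\<^bsub>M\<^esub> u"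
      using M.smult_l_minus[of 1 u] M.smult_one[OF that] that by simp
    ultimately show ?thesis
      by metis
  qed
  have zero: "\<zero>\<^bsub>M\<^esub> \<in> U"
  proof -
    obtain u where "u \<in> U" using U(2) by blast
    then show ?thesis
      using U(4)[of u 0] M.smult_l_null[of u] U(1) by auto
  qed
  have "submodule U K M"
    by (rule KM.submoduleI) (use U zero neg in \<open>auto simp: base_field_def subset_iff\<close>)
  moreover have "\<phi> \<in> module_hom K (M\<lparr>carrier := U\<rparr>) residue_module"
    using phi by (intro module_homI) (auto simp: functional_def base_field_def)
  moreover have "\<exists>z\<in>carrier residue_module. \<forall>a\<in>I. f a = a \<odot>\<^bsub>residue_module\<^esub> z"
    if I: "ideal I K" and f: "f \<in> module_hom K (regular_module K\<lparr>carrier := I\<rparr>) residue_module" for I and f :: "'k fps \<Rightarrow> 'k"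
  proof -
    interpret I: ideal I K by (rule I)
    have sub: "I \<subseteq> base_field"
      using I.a_subset by simp
    show ?thesis
    proof (cases "I \<subseteq> {0}")
      case True
      have "f 0 = f (0 \<odot>\<^bsub>regular_module K\<lparr>carrier := I\<rparr>\<^esub> 0)"
        by simp
      also have "\<dots> = 0"
        using module_homD(3)[OF f, of 0 0] I.zero_closed by (simp add: base_field_def image_iff exI[of _ 0])
      finally have "\<forall>a\<in>I. f a = fps_nth a 0 * 0"
        using True by auto
      then show ?thesis by auto
    next
      case False
      then obtain a where a: "a \<in> I" "a \<noteq> 0"
        by blast
      moreover then obtain c where "a = fps_const c"
        using sub by (auto simp: base_field_def)
      ultimately have c: "fps_const c \<in> I" "c \<noteq> 0"
        by auto
      have "f a = fps_nth a 0 * (f (fps_const c) / c)" if "a \<in> I" for a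
      proof -
        obtain b where b: "a = fps_const b"
          using sub \<open>a \<in> I\<close> by (auto simp: base_field_def)
        have "f (fps_const (b / c) \<odot>\<^bsub>regular_module K\<lparr>carrier := I\<rparr>\<^esub> fps_const c) = b / c * f (fps_const c)"
          using module_homD(3)[OF f, of "fps_const (b / c)" "fps_const c"] c by (simp add: base_field_def)
        then show ?thesis
          using c by (simp add: b)
      qed
      then show ?thesis
        by (intro bexI[of _ "f (fps_const c) / c"]) auto
    qed
  qed
  ultimately obtain h where h: "h \<in> module_hom K M residue_module" "\<forall>x\<in>U. h x = \<phi> x"
    using baer_extension[OF KM.module_axioms resK] by blast
  have "functional M (carrier M) h"
    using module_homD[OF h(1)] by (auto simp: functional_def base_field_def)
  then show thesis
    using that h(2) by blast
qed

text \<open>The values prescribed on \<open>xc M\<close> and at \<open>w\<^sub>0\<close> are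
  consistent: a nonzero multiple of \<open>w\<^sub>0\<close> in \<open>xc M\<close> would, after
  division by the constant, put \<open>w\<^sub>0\<close> there.\<close>

lemma functional_mod_xc:
  assumes M: "module A M" and w0: "w\<^sub>0 \<in> carrier M" "\<And>u. u \<in> carrier M \<Longrightarrow> w\<^sub>0 \<noteq> xc \<odot>\<^bsub>M\<^esub> u"
  obtains h where "functional M (carrier M) h" "\<And>u. u \<in> carrier M \<Longrightarrow> h (xc \<odot>\<^bsub>M\<^esub> u) = 0" "h w\<^sub>0 = 1"
proof -
  interpret M: module A M by (rule M)
  define f where "f c u = fps_const c \<odot>\<^bsub>M\<^esub> w\<^sub>0 \<oplus>\<^bsub>M\<^esub> xc \<odot>\<^bsub>M\<^esub> u" for c u
  have smc: "fps_const c \<odot>\<^bsub>M\<^esub> (xc \<odot>\<^bsub>M\<^esub> u) = xc \<odot>\<^bsub>M\<^esub> (fps_const c \<odot>\<^bsub>M\<^esub> u)" if "u \<in> carrier M" for c u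
    using M.smult_assoc1[OF _ xc(1) that, of "fps_const c"] M.smult_assoc1[OF xc(1) _ that, of "fps_const c"]
    by (simp add: mult.commute)
  have uniq: "c = c'" if "f c u = f c' u'" "u \<in> carrier M" "u' \<in> carrier M" for c c' u u'
  proof (rule ccontr)
    assume ne: "c \<noteq> c'"
    have "xc \<odot>\<^bsub>M\<^esub> u \<oplus>\<^bsub>M\<^esub> fps_const c \<odot>\<^bsub>M\<^esub> w\<^sub>0 = xc \<odot>\<^bsub>M\<^esub> u' \<oplus>\<^bsub>M\<^esub> fps_const c' \<odot>\<^bsub>M\<^esub> w\<^sub>0"
      using that w0(1) xc(1) by (simp add: f_def M.M.a_comm)
    then have "fps_const c \<odot>\<^bsub>M\<^esub> w\<^sub>0 \<ominus>\<^bsub>M\<^esub> fps_const c' \<odot>\<^bsub>M\<^esub> w\<^sub>0 = xc \<odot>\<^bsub>M\<^esub> u' \<ominus>\<^bsub>M\<^esub> xc \<odot>\<^bsub>M\<^esub> u"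
      by (rule M.M.sum_eq_imp_minus_eq[rotated -1]) (use that w0 xc in auto)
    then have "fps_const (c - c') \<odot>\<^bsub>M\<^esub> w\<^sub>0 = xc \<odot>\<^bsub>M\<^esub> (u' \<ominus>\<^bsub>M\<^esub> u)"
      using M.smult_minus_l[of "fps_const c" "fps_const c'" w\<^sub>0] M.smult_minus_r[OF xc(1) that(3,2)] w0(1) by simp
    then have "fps_const (1 / (c - c')) \<odot>\<^bsub>M\<^esub> (fps_const (c - c') \<odot>\<^bsub>M\<^esub> w\<^sub>0) = xc \<odot>\<^bsub>M\<^esub> (fps_const (1 / (c - c')) \<odot>\<^bsub>M\<^esub> (u' \<ominus>\<^bsub>M\<^esub> u))"
      using smc that by simp
    moreover have "fps_const (1 / (c - c')) \<odot>\<^bsub>M\<^esub> (fps_const (c - c') \<odot>\<^bsub>M\<^esub> w\<^sub>0) = w\<^sub>0"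
      using M.smult_assoc1[of "fps_const (1 / (c - c'))" "fps_const (c - c')" w\<^sub>0] w0(1) ne M.smult_one[OF w0(1)]
      by simp
    ultimately show False
      using w0(2) that by simp
  qed
  define U where "U = {f c u | c u. u \<in> carrier M}"
  define \<phi> where "\<phi> v = (THE c. \<exists>u\<in>carrier M. v = f c u)" for v
  have phi: "\<phi> (f c u) = c" if "u \<in> carrier M" for c u
    unfolding \<phi>_def using that uniq by blast
  have fadd: "f c u \<oplus>\<^bsub>M\<^esub> f c' u' = f (c + c') (u \<oplus>\<^bsub>M\<^esub> u')" if "u \<in> carrier M" "u' \<in> carrier M" for c u c' u'
    using that w0(1) xc(1) M.smult_l_distr[of "fps_const c" "fps_const c'" w\<^sub>0]
    by (simp add: f_def M.smult_r_distr M.M.a_ac)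
  have fsm: "fps_const a \<odot>\<^bsub>M\<^esub> f c u = f (a * c) (fps_const a \<odot>\<^bsub>M\<^esub> u)" if "u \<in> carrier M" for a c u
    using that w0(1) xc(1) smc M.smult_assoc1[of "fps_const a" "fps_const c" w\<^sub>0]
    by (simp add: f_def M.smult_r_distr)
  have U: "U \<subseteq> carrier M" "U \<noteq> {}" "\<And>u v. u \<in> U \<Longrightarrow> v \<in> U \<Longrightarrow> u \<oplus>\<^bsub>M\<^esub> v \<in> U"
    "\<And>c u. u \<in> U \<Longrightarrow> fps_const c \<odot>\<^bsub>M\<^esub> u \<in> U"
  proof -
    show "U \<subseteq> carrier M" "U \<noteq> {}"
      using w0(1) xc(1) unfolding U_def f_def by auto
    show "u \<oplus>\<^bsub>M\<^esub> v \<in> U" if uv: "u \<in> U" "v \<in> U" for u v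
    proof -
      obtain c u' d v' where "u = f c u'" "v = f d v'" "u' \<in> carrier M" "v' \<in> carrier M"
        using uv unfolding U_def by blast
      then show ?thesis
        using fadd[of u' v' c d] unfolding U_def by blast
    qed
    show "fps_const c \<odot>\<^bsub>M\<^esub> u \<in> U" if u: "u \<in> U" for c u
    proof -
      obtain d u' where "u = f d u'" "u' \<in> carrier M"
        using u unfolding U_def by blast
      then show ?thesis
        using fsm[of u' c d] unfolding U_def by blast
    qed
  qed
  have "functional M U \<phi>"
    unfolding functional_def U_def using phi fadd fsm by auto
  then obtain h where h: "functional M (carrier M) h" "\<And>u. u \<in> U \<Longrightarrow> h u = \<phi> u"
    using functional_extend[OF M U] by blast
  have hf: "h (f c u) = c" if "u \<in> carrier M" for c u
    using h(2)[of "f c u"] phi[OF that] that unfolding U_def by auto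
  show thesis
  proof (rule that[OF h(1)])
    show "h (xc \<odot>\<^bsub>M\<^esub> u) = 0" if "u \<in> carrier M" for u
      using hf[OF that, of 0] M.smult_l_null[OF w0(1)] that xc(1) by (simp add: f_def)
    show "h w\<^sub>0 = 1"
      using hf[of "\<zero>\<^bsub>M\<^esub>" 1] w0(1) M.smult_one[OF w0(1)] xc(1) by (simp add: f_def)
  qed
qed

text \<open>Dividing by \<open>xc\<close>, which is well defined by torsion-freeness, turns \<psi>
  into a functional on \<open>xc M\<close>, and this extends to \<open>M\<close>. Iterated, it
  continues a functional from \<open>M / xc^n\<close> to \<open>M / xc^(n+1)\<close>, both read as
  submodules of \<open>M[1/xc]\<close>.\<close>

lemma functional_tower_step:
  assumes M: "module A M" and tf: "torsion_free M" and psi: "functional M (carrier M) \<psi>"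
  obtains h where "functional M (carrier M) h" "\<And>u. u \<in> carrier M \<Longrightarrow> h (xc \<odot>\<^bsub>M\<^esub> u) = \<psi> u"
proof -
  interpret M: module A M by (rule M)
  define U where "U = (\<lambda>u. xc \<odot>\<^bsub>M\<^esub> u) ` carrier M"
  define \<phi> where "\<phi> v = \<psi> (THE u. u \<in> carrier M \<and> v = xc \<odot>\<^bsub>M\<^esub> u)" for v
  have phi: "\<phi> (xc \<odot>\<^bsub>M\<^esub> u) = \<psi> u" if "u \<in> carrier M" for u
  proof -
    have "(THE v. v \<in> carrier M \<and> xc \<odot>\<^bsub>M\<^esub> u = xc \<odot>\<^bsub>M\<^esub> v) = u"
      using that torsion_free_cancel[OF M tf xc(1,3)] by (intro the_equality) auto
    then show ?thesis by (simp add: \<phi>_def)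
  qed
  have smc: "fps_const c \<odot>\<^bsub>M\<^esub> (xc \<odot>\<^bsub>M\<^esub> u) = xc \<odot>\<^bsub>M\<^esub> (fps_const c \<odot>\<^bsub>M\<^esub> u)" if "u \<in> carrier M" for c u
    using M.smult_assoc1[OF _ xc(1) that, of "fps_const c"] M.smult_assoc1[OF xc(1) _ that, of "fps_const c"]
    by (simp add: mult.commute)
  have add: "xc \<odot>\<^bsub>M\<^esub> u \<oplus>\<^bsub>M\<^esub> xc \<odot>\<^bsub>M\<^esub> v = xc \<odot>\<^bsub>M\<^esub> (u \<oplus>\<^bsub>M\<^esub> v)" if "u \<in> carrier M" "v \<in> carrier M" for u v
    using that xc(1) by (simp add: M.smult_r_distr)
  have U: "U \<subseteq> carrier M" "U \<noteq> {}" "\<And>u v. u \<in> U \<Longrightarrow> v \<in> U \<Longrightarrow> u \<oplus>\<^bsub>M\<^esub> v \<in> U"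
    "\<And>c u. u \<in> U \<Longrightarrow> fps_const c \<odot>\<^bsub>M\<^esub> u \<in> U"
    using xc(1) smc add unfolding U_def by auto
  have "functional M U \<phi>"
    using psi phi smc add unfolding functional_def U_def by auto
  then obtain h where "functional M (carrier M) h" "\<And>u. u \<in> U \<Longrightarrow> h u = \<phi> u"
    using functional_extend[OF M U] by blast
  then show thesis
    using that phi unfolding U_def by auto
qed

lemma functional_tower_exists:
  assumes M: "module A M" and tf: "torsion_free M"
    and w0: "w\<^sub>0 \<in> carrier M" "\<And>u. u \<in> carrier M \<Longrightarrow> w\<^sub>0 \<noteq> xc \<odot>\<^bsub>M\<^esub> u"
  shows "\<exists>\<phi>. (\<forall>n. functional M (carrier M) (\<phi> n)) \<and> (\<forall>u\<in>carrier M. \<phi> 0 u = 0) \<and>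
    (\<forall>n. \<forall>u\<in>carrier M. \<phi> (Suc n) (xc \<odot>\<^bsub>M\<^esub> u) = \<phi> n u) \<and> \<phi> 1 w\<^sub>0 = 1"
proof -
  define P where "P n h \<longleftrightarrow> functional M (carrier M) h \<and>
    (n = 0 \<longrightarrow> (\<forall>u\<in>carrier M. h (xc \<odot>\<^bsub>M\<^esub> u) = 0) \<and> h w\<^sub>0 = 1)" for n :: nat and h
  have "\<exists>\<psi>. \<forall>n. P n (\<psi> n) \<and> (\<forall>u\<in>carrier M. \<psi> (Suc n) (xc \<odot>\<^bsub>M\<^esub> u) = \<psi> n u)"
  proof (rule dependent_nat_choice)
    show "\<exists>h. P 0 h"
      using functional_mod_xc[OF M w0] unfolding P_def by metis
    show "\<exists>h'. P (Suc n) h' \<and> (\<forall>u\<in>carrier M. h' (xc \<odot>\<^bsub>M\<^esub> u) = h u)" if "P n h" for n h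
      using functional_tower_step[OF M tf, of h] that unfolding P_def by (metis nat.distinct(1))
  qed
  then obtain \<psi> where psi: "\<And>n. P n (\<psi> n)" "\<And>n u. u \<in> carrier M \<Longrightarrow> \<psi> (Suc n) (xc \<odot>\<^bsub>M\<^esub> u) = \<psi> n u"
    by blast
  \<comment> \<open>Level 0 is the zero functional, since the functional on \<open>M[1/xc]\<close>
    has to vanish on \<open>M\<close>; the chosen sequence supplies the levels from 1 on.\<close>
  have "functional M (carrier M) (\<lambda>_. 0)"
    by (simp add: functional_def)
  then show ?thesis
    using psi unfolding P_def by (intro exI[of _ "case_nat (\<lambda>_. 0) \<psi>"]) (auto split: nat.split)
qed

text \<open>Generators are removed one at a time. Modulo a submodule \<open>L\<close> that contains
  the others, y = xc y' and y' = a y, so (1 - xc a) y lies in \<open>L\<close>; the factor is a unit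
  because \<open>xc\<close> has no constant term.\<close>

lemma nakayama:
  assumes M: "module A M" and N: "submodule N A M" "\<And>u. u \<in> N \<Longrightarrow> \<exists>v\<in>N. u = xc \<odot>\<^bsub>M\<^esub> v"
    and "finite T" "T \<subseteq> N" "\<And>L. submodule L A M \<Longrightarrow> T \<subseteq> L \<Longrightarrow> N \<subseteq> L"
  shows "N = {\<zero>\<^bsub>M\<^esub>}"
proof -
  interpret M: module A M by (rule M)
  note NE = M.submoduleE[OF N(1)]
  show ?thesis
    using assms(4-6)
  proof (induction T rule: finite_induct)
    case empty
    have "submodule {\<zero>\<^bsub>M\<^esub>} A M"
      by (rule M.submoduleI) auto
    then have "N \<subseteq> {\<zero>\<^bsub>M\<^esub>}"
      using empty by blast
    then show ?case
      using NE(2) by blast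
  next
    case (insert y T)
    have y: "y \<in> N" "y \<in> carrier M"
      using insert NE(1) by auto
    have "N \<subseteq> L" if L: "submodule L A M" "T \<subseteq> L" for L
    proof -
      note LE = M.submoduleE[OF L(1)]
      \<comment> \<open>\<open>L'\<close> is \<open>L + A y\<close>. It contains all generators and
        therefore \<open>N\<close>.\<close>
      define L' where "L' = {u \<in> carrier M. \<exists>a\<in>carrier A. u \<ominus>\<^bsub>M\<^esub> a \<odot>\<^bsub>M\<^esub> y \<in> L}"
      have L'I: "u \<in> L'" if "u \<in> carrier M" "a \<in> carrier A" "u \<ominus>\<^bsub>M\<^esub> a \<odot>\<^bsub>M\<^esub> y \<in> L" for u a
        using that unfolding L'_def by blast
      have L0: "\<zero>\<^bsub>M\<^esub> \<in> L"
        using LE(1,2,4) by (metis A.zero_closed M.smult_l_null ex_in_conv subsetD)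
      have LL': "u \<in> L'" if "u \<in> L" for u
      proof -
        have "\<ominus>\<^bsub>M\<^esub> \<zero>\<^bsub>M\<^esub> = \<zero>\<^bsub>M\<^esub>"
          by (rule M.M.minus_equality) auto
        then show ?thesis
          using L'I[of u "\<zero>\<^bsub>A\<^esub>"] that subsetD[OF LE(1) that] M.smult_l_null[OF y(2)] M.M.r_zero A.zero_closed
          unfolding a_minus_def by metis
      qed
      have yL': "y \<in> L'"
        using L'I[of y 1] M.smult_one[OF y(2)] y L0 by (simp add: a_minus_def M.M.r_neg)
      have smL': "b \<odot>\<^bsub>M\<^esub> u \<in> L'" if b: "b \<in> carrier A" and u: "u \<in> L'" for b u
      proof -
        obtain a where a: "a \<in> carrier A" "u \<ominus>\<^bsub>M\<^esub> a \<odot>\<^bsub>M\<^esub> y \<in> L" "u \<in> carrier M"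
          using u unfolding L'_def by blast
        have "b \<odot>\<^bsub>M\<^esub> u \<ominus>\<^bsub>M\<^esub> (b * a) \<odot>\<^bsub>M\<^esub> y = b \<odot>\<^bsub>M\<^esub> (u \<ominus>\<^bsub>M\<^esub> a \<odot>\<^bsub>M\<^esub> y)"
          using a b y M.smult_assoc1[OF b a(1) y(2)] by (simp add: M.smult_minus_r)
        then show ?thesis
          using L'I[of "b \<odot>\<^bsub>M\<^esub> u" "b * a"] a b LE(4)[OF b a(2)] by simp
      qed
      have "submodule L' A M"
      proof (rule M.submoduleI)
        show L'M: "L' \<subseteq> carrier M"
          unfolding L'_def by blast
        show "\<zero>\<^bsub>M\<^esub> \<in> L'"
          by (rule LL'[OF L0])
        show "\<ominus>\<^bsub>M\<^esub> u \<in> L'" if "u \<in> L'" for u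
          using smL'[of "-1" u] that L'M M.smult_l_minus[of 1 u] M.smult_one[of u] by auto
        show "u \<oplus>\<^bsub>M\<^esub> v \<in> L'" if uv: "u \<in> L'" "v \<in> L'" for u v
        proof -
          obtain a b where a: "a \<in> carrier A" "u \<ominus>\<^bsub>M\<^esub> a \<odot>\<^bsub>M\<^esub> y \<in> L" "u \<in> carrier M"
            and b: "b \<in> carrier A" "v \<ominus>\<^bsub>M\<^esub> b \<odot>\<^bsub>M\<^esub> y \<in> L" "v \<in> carrier M"
            using uv unfolding L'_def by blast
          have "(u \<oplus>\<^bsub>M\<^esub> v) \<ominus>\<^bsub>M\<^esub> (a + b) \<odot>\<^bsub>M\<^esub> y = (u \<ominus>\<^bsub>M\<^esub> a \<odot>\<^bsub>M\<^esub> y) \<oplus>\<^bsub>M\<^esub> (v \<ominus>\<^bsub>M\<^esub> b \<odot>\<^bsub>M\<^esub> y)"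
            using a b y M.smult_l_distr[OF a(1) b(1) y(2)]
            by (simp add: a_minus_def M.M.a_ac M.M.minus_add)
          then show ?thesis
            using L'I[of "u \<oplus>\<^bsub>M\<^esub> v" "a + b"] a b LE(5)[OF a(2) b(2)] by simp
        qed
      qed (use smL' in auto)
      then have NL': "N \<subseteq> L'"
        using insert.prems(2)[of L'] LL' yL' L(2) by blast
      obtain y' where y': "y' \<in> N" "y = xc \<odot>\<^bsub>M\<^esub> y'"
        using N(2) y by blast
      then obtain a where a: "a \<in> carrier A" "y' \<ominus>\<^bsub>M\<^esub> a \<odot>\<^bsub>M\<^esub> y \<in> L" "y' \<in> carrier M"
        using NL' unfolding L'_def by blast
      define b where "b = 1 - xc * a"
      have b: "b \<in> carrier A" "fps_nth b 0 \<noteq> 0"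
        using a xc cnd_pos by (auto simp: b_def)
      have "xc \<odot>\<^bsub>M\<^esub> (y' \<ominus>\<^bsub>M\<^esub> a \<odot>\<^bsub>M\<^esub> y) = b \<odot>\<^bsub>M\<^esub> y"
        using a xc(1) y y'(2)[symmetric] M.smult_assoc1[OF xc(1) a(1) y(2)] M.smult_minus_l[of 1 "xc * a" y]
          M.smult_one[OF y(2)]
        by (simp add: M.smult_minus_r b_def)
      then have "b \<odot>\<^bsub>M\<^esub> y \<in> L"
        using LE(4)[OF xc(1) a(2)] by simp
      then have "inverse b \<odot>\<^bsub>M\<^esub> (b \<odot>\<^bsub>M\<^esub> y) \<in> L"
        using LE(4) inverse_in_A[OF b] by blast
      then have "y \<in> L"
        using M.smult_assoc1[OF inverse_in_A[OF b] b(1) y(2)] inverse_mult_eq_1[OF b(2)] M.smult_one[OF y(2)]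
        by simp
      then show ?thesis
        using insert.prems(2) L by blast
    qed
    then show ?case
      using insert by blast
  qed
qed

text \<open>A shift of the canonical fractional ideal, spanned by the \<open>t^j\<close> with \<open>-j \<notin> \<Gamma>\<close>.\<close>

definition dual :: "'k fls set" where
  "dual = {f. \<forall>n\<in>\<Gamma>. fls_nth f (- int n) = 0}"

lemma dual_nth:
  assumes "f \<in> dual" "- j \<in> GZ" shows "fls_nth f j = 0"
proof -
  obtain n where "n \<in> \<Gamma>" "- j = int n"
    using assms(2) by blast
  then have "n \<in> \<Gamma>" "j = - int n"
    by auto
  then show ?thesis
    using assms(1) by (simp add: dual_def)
qed

lemma dual_smult:
  assumes a: "a \<in> carrier A" and f: "f \<in> dual" shows "fps_to_fls a * f \<in> dual"
  unfolding dual_def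
proof (intro CollectI ballI, rule ccontr)
  fix n assume n: "n \<in> \<Gamma>" and "fls_nth (fps_to_fls a * f) (- int n) \<noteq> 0"
  then obtain i where i: "fls_nth (fps_to_fls a) i \<noteq> 0" "fls_nth f (- int n - i) \<noteq> 0"
    by (elim fls_times_nth_nonzeroE)
  then have i0: "i \<ge> 0" "fps_nth a (nat i) \<noteq> 0"
    by (auto split: if_splits)
  then have "nat i + n \<in> \<Gamma>"
    using a n add_in by (auto simp: carrier_A)
  then show False
    using i(2) i0 dual_nth[OF f, of "- int n - i"] by (simp add: GZ_iff nat_add_distrib add.commute)
qed

lemma X_power_times_nth:
  "fls_nth (fps_to_fls (fps_X ^ n) * f) j = fls_nth f (j - int n)" for f :: "'k fls"
  by (simp add: fps_to_fls_power fls_X_power_times_conv_shift)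

lemma xc_power: "xc ^ m = fps_X ^ (cnd * m)"
  by (simp add: power_mult)

lemma cnd_mult_in: "n \<in> \<Gamma> \<Longrightarrow> n + cnd * m \<in> \<Gamma>"
  by (cases m) (auto intro: ge_cnd_in)

end

text \<open>The maps \<open>\<phi> n\<close> encode one functional \<open>\<lambda>\<close> on \<open>M[1/xc]\<close> that vanishes on \<open>M\<close>:
  \<open>\<phi> n w = \<lambda> (w / xc^n)\<close>. The coefficient of \<open>Phi w\<close> at \<open>t^j\<close> is \<open>\<lambda> (t^(-j) w)\<close>.\<close>

locale functional_tower = monomial_ring \<Gamma> A
  for \<Gamma> :: "nat set" and A :: "'k::field fps ring" +
  fixes M :: "('k fps, 'm) module" and \<phi> :: "nat \<Rightarrow> 'm \<Rightarrow> 'k" and w\<^sub>0 :: 'm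
  assumes M: "module A M" and tf: "torsion_free M" and fg: "finitely_generated A M"
    and w0: "socle_generator M w\<^sub>0"
    and phi: "\<And>n. functional M (carrier M) (\<phi> n)" and phi_zero: "\<And>u. u \<in> carrier M \<Longrightarrow> \<phi> 0 u = 0"
    and phi_Suc: "\<And>n u. u \<in> carrier M \<Longrightarrow> \<phi> (Suc n) (xc \<odot>\<^bsub>M\<^esub> u) = \<phi> n u"
    and phi_w0: "\<phi> 1 w\<^sub>0 = 1"
begin

section \<open>Construction and linearity of the map to k((t))\<close>

sublocale M: module A M by (rule M)

lemma M_smult_one [simp]: "u \<in> carrier M \<Longrightarrow> 1 \<odot>\<^bsub>M\<^esub> u = u"
  using M.smult_one by simp

lemma M_smult_assoc: "a \<in> carrier A \<Longrightarrow> b \<in> carrier A \<Longrightarrow> u \<in> carrier M \<Longrightarrow>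
    (a * b) \<odot>\<^bsub>M\<^esub> u = a \<odot>\<^bsub>M\<^esub> (b \<odot>\<^bsub>M\<^esub> u)"
  using M.smult_assoc1 by simp

lemma M_smult_add: "a \<in> carrier A \<Longrightarrow> b \<in> carrier A \<Longrightarrow> u \<in> carrier M \<Longrightarrow>
    (a + b) \<odot>\<^bsub>M\<^esub> u = a \<odot>\<^bsub>M\<^esub> u \<oplus>\<^bsub>M\<^esub> b \<odot>\<^bsub>M\<^esub> u"
  using M.smult_l_distr by simp

lemma M_smult_zero [simp]: "u \<in> carrier M \<Longrightarrow> 0 \<odot>\<^bsub>M\<^esub> u = \<zero>\<^bsub>M\<^esub>"
  using M.smult_l_null by simp

lemma phi_add: "u \<in> carrier M \<Longrightarrow> v \<in> carrier M \<Longrightarrow> \<phi> n (u \<oplus>\<^bsub>M\<^esub> v) = \<phi> n u + \<phi> n v"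
  and phi_const: "u \<in> carrier M \<Longrightarrow> \<phi> n (fps_const c \<odot>\<^bsub>M\<^esub> u) = c * \<phi> n u"
  using phi by (auto simp: functional_def)

lemma phi_shift: "u \<in> carrier M \<Longrightarrow> \<phi> (n + m) (fps_X ^ (cnd * m) \<odot>\<^bsub>M\<^esub> u) = \<phi> n u"
proof (induction m)
  case (Suc m)
  have "cnd * m \<in> \<Gamma>"
    using cnd_mult_in[OF zero_in, of m] by simp
  then have c: "fps_X ^ (cnd * m) \<odot>\<^bsub>M\<^esub> u \<in> carrier M"
    using Suc by auto
  have "fps_X ^ (cnd * Suc m) \<odot>\<^bsub>M\<^esub> u = xc \<odot>\<^bsub>M\<^esub> (fps_X ^ (cnd * m) \<odot>\<^bsub>M\<^esub> u)"
    using M_smult_assoc[OF xc(1) X_in_A Suc.prems, of "cnd * m"] \<open>cnd * m \<in> \<Gamma>\<close>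
    by (simp add: power_add)
  then show ?case
    using phi_Suc[OF c, of "n + m"] Suc by simp
qed auto

text \<open>The value \<lambda> (t^(-j) w), written as \<phi> m (t^n w) with cnd m - n = j. All such
  m and n with n in \<Gamma> give the same value; m = |j| + 1 makes n at least
  \<open>cnd\<close>.\<close>

definition coef :: "'m \<Rightarrow> int \<Rightarrow> 'k" where
  "coef w j = \<phi> (Suc (nat \<bar>j\<bar>)) (fps_X ^ nat (int cnd * int (Suc (nat \<bar>j\<bar>)) - j) \<odot>\<^bsub>M\<^esub> w)"

lemma phi_eq:
  assumes "w \<in> carrier M" "n \<in> \<Gamma>" "n' \<in> \<Gamma>" "int cnd * int m - int n = int cnd * int m' - int n'" "m \<le> m'"
  shows "\<phi> m (fps_X ^ n \<odot>\<^bsub>M\<^esub> w) = \<phi> m' (fps_X ^ n' \<odot>\<^bsub>M\<^esub> w)"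
proof -
  define k where "k = m' - m"
  have m': "m' = m + k"
    using assms(5) by (simp add: k_def)
  have "int n' = int (cnd * k + n)"
    using assms(4) by (simp add: m' algebra_simps)
  then have n': "n' = cnd * k + n"
    by (simp only: of_nat_eq_iff)
  have "cnd * k \<in> \<Gamma>"
    using cnd_mult_in[OF zero_in, of k] by simp
  then have "fps_X ^ n' \<odot>\<^bsub>M\<^esub> w = fps_X ^ (cnd * k) \<odot>\<^bsub>M\<^esub> (fps_X ^ n \<odot>\<^bsub>M\<^esub> w)"
    using M_smult_assoc[OF X_in_A X_in_A, of "cnd * k" n w] assms by (simp add: n' power_add)
  then show ?thesis
    using phi_shift[of "fps_X ^ n \<odot>\<^bsub>M\<^esub> w" m k] assms by (simp add: m')
qed

lemma coef_eq:
  assumes w: "w \<in> carrier M" and n: "n \<in> \<Gamma>" "int cnd * int m - int n = j"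
  shows "coef w j = \<phi> m (fps_X ^ n \<odot>\<^bsub>M\<^esub> w)"
proof -
  define m' where "m' = Suc (nat \<bar>j\<bar>)"
  define n' where "n' = nat (int cnd * int m' - j)"
  have "int cnd * int (nat \<bar>j\<bar>) \<ge> 1 * int (nat \<bar>j\<bar>)"
    using cnd_pos by (intro mult_right_mono) auto
  moreover have "int cnd * int m' = int cnd * int (nat \<bar>j\<bar>) + int cnd"
    by (simp add: m'_def algebra_simps)
  ultimately have ge: "int cnd * int m' - j \<ge> int cnd"
    by linarith
  then have n': "n' \<in> \<Gamma>" "int cnd * int m' - int n' = j"
    by (auto simp: n'_def intro: ge_cnd_in)
  have "\<phi> m (fps_X ^ n \<odot>\<^bsub>M\<^esub> w) = \<phi> m' (fps_X ^ n' \<odot>\<^bsub>M\<^esub> w)"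
  proof (cases "m \<le> m'")
    case True
    then show ?thesis
      using phi_eq[OF w n(1) n'(1), of m m'] n n' by simp
  next
    case False
    then show ?thesis
      using phi_eq[OF w n'(1) n(1), of m' m] n n' by simp
  qed
  then show ?thesis
    by (simp add: coef_def m'_def n'_def)
qed

definition Phi :: "'m \<Rightarrow> 'k fls" where
  "Phi w = Abs_fls (coef w)"

text \<open>For j below -cnd the monomial t^(-j) lies in \<open>A\<close>, so t^(-j) w is in
  \<open>M\<close>, where \<lambda> vanishes. Hence the coefficients do form a Laurent
  series.\<close>

lemma Phi_coef:
  assumes "w \<in> carrier M" shows "fls_nth (Phi w) j = coef w j"
proof -
  have "coef w j = 0" if "j < - int cnd" for j
  proof -
    have "nat (- j) \<in> \<Gamma>"
      using that by (intro ge_cnd_in) auto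
    then show ?thesis
      using coef_eq[OF assms, of "nat (- j)" 0 j] that phi_zero assms by auto
  qed
  then show ?thesis
    unfolding Phi_def by (intro nth_Abs_fls_lower_bound) blast
qed

lemma Phi_nth:
  assumes "w \<in> carrier M" "n \<in> \<Gamma>" "int cnd * int m - int n = j"
  shows "fls_nth (Phi w) j = \<phi> m (fps_X ^ n \<odot>\<^bsub>M\<^esub> w)"
  using Phi_coef coef_eq assms by metis

lemma nat_exponent:
  obtains n m where "n \<in> \<Gamma>" "int cnd * int m - int n = j"
proof -
  define m where "m = Suc (nat \<bar>j\<bar>)"
  have "int cnd * int (nat \<bar>j\<bar>) \<ge> 1 * int (nat \<bar>j\<bar>)"
    using cnd_pos by (intro mult_right_mono) auto
  moreover have "int cnd * int m = int cnd * int (nat \<bar>j\<bar>) + int cnd"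
    by (simp add: m_def algebra_simps)
  ultimately have ge: "int cnd * int m - j \<ge> int cnd"
    by linarith
  then show thesis
    by (intro that[of "nat (int cnd * int m - j)" m]) (auto intro: ge_cnd_in)
qed

lemma Phi_dual: "w \<in> carrier M \<Longrightarrow> Phi w \<in> dual"
  using Phi_nth[of w _ 0] phi_zero by (auto simp: dual_def)

lemma Phi_low: "w \<in> carrier M \<Longrightarrow> j \<le> - int cnd \<Longrightarrow> fls_nth (Phi w) j = 0"
  by (rule dual_nth[OF Phi_dual]) (auto simp: GZ_iff intro: ge_cnd_in)

lemma Phi_add:
  assumes "u \<in> carrier M" "v \<in> carrier M" shows "Phi (u \<oplus>\<^bsub>M\<^esub> v) = Phi u + Phi v"
proof (rule fls_eqI)
  fix j
  obtain n m where nm: "n \<in> \<Gamma>" "int cnd * int m - int n = j"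
    by (rule nat_exponent)
  then show "fls_nth (Phi (u \<oplus>\<^bsub>M\<^esub> v)) j = fls_nth (Phi u + Phi v) j"
    using Phi_nth[OF _ nm] assms X_in_A[OF nm(1)] by (simp add: M.smult_r_distr phi_add)
qed

lemma Phi_const:
  assumes "u \<in> carrier M" shows "Phi (fps_const c \<odot>\<^bsub>M\<^esub> u) = fls_const c * Phi u"
proof (rule fls_eqI)
  fix j
  obtain n m where nm: "n \<in> \<Gamma>" "int cnd * int m - int n = j"
    by (rule nat_exponent)
  have "fps_X ^ n \<odot>\<^bsub>M\<^esub> (fps_const c \<odot>\<^bsub>M\<^esub> u) = fps_const c \<odot>\<^bsub>M\<^esub> (fps_X ^ n \<odot>\<^bsub>M\<^esub> u)"
    using M_smult_assoc[OF X_in_A _ assms, of n "fps_const c"] M_smult_assoc[OF _ X_in_A assms, of "fps_const c" n] nm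
    by (simp add: mult.commute)
  then show "fls_nth (Phi (fps_const c \<odot>\<^bsub>M\<^esub> u)) j = fls_nth (fls_const c * Phi u) j"
    using Phi_nth[OF _ nm] assms X_in_A[OF nm(1)] by (simp add: phi_const)
qed

lemma Phi_X:
  assumes "u \<in> carrier M" "g \<in> \<Gamma>" shows "Phi (fps_X ^ g \<odot>\<^bsub>M\<^esub> u) = fps_to_fls (fps_X ^ g) * Phi u"
proof (rule fls_eqI)
  fix j
  obtain n m where nm: "n \<in> \<Gamma>" "int cnd * int m - int n = j"
    by (rule nat_exponent)
  have "fps_X ^ n \<odot>\<^bsub>M\<^esub> (fps_X ^ g \<odot>\<^bsub>M\<^esub> u) = fps_X ^ (n + g) \<odot>\<^bsub>M\<^esub> u"
    using M_smult_assoc[OF X_in_A X_in_A assms(1), of n g] nm assms by (simp add: power_add)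
  moreover have "fls_nth (Phi u) (j - int g) = \<phi> m (fps_X ^ (n + g) \<odot>\<^bsub>M\<^esub> u)"
    using nm assms by (intro Phi_nth add_in) auto
  ultimately show "fls_nth (Phi (fps_X ^ g \<odot>\<^bsub>M\<^esub> u)) j = fls_nth (fps_to_fls (fps_X ^ g) * Phi u) j"
    using Phi_nth[OF _ nm, of "fps_X ^ g \<odot>\<^bsub>M\<^esub> u"] assms X_in_A[OF assms(2)] by (simp add: X_power_times_nth)
qed

lemma Phi_zero: "Phi \<zero>\<^bsub>M\<^esub> = 0"
  using Phi_const[of "\<zero>\<^bsub>M\<^esub>" 0] by simp

lemma Phi_truncation:
  assumes u: "u \<in> carrier M" and a: "a \<in> carrier A"
  shows "(\<Sum>i<N. fps_const (fps_nth a i) * fps_X ^ i) \<in> carrier A \<and>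
    Phi ((\<Sum>i<N. fps_const (fps_nth a i) * fps_X ^ i) \<odot>\<^bsub>M\<^esub> u) =
      fps_to_fls (\<Sum>i<N. fps_const (fps_nth a i) * fps_X ^ i) * Phi u"
proof (induction N)
  case 0
  then show ?case using u Phi_zero by simp
next
  case (Suc N)
  show ?case
  proof (cases "fps_nth a N = 0")
    case True
    then show ?thesis using Suc by simp
  next
    case False
    then have N: "N \<in> \<Gamma>"
      using a by (simp add: carrier_A)
    have "Phi ((fps_const (fps_nth a N) * fps_X ^ N) \<odot>\<^bsub>M\<^esub> u) = fps_to_fls (fps_const (fps_nth a N) * fps_X ^ N) * Phi u"
      using M_smult_assoc[OF _ X_in_A[OF N] u, of "fps_const (fps_nth a N)"] u N Phi_X[OF u N]
      by (simp add: Phi_const fls_times_fps_to_fls mult.assoc)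
    then show ?thesis
      using Suc u X_in_A[OF N] M_smult_add[OF _ _ u, of "\<Sum>i<N. fps_const (fps_nth a i) * fps_X ^ i" "fps_const (fps_nth a N) * fps_X ^ N"]
      by (simp add: Phi_add distrib_right)
  qed
qed

text \<open>\<lambda> need not be continuous, so an infinite sum of monomials cannot be treated
  termwise. For a single coefficient, \<open>a\<close> is split into a polynomial and a tail t^(cnd
  m) r with \<open>r\<close> in \<open>A\<close>; the shift by cnd m moves the coefficient in
  question to a place where Phi (r u) and r Phi u both vanish.\<close>

lemma Phi_smult:
  assumes u: "u \<in> carrier M" and a: "a \<in> carrier A"
  shows "Phi (a \<odot>\<^bsub>M\<^esub> u) = fps_to_fls a * Phi u"
proof (rule fls_eqI)
  fix j
  define m where "m = nat \<bar>j\<bar> + 1"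
  define p where "p = (\<Sum>i<cnd * m + cnd. fps_const (fps_nth a i) * fps_X ^ i)"
  have p: "p \<in> carrier A" "Phi (p \<odot>\<^bsub>M\<^esub> u) = fps_to_fls p * Phi u"
    using Phi_truncation[OF u a] by (auto simp: p_def)
  have "subdegree (fps_X ^ (cnd * m) :: 'k fps) = cnd * m"
    by simp
  then obtain r where r: "r \<in> carrier A" "a - p = r * fps_X ^ (cnd * m)"
    by (rule_tac high_order_multiple[of "fps_X ^ (cnd * m)" "a - p"]) (auto simp: p_def fps_truncation_nth)
  have cm: "cnd * m \<in> \<Gamma>"
    using cnd_mult_in[OF zero_in, of m] by simp
  have "int cnd * int (nat \<bar>j\<bar>) \<ge> 1 * int (nat \<bar>j\<bar>)"
    using cnd_pos by (intro mult_right_mono) auto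
  moreover have "int (cnd * m) = int cnd * int (nat \<bar>j\<bar>) + int cnd"
    by (simp add: m_def algebra_simps)
  ultimately have low: "j - int (cnd * m) \<le> - int cnd"
    by linarith
  have ru: "r \<odot>\<^bsub>M\<^esub> u \<in> carrier M"
    using r u by simp
  have "Phi (a \<odot>\<^bsub>M\<^esub> u) = Phi (p \<odot>\<^bsub>M\<^esub> u) + Phi ((fps_X ^ (cnd * m) * r) \<odot>\<^bsub>M\<^esub> u)"
  proof -
    have "a = p + fps_X ^ (cnd * m) * r"
      using r(2) by (simp add: algebra_simps)
    then show ?thesis
      using M_smult_add[OF p(1) _ u, of "fps_X ^ (cnd * m) * r"] X_in_A[OF cm] r(1) p(1) u
      by (simp add: Phi_add)
  qed
  moreover have "Phi ((fps_X ^ (cnd * m) * r) \<odot>\<^bsub>M\<^esub> u) = fps_to_fls (fps_X ^ (cnd * m)) * Phi (r \<odot>\<^bsub>M\<^esub> u)"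
    using M_smult_assoc[OF X_in_A[OF cm] r(1) u] Phi_X[OF ru cm] by simp
  ultimately have 1: "fls_nth (Phi (a \<odot>\<^bsub>M\<^esub> u)) j = fls_nth (fps_to_fls p * Phi u) j"
    using Phi_low[OF ru low] p(2) by (simp add: X_power_times_nth)
  have "fls_nth (fps_to_fls r * Phi u) (j - int (cnd * m)) = 0"
  proof (cases "Phi u = 0")
    case False
    have "fls_subdegree (Phi u) > - int cnd"
      using Phi_low[OF u] by (intro fls_subdegree_greaterI False) auto
    moreover have "fls_subdegree (fps_to_fls r) \<ge> 0"
      by (rule fls_subdegree_fls_to_fps_gt0)
    ultimately show ?thesis
      using low by (intro fls_times_nth_eq0) linarith
  qed simp
  moreover have "fps_to_fls a * Phi u = fps_to_fls p * Phi u + fps_to_fls (fps_X ^ (cnd * m)) * (fps_to_fls r * Phi u)"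
  proof -
    have "a = p + fps_X ^ (cnd * m) * r"
      using r(2) by (simp add: algebra_simps)
    then have "fps_to_fls a = fps_to_fls p + fps_to_fls (fps_X ^ (cnd * m)) * fps_to_fls r"
      by (simp add: fls_times_fps_to_fls)
    then show ?thesis
      by (simp add: algebra_simps)
  qed
  ultimately show "fls_nth (Phi (a \<odot>\<^bsub>M\<^esub> u)) j = fls_nth (fps_to_fls a * Phi u) j"
    using 1 by (simp add: X_power_times_nth)
qed

section \<open>Bijectivity onto the dual\<close>

lemma Phi_xc: "u \<in> carrier M \<Longrightarrow> Phi (xc \<odot>\<^bsub>M\<^esub> u) = fps_to_fls xc * Phi u"
  by (rule Phi_smult[OF _ xc(1)])

text \<open>If \<open>w \<notin> xc M\<close>, some monomial multiple \<open>t^\<gamma> w\<close> is a nonzero socle element modulo \<open>xc M\<close>;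
  the functional \<open>\<phi> 1\<close> does not vanish on it, and its value there is a coefficient that vanishes for
  elements of \<open>xc dual\<close>.\<close>

lemma Phi_in_xc_dual:
  assumes w: "w \<in> carrier M" and f: "f \<in> dual" "Phi w = fps_to_fls xc * f"
  shows "\<exists>u\<in>carrier M. w = xc \<odot>\<^bsub>M\<^esub> u"
proof (rule ccontr)
  define XM where "XM = {xc \<odot>\<^bsub>M\<^esub> u | u. u \<in> carrier M}"
  assume "\<not> ?thesis"
  then have wX: "w \<notin> XM"
    by (auto simp: XM_def)
  have XM_zero: "\<zero>\<^bsub>M\<^esub> \<in> XM"
    using M.smult_r_null[OF xc(1)] by (auto simp: XM_def intro!: exI[of _ "\<zero>\<^bsub>M\<^esub>"])
  have XM_add: "u \<oplus>\<^bsub>M\<^esub> v \<in> XM" if uv: "u \<in> XM" "v \<in> XM" for u v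
  proof -
    obtain u' v' where "u' \<in> carrier M" "v' \<in> carrier M" "u = xc \<odot>\<^bsub>M\<^esub> u'" "v = xc \<odot>\<^bsub>M\<^esub> v'"
      using uv unfolding XM_def by blast
    then show ?thesis
      using xc(1) by (auto simp: XM_def M.smult_r_distr intro!: exI[of _ "u' \<oplus>\<^bsub>M\<^esub> v'"])
  qed
  have XM_smult: "a \<odot>\<^bsub>M\<^esub> u \<in> XM" if a: "a \<in> carrier A" and u: "u \<in> XM" for a u
  proof -
    obtain u' where u': "u' \<in> carrier M" "u = xc \<odot>\<^bsub>M\<^esub> u'"
      using u unfolding XM_def by blast
    then have "a \<odot>\<^bsub>M\<^esub> u = xc \<odot>\<^bsub>M\<^esub> (a \<odot>\<^bsub>M\<^esub> u')"
      using M_smult_assoc[OF a xc(1) u'(1)] M_smult_assoc[OF xc(1) a u'(1)] by (simp add: mult.commute)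
    then show ?thesis
      using a u' by (auto simp: XM_def)
  qed
  \<comment> \<open>A series of order at least 2 cnd is \<open>xc\<close> times a series of order at
    least \<open>cnd\<close>, and the latter lies in \<open>A\<close>. Hence only finitely many g
    can have t^g w outside \<open>xc M\<close>.\<close>
  have high: "a \<odot>\<^bsub>M\<^esub> u \<in> XM" if a: "\<And>i. i < cnd + cnd \<Longrightarrow> fps_nth a i = 0" and u: "u \<in> carrier M" for a u
  proof -
    obtain b where b: "b \<in> carrier A" "a = b * xc"
      by (rule high_order_multiple[of xc a]) (use a in auto)
    then have "a \<odot>\<^bsub>M\<^esub> u = xc \<odot>\<^bsub>M\<^esub> (b \<odot>\<^bsub>M\<^esub> u)"
      using M_smult_assoc[OF xc(1) b(1) u] by (simp add: mult.commute)
    then show ?thesis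
      using b u by (auto simp: XM_def)
  qed
  define S where "S = {g \<in> \<Gamma>. fps_X ^ g \<odot>\<^bsub>M\<^esub> w \<notin> XM}"
  have "S \<subseteq> {..<cnd + cnd}"
  proof
    fix g assume g: "g \<in> S"
    show "g \<in> {..<cnd + cnd}"
    proof (rule ccontr)
      assume "g \<notin> {..<cnd + cnd}"
      then have "fps_X ^ g \<odot>\<^bsub>M\<^esub> w \<in> XM"
        by (intro high w) auto
      then show False
        using g by (simp add: S_def)
    qed
  qed
  then have "finite S"
    by (rule finite_subset) simp
  moreover have "0 \<in> S"
    using wX w zero_in by (simp add: S_def)
  ultimately have max: "Max S \<in> S" "\<And>g. g \<in> S \<Longrightarrow> g \<le> Max S"
    using Max_in by auto
  define g where "g = Max S"
  define u where "u = fps_X ^ g \<odot>\<^bsub>M\<^esub> w"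
  have g: "g \<in> \<Gamma>" "u \<notin> XM" "u \<in> carrier M"
    using max(1) w by (auto simp: g_def S_def u_def)
  have mono: "fps_X ^ n \<odot>\<^bsub>M\<^esub> u \<in> XM" if n: "n \<in> \<Gamma>" "n > 0" for n
  proof (rule ccontr)
    assume "fps_X ^ n \<odot>\<^bsub>M\<^esub> u \<notin> XM"
    moreover have "fps_X ^ n \<odot>\<^bsub>M\<^esub> u = fps_X ^ (n + g) \<odot>\<^bsub>M\<^esub> w"
      using M_smult_assoc[OF X_in_A[OF n(1)] X_in_A[OF g(1)] w] by (simp add: u_def power_add)
    ultimately have "n + g \<in> S"
      using add_in n g by (simp add: S_def)
    then show False
      using max(2)[of "n + g"] n by (simp add: g_def)
  qed
  have trunc: "(\<Sum>i<N. fps_const (fps_nth a i) * fps_X ^ i) \<in> carrier A \<and>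
      (\<Sum>i<N. fps_const (fps_nth a i) * fps_X ^ i) \<odot>\<^bsub>M\<^esub> u \<in> XM"
    if a: "a \<in> carrier A" "fps_nth a 0 = 0" for a N
  proof (induction N)
    case 0
    then show ?case
      using g(3) XM_zero by simp
  next
    case (Suc N)
    show ?case
    proof (cases "fps_nth a N = 0")
      case True
      then show ?thesis using Suc by simp
    next
      case False
      then have N: "N \<in> \<Gamma>" "N > 0"
        using a by (auto simp: carrier_A intro: gr0I)
      have "(fps_const (fps_nth a N) * fps_X ^ N) \<odot>\<^bsub>M\<^esub> u \<in> XM"
        using M_smult_assoc[OF _ X_in_A[OF N(1)] g(3), of "fps_const (fps_nth a N)"] XM_smult mono[OF N]
        by simp
      then show ?thesis
        using Suc X_in_A[OF N(1)] XM_add M_smult_add[OF _ _ g(3), of "\<Sum>i<N. fps_const (fps_nth a i) * fps_X ^ i" "fps_const (fps_nth a N) * fps_X ^ N"]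
        by simp
    qed
  qed
  have "a \<odot>\<^bsub>M\<^esub> u \<in> XM" if a: "a \<in> carrier A" "fps_nth a 0 = 0" for a
  proof -
    define p where "p = (\<Sum>i<cnd + cnd. fps_const (fps_nth a i) * fps_X ^ i)"
    have p: "p \<in> carrier A" "p \<odot>\<^bsub>M\<^esub> u \<in> XM"
      using trunc[OF a] by (auto simp: p_def)
    have "(a - p) \<odot>\<^bsub>M\<^esub> u \<in> XM"
      by (rule high) (use g(3) in \<open>auto simp: p_def fps_truncation_nth\<close>)
    then show ?thesis
      using XM_add[OF p(2)] M_smult_add[OF p(1) _ g(3), of "a - p"] a p by simp
  qed
  then have "u \<in> socle_mod_xc M"
    using g(3) by (auto simp: socle_mod_xc_def XM_def)
  then obtain c v where c: "v \<in> carrier M" "u = fps_const c \<odot>\<^bsub>M\<^esub> w\<^sub>0 \<oplus>\<^bsub>M\<^esub> xc \<odot>\<^bsub>M\<^esub> v"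
    using w0 unfolding socle_generator_def by blast
  have w0M: "w\<^sub>0 \<in> carrier M"
    using w0 by (simp add: socle_generator_def socle_mod_xc_def)
  have "c \<noteq> 0"
  proof
    assume "c = 0"
    then have "u = xc \<odot>\<^bsub>M\<^esub> v"
      using c w0M xc(1) by simp
    then show False
      using c(1) g(2) by (auto simp: XM_def)
  qed
  moreover have "\<phi> 1 u = c"
    using c w0M xc(1) phi_w0 phi_Suc[OF c(1), of 0] phi_zero[OF c(1)] by (simp add: phi_add phi_const)
  \<comment> \<open>\<phi> 1 u = \<lambda> (u / xc) is the coefficient of Phi u at t^cnd. Since Phi
    u = t^g xc f, it is the coefficient of \<open>f\<close> at -g, which vanishes as g lies in
    \<Gamma>.\<close>
  moreover have "\<phi> 1 u = fls_nth (Phi u) (int cnd)"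
    using Phi_nth[OF g(3) zero_in, of 1 "int cnd"] g(3) by simp
  moreover have "fls_nth (Phi u) (int cnd) = fls_nth f (- int g)"
    using Phi_X[OF w g(1)] f(2) by (simp add: u_def X_power_times_nth)
  moreover have "fls_nth f (- int g) = 0"
    using f(1) g(1) by (simp add: dual_def)
  ultimately show False by simp
qed

lemma fls_cancel_xc: "fps_to_fls xc * f = fps_to_fls xc * g \<Longrightarrow> f = g" for f g :: "'k fls"
  using xc(3) by simp

lemma Phi_w0_nonzero: "Phi w\<^sub>0 \<noteq> 0"
proof -
  have w0M: "w\<^sub>0 \<in> carrier M"
    using w0 by (simp add: socle_generator_def socle_mod_xc_def)
  then have "fls_nth (Phi w\<^sub>0) (int cnd) = 1"
    using Phi_nth[OF w0M zero_in, of 1 "int cnd"] phi_w0 by simp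
  then show ?thesis by auto
qed

text \<open>Since k((t)) is a field, f is a multiple q of \<open>Phi w\<^sub>0\<close>, and a power
  of \<open>xc\<close> brings q into \<open>A\<close>. So some xc^m f is attained, and
  \<open>Phi_in_xc_dual\<close> removes the factors one by one.\<close>

lemma Phi_surj:
  assumes f: "f \<in> dual" shows "\<exists>w\<in>carrier M. Phi w = f"
proof (cases "f = 0")
  case True
  then show ?thesis using Phi_zero by auto
next
  case False
  define g where "g = Phi w\<^sub>0"
  have g: "g \<noteq> 0"
    using Phi_w0_nonzero by (simp add: g_def)
  have w0M: "w\<^sub>0 \<in> carrier M"
    using w0 by (simp add: socle_generator_def socle_mod_xc_def)
  define q where "q = f / g"
  have q: "f = q * g" "q \<noteq> 0"
    using g False by (auto simp: q_def)
  define m where "m = nat (int cnd - fls_subdegree q)"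
  define a where "a = fls_regpart (fls_shift (- int (cnd * m)) q)"
  have "int cnd * int m \<ge> 1 * int m"
    using cnd_pos by (intro mult_right_mono) auto
  then have m: "fls_subdegree q + int (cnd * m) \<ge> int cnd"
    unfolding m_def of_nat_mult by linarith
  have sub: "fls_nth (fls_shift (- int (cnd * m)) q) k = 0" if "k < int cnd" for k
    using that m by (simp add: fls_eq0_below_subdegree)
  then have a: "fps_to_fls a = fls_shift (- int (cnd * m)) q"
    unfolding a_def by (intro fls_regpart_to_fls_trivial fls_subdegree_ge0I) (simp add: sub)
  have aA: "a \<in> carrier A"
    by (rule high_order_in_A) (use sub in \<open>simp add: a_def\<close>)
  have cm: "fls_shift (- int (cnd * m)) q = fps_to_fls (xc ^ m) * q"
    unfolding xc_power by (simp only: fps_to_fls_power fps_X_to_fls fls_X_power_times_conv_shift)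
  have "\<exists>w\<in>carrier M. Phi w = fps_to_fls (xc ^ m) * f"
  proof
    show "a \<odot>\<^bsub>M\<^esub> w\<^sub>0 \<in> carrier M"
      using aA w0M by simp
    show "Phi (a \<odot>\<^bsub>M\<^esub> w\<^sub>0) = fps_to_fls (xc ^ m) * f"
      unfolding Phi_smult[OF w0M aA] a cm q(1) g_def by (simp only: mult.assoc)
  qed
  then show ?thesis
  proof (induction m)
    case (Suc m)
    then obtain w where w: "w \<in> carrier M" "Phi w = fps_to_fls (xc ^ Suc m) * f"
      by blast
    have xm: "xc ^ m \<in> carrier A"
      using xc(1) by (rule A_power_closed)
    have eq: "Phi w = fps_to_fls xc * (fps_to_fls (xc ^ m) * f)"
      using w(2) by (simp add: fls_times_fps_to_fls mult.assoc)
    obtain u where u: "u \<in> carrier M" "w = xc \<odot>\<^bsub>M\<^esub> u"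
      using Phi_in_xc_dual[OF w(1) dual_smult[OF xm f] eq] by blast
    have "Phi u = fps_to_fls (xc ^ m) * f"
      using fls_cancel_xc[of "Phi u"] eq Phi_xc[OF u(1)] u(2) by simp
    then show ?case
      using Suc.IH u by blast
  qed simp
qed

text \<open>Since 0 is \<open>xc\<close> times an element of \<open>dual\<close>, every kernel
  element is divisible by \<open>xc\<close>; the quotient is in the kernel again, because
  \<open>xc\<close> can be cancelled in k((t)).\<close>

lemma kernel_divisible:
  assumes "u \<in> carrier M" "Phi u = 0"
  shows "\<exists>v\<in>carrier M. Phi v = 0 \<and> u = xc ^ n \<odot>\<^bsub>M\<^esub> v"
proof (induction n)
  case 0
  then show ?case using assms by auto
next
  case (Suc n)
  then obtain v where v: "v \<in> carrier M" "Phi v = 0" "u = xc ^ n \<odot>\<^bsub>M\<^esub> v"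
    by blast
  have "0 \<in> dual"
    by (simp add: dual_def)
  then obtain v' where v': "v' \<in> carrier M" "v = xc \<odot>\<^bsub>M\<^esub> v'"
    using Phi_in_xc_dual[OF v(1), of 0] v(2) by auto
  have "Phi v' = 0"
    using fls_cancel_xc[of "Phi v'" 0] Phi_xc[OF v'(1)] v(2) v'(2) by simp
  moreover have "u = xc ^ Suc n \<odot>\<^bsub>M\<^esub> v'"
    using M_smult_assoc[OF A_power_closed[OF xc(1)] xc(1) v'(1), of n] v(3) v'(2) by (simp add: mult.commute)
  ultimately show ?case
    using v' by blast
qed

text \<open>The kernel is finitely generated: with \<open>Phi w1 = xc^2\<close>, the map
  \<open>w \<mapsto> xc^4 w - (xc^2 Phi w) w1\<close> sends \<open>M\<close> onto the kernel, on which it is multiplication by \<open>xc^4\<close>.\<close>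

lemma Phi_inj:
  assumes u: "u \<in> carrier M" "Phi u = 0"
  shows "u = \<zero>\<^bsub>M\<^esub>"
proof -
  define N where "N = {u \<in> carrier M. Phi u = 0}"
  have x4: "xc ^ 4 \<in> carrier A"
    using xc(1) by (rule A_power_closed)
  have nth_x2: "fls_nth (fps_to_fls (xc ^ 2) * f) j = fls_nth f (j - 2 * int cnd)" for f :: "'k fls" and j
    unfolding xc_power X_power_times_nth by (simp add: mult.commute)
  have "fps_to_fls (xc ^ 2) \<in> dual"
    unfolding dual_def xc_power using cnd_pos by auto
  then obtain w1 where w1: "w1 \<in> carrier M" "Phi w1 = fps_to_fls (xc ^ 2)"
    using Phi_surj by blast
  \<comment> \<open>\<open>Phi w\<close> starts above -cnd, so the factor xc^2 moves it above cnd
    and hence into \<open>A\<close>.\<close>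
  define B where "B w = fls_regpart (fps_to_fls (xc ^ 2) * Phi w)" for w
  have B: "fps_to_fls (B w) = fps_to_fls (xc ^ 2) * Phi w" if "w \<in> carrier M" for w
    unfolding B_def
    by (intro fls_regpart_to_fls_trivial fls_subdegree_ge0I, unfold nth_x2, rule Phi_low[OF that]) auto
  have BA: "B w \<in> carrier A" if "w \<in> carrier M" for w
  proof (rule high_order_in_A)
    fix i assume "i < cnd"
    then show "fps_nth (B w) i = 0"
      unfolding B_def fls_regpart_nth nth_x2 by (intro Phi_low[OF that]) auto
  qed
  have B_add: "B (v \<oplus>\<^bsub>M\<^esub> w) = B v + B w" if "v \<in> carrier M" "w \<in> carrier M" for v w
  proof -
    have "fps_to_fls (B (v \<oplus>\<^bsub>M\<^esub> w)) = fps_to_fls (B v + B w)"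
      using that by (simp add: B Phi_add algebra_simps)
    then show ?thesis by (simp only: fps_to_fls_eq_iff)
  qed
  have B_smult: "B (a \<odot>\<^bsub>M\<^esub> w) = a * B w" if "a \<in> carrier A" "w \<in> carrier M" for a w
  proof -
    have "fps_to_fls (B (a \<odot>\<^bsub>M\<^esub> w)) = fps_to_fls (a * B w)"
      using that by (simp add: B Phi_smult fls_times_fps_to_fls)
    then show ?thesis by (simp only: fps_to_fls_eq_iff)
  qed
  define \<pi> where "\<pi> w = xc ^ 4 \<odot>\<^bsub>M\<^esub> w \<ominus>\<^bsub>M\<^esub> B w \<odot>\<^bsub>M\<^esub> w1" for w
  have pi_hom: "\<pi> \<in> module_hom A M M"
  proof (rule module_homI)
    fix v assume v: "v \<in> carrier M"
    show "\<pi> v \<in> carrier M"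
      using v x4 BA[OF v] w1 by (simp add: \<pi>_def)
    fix w assume w: "w \<in> carrier M"
    show "\<pi> (v \<oplus>\<^bsub>M\<^esub> w) = \<pi> v \<oplus>\<^bsub>M\<^esub> \<pi> w"
      using v w x4 BA[OF v] BA[OF w] w1 M_smult_add[OF BA[OF v] BA[OF w] w1(1)]
      by (simp add: \<pi>_def B_add M.smult_r_distr a_minus_def M.M.a_ac M.M.minus_add)
  next
    fix a v assume a: "a \<in> carrier A" and v: "v \<in> carrier M"
    have "xc ^ 4 \<odot>\<^bsub>M\<^esub> (a \<odot>\<^bsub>M\<^esub> v) = a \<odot>\<^bsub>M\<^esub> (xc ^ 4 \<odot>\<^bsub>M\<^esub> v)"
      using M_smult_assoc[OF x4 a v] M_smult_assoc[OF a x4 v] by (simp add: mult.commute)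
    then show "\<pi> (a \<odot>\<^bsub>M\<^esub> v) = a \<odot>\<^bsub>M\<^esub> \<pi> v"
      using a v x4 BA[OF v] w1 M_smult_assoc[OF a BA[OF v] w1(1)]
      by (simp add: \<pi>_def B_smult M.smult_minus_r)
  qed
  have pi_N: "\<pi> w \<in> N" if w: "w \<in> carrier M" for w
  proof -
    have "Phi (\<pi> w) + Phi (B w \<odot>\<^bsub>M\<^esub> w1) = Phi (\<pi> w \<oplus>\<^bsub>M\<^esub> B w \<odot>\<^bsub>M\<^esub> w1)"
      using Phi_add module_homD(1)[OF pi_hom w] BA[OF w] w1 by simp
    also have "\<pi> w \<oplus>\<^bsub>M\<^esub> B w \<odot>\<^bsub>M\<^esub> w1 = xc ^ 4 \<odot>\<^bsub>M\<^esub> w"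
      using w x4 BA[OF w] w1 by (simp add: \<pi>_def a_minus_def M.M.a_assoc M.M.l_neg)
    also have "Phi (xc ^ 4 \<odot>\<^bsub>M\<^esub> w) = fps_to_fls (xc ^ 4) * Phi w"
      by (rule Phi_smult[OF w x4])
    also have "\<dots> = Phi (B w \<odot>\<^bsub>M\<^esub> w1)"
    proof -
      have "xc ^ 4 = xc ^ 2 * xc ^ 2"
        by (simp flip: power_add)
      then have "fps_to_fls (xc ^ 4) = fps_to_fls (xc ^ 2) * fps_to_fls (xc ^ 2)"
        by (simp only: fls_times_fps_to_fls)
      then show ?thesis
        unfolding Phi_smult[OF w1(1) BA[OF w]] w1(2) B[OF w] by (simp only: ac_simps)
    qed
    finally show ?thesis
      using module_homD(1)[OF pi_hom w] by (simp add: N_def)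
  qed
  have N_sub: "submodule N A M"
  proof (rule M.submoduleI)
    show "\<ominus>\<^bsub>M\<^esub> v \<in> N" if "v \<in> N" for v
      using that Phi_add[of v "\<ominus>\<^bsub>M\<^esub> v"] Phi_zero by (simp add: N_def M.M.r_neg)
  qed (auto simp: N_def Phi_zero Phi_add Phi_smult)
  \<comment> \<open>\<open>B\<close> vanishes on the kernel, where \<pi> is thus multiplication by
    xc^4; divisibility of the kernel provides the preimage.\<close>
  have pi_kernel: "\<exists>v\<in>carrier M. \<pi> v = w" if w: "w \<in> N" for w
  proof -
    obtain v where v: "v \<in> carrier M" "Phi v = 0" "w = xc ^ 4 \<odot>\<^bsub>M\<^esub> v"
      using kernel_divisible[of w 4] w by (auto simp: N_def)
    then have "B v = 0"
      by (simp add: B_def)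
    then have "\<pi> v = w"
      using v w1 x4 by (simp add: \<pi>_def a_minus_def)
    then show ?thesis using v by blast
  qed
  obtain S where S: "finite S" "S \<subseteq> carrier M"
    "\<And>L. submodule L A M \<Longrightarrow> S \<subseteq> L \<Longrightarrow> L = carrier M"
    using fg unfolding finitely_generated_def by blast
  have gen: "N \<subseteq> L" if L: "submodule L A M" "\<pi> ` S \<subseteq> L" for L
  proof -
    note LE = M.submoduleE[OF L(1)]
    have "submodule {w \<in> carrier M. \<pi> w \<in> L} A M"
    proof (rule M.submoduleI)
      show "\<zero>\<^bsub>M\<^esub> \<in> {w \<in> carrier M. \<pi> w \<in> L}"
      proof -
        have "\<zero>\<^bsub>M\<^esub> \<in> L"
          using LE(1,2,4) by (metis A.zero_closed M.smult_l_null ex_in_conv subsetD)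
        then show ?thesis
          using module_hom_zero[OF M M pi_hom] by simp
      qed
      show "\<ominus>\<^bsub>M\<^esub> w \<in> {w \<in> carrier M. \<pi> w \<in> L}" if "w \<in> {w \<in> carrier M. \<pi> w \<in> L}" for w
        using that LE(3) module_hom_uminus[OF M M pi_hom, of w] by simp
    qed (use LE(4,5) module_homD[OF pi_hom] in auto)
    then have "{w \<in> carrier M. \<pi> w \<in> L} = carrier M"
      by (rule S(3)) (use S(2) L(2) in auto)
    then show ?thesis
      using pi_kernel by blast
  qed
  have "N = {\<zero>\<^bsub>M\<^esub>}"
  proof (rule nakayama[OF M N_sub])
    show "\<exists>w\<in>N. v = xc \<odot>\<^bsub>M\<^esub> w" if "v \<in> N" for v
      using kernel_divisible[of v 1] that by (auto simp: N_def)
    show "finite (\<pi> ` S)" "\<pi> ` S \<subseteq> N"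
      using S pi_N by auto
  qed (use gen in auto)
  then show ?thesis
    using u by (auto simp: N_def)
qed

lemma Phi_bij: "bij_betw Phi (carrier M) dual"
proof (rule bij_betwI')
  show "(Phi u = Phi v) = (u = v)" if "u \<in> carrier M" "v \<in> carrier M" for u v
  proof
    assume eq: "Phi u = Phi v"
    have "Phi (u \<ominus>\<^bsub>M\<^esub> v) + Phi v = Phi u"
      using Phi_add[of "u \<ominus>\<^bsub>M\<^esub> v" v] that by (simp add: a_minus_def M.M.a_assoc M.M.l_neg)
    then have "u \<ominus>\<^bsub>M\<^esub> v = \<zero>\<^bsub>M\<^esub>"
      using eq that by (intro Phi_inj) auto
    then have "u \<oplus>\<^bsub>M\<^esub> \<ominus>\<^bsub>M\<^esub> v \<oplus>\<^bsub>M\<^esub> v = v"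
      using that by (simp add: a_minus_def)
    then show "u = v"
      using that by (simp add: M.M.a_assoc M.M.l_neg)
  qed simp
qed (use Phi_dual Phi_surj in auto)

end

context monomial_ring
begin

section \<open>Consequence for canonical modules\<close>

definition dual_iso :: "('k fps, 'm) module \<Rightarrow> ('m \<Rightarrow> 'k fls) \<Rightarrow> bool" where
  "dual_iso M \<Phi> \<longleftrightarrow> bij_betw \<Phi> (carrier M) dual \<and>
     (\<forall>u\<in>carrier M. \<forall>v\<in>carrier M. \<Phi> (u \<oplus>\<^bsub>M\<^esub> v) = \<Phi> u + \<Phi> v) \<and>
     (\<forall>a\<in>carrier A. \<forall>u\<in>carrier M. \<Phi> (a \<odot>\<^bsub>M\<^esub> u) = fps_to_fls a * \<Phi> u)"

lemma socle_generator_imp_dual_iso: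
  assumes M: "module A M" "torsion_free M" "finitely_generated A M" and w0: "socle_generator M w\<^sub>0"
  shows "\<exists>\<Phi>. dual_iso M \<Phi>"
proof -
  have "w\<^sub>0 \<in> carrier M" "\<And>u. u \<in> carrier M \<Longrightarrow> w\<^sub>0 \<noteq> xc \<odot>\<^bsub>M\<^esub> u"
    using w0 by (auto simp: socle_generator_def socle_mod_xc_def)
  from functional_tower_exists[OF M(1,2) this] obtain \<phi> where
    "\<And>n. functional M (carrier M) (\<phi> n)" "\<And>u. u \<in> carrier M \<Longrightarrow> \<phi> 0 u = 0"
    "\<And>n u. u \<in> carrier M \<Longrightarrow> \<phi> (Suc n) (xc \<odot>\<^bsub>M\<^esub> u) = \<phi> n u" "\<phi> 1 w\<^sub>0 = 1"
    by blast
  then have "functional_tower \<Gamma> A M \<phi> w\<^sub>0"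
    using M w0 by (intro functional_tower.intro functional_tower_axioms.intro monomial_ring_axioms)
  then interpret functional_tower \<Gamma> A M \<phi> w\<^sub>0 .
  show ?thesis
    unfolding dual_iso_def using Phi_bij Phi_add Phi_smult by blast
qed

text \<open>\<open>Ext\<close> refers to a resolution picked by choice. Finite injective dimension
  supplies some resolution, so the picked pair is one as well, and the dimension hypothesis can be
  applied to it.\<close>

lemma canonical_module_dual_iso:
  fixes M :: "('k fps, 'm) module"
  assumes "canonical_module A M"
  shows "\<exists>\<Phi>. dual_iso M \<Phi>"
proof -
  have cm: "maximal_cohen_macaulay A M"
    and fid: "finite_injective_dimension A M"
    and ext: "has_dimension (A\<lparr>carrier := base_field\<rparr>) (Ext A 1 residue_module M) 1"
    using assms by (auto simp: canonical_module_def)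
  have M: "module A M" "finitely_generated A M"
    using cm by (auto simp: maximal_cohen_macaulay_def)
  have tf: "torsion_free M"
    unfolding torsion_free_def using maximal_cohen_macaulay_torsion_free[OF cm] by blast
  obtain \<epsilon> I d where "injective_resolution A M \<epsilon> (I :: nat \<Rightarrow> ('k fps, ('k fps, 'm) universe) module) d"
    using fid unfolding finite_injective_dimension_def by blast
  then have "\<exists>p. case p of (I, d) \<Rightarrow>
      \<exists>\<epsilon>. injective_resolution A M \<epsilon> (I :: nat \<Rightarrow> ('k fps, ('k fps, 'm) universe) module) d"
    by auto
  then have "case some_injective_resolution A M of (I, d) \<Rightarrow> \<exists>\<epsilon>. injective_resolution A M \<epsilon> I d"
    unfolding some_injective_resolution_def by (rule someI_ex)
  then obtain I d \<epsilon> where "some_injective_resolution A M = (I, d)" "injective_resolution A M \<epsilon> I d"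
    by (auto split: prod.splits)
  then have "\<exists>w\<^sub>0. socle_generator M w\<^sub>0"
    using one_dim_ext_imp_socle_generator[OF M(1) tf] ext by (simp add: Ext_def)
  then show ?thesis
    using socle_generator_imp_dual_iso[OF M(1) tf M(2)] by blast
qed

section \<open>Connections and pseudo-Frobenius numbers\<close>

text \<open>Integers instead of naturals cover \<open>\<Gamma> = \<nat>\<close>, where \<open>frob = -1\<close> is the only element.\<close>

definition pseudo_frob :: "int set" where
  "pseudo_frob = {s. s \<notin> GZ \<and> (\<forall>g\<in>GZ. g > 0 \<longrightarrow> s + g \<in> GZ)}"

definition symmetric_semigroup :: bool where
  "symmetric_semigroup \<longleftrightarrow> (\<forall>j. j \<notin> GZ \<longleftrightarrow> frob - j \<in> GZ)"

lemma frob_pseudo_frob: "frob \<in> pseudo_frob"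
  using frob_notin_GZ gt_frob_in_GZ by (auto simp: pseudo_frob_def)

text \<open>For j outside \<Gamma>, take the largest g in \<Gamma> with j + g still outside
  \<Gamma>; it exists because j + g is at most \<open>frob\<close>. Then j + g is pseudo-Frobenius,
  hence equal to \<open>frob\<close>, and frob - j = g.\<close>

lemma pseudo_frob_unique_imp_symmetric:
  assumes "\<And>p q. p \<in> pseudo_frob \<Longrightarrow> q \<in> pseudo_frob \<Longrightarrow> p = q"
  shows symmetric_semigroup
  unfolding symmetric_semigroup_def
proof (intro allI iffI)
  fix j assume "frob - j \<in> GZ"
  then show "j \<notin> GZ"
    using GZ_add[of j "frob - j"] frob_notin_GZ by auto
next
  fix j assume j: "j \<notin> GZ"
  define S where "S = {g \<in> GZ. j + g \<notin> GZ}"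
  have "S \<subseteq> {0..frob - j}"
  proof
    fix g assume "g \<in> S"
    then have "g \<in> GZ" "\<not> j + g > frob"
      using gt_frob_in_GZ by (auto simp: S_def)
    then show "g \<in> {0..frob - j}"
      by (auto simp: GZ_iff)
  qed
  then have "finite S"
    by (rule finite_subset) simp
  moreover have "0 \<in> S"
    using j GZ_zero by (simp add: S_def)
  ultimately have max: "Max S \<in> S" "\<And>g. g \<in> S \<Longrightarrow> g \<le> Max S"
    using Max_in by auto
  have g: "Max S \<in> GZ" "j + Max S \<notin> GZ"
    using max(1) by (auto simp: S_def)
  have "j + Max S + h \<in> GZ" if h: "h \<in> GZ" "h > 0" for h
  proof (rule ccontr)
    assume "j + Max S + h \<notin> GZ"
    then have "Max S + h \<in> S"
      using GZ_add[OF g(1) h(1)] by (simp add: S_def add.assoc)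
    then show False
      using max(2)[of "Max S + h"] h by simp
  qed
  then have "j + Max S \<in> pseudo_frob"
    using g(2) by (simp add: pseudo_frob_def)
  then have "j + Max S = frob"
    using assms frob_pseudo_frob by blast
  then have "frob - j = Max S"
    by simp
  then show "frob - j \<in> GZ"
    using g(1) by simp
qed

text \<open>\<open>fls_shift frob\<close> is multiplication by t^(-frob). By symmetry, -j is outside
  \<Gamma> exactly if j + frob lies in \<Gamma>.\<close>

lemma symmetric_dual:
  assumes sym: symmetric_semigroup
  shows "(\<lambda>a. fls_shift frob (fps_to_fls a)) ` carrier A = dual"
proof (intro equalityI subsetI)
  fix f assume "f \<in> (\<lambda>a. fls_shift frob (fps_to_fls a)) ` carrier A"
  then obtain a where a: "a \<in> carrier A" "f = fls_shift frob (fps_to_fls a)"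
    by blast
  show "f \<in> dual"
    unfolding dual_def
  proof (intro CollectI ballI, rule ccontr)
    fix n assume n: "n \<in> \<Gamma>" and "fls_nth f (- int n) \<noteq> 0"
    then have "frob - int n \<in> GZ"
      using a by (auto simp: carrier_A GZ_iff split: if_splits)
    then show False
      using GZ_add[of "frob - int n" "int n"] frob_notin_GZ n by auto
  qed
next
  fix f assume f: "f \<in> dual"
  have support: "j \<in> GZ" if "fls_nth (fls_shift (- frob) f) j \<noteq> 0" for j
  proof (rule ccontr)
    assume "j \<notin> GZ"
    then have "- (j - frob) \<in> GZ"
      using sym by (simp add: symmetric_semigroup_def)
    then show False
      using dual_nth[OF f, of "j - frob"] that by simp
  qed
  define a where "a = fls_regpart (fls_shift (- frob) f)"
  have "fls_nth (fls_shift (- frob) f) j = 0" if "j < 0" for j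
    using support[of j] that by (cases "fls_nth (fls_shift (- frob) f) j = 0") (auto simp: GZ_iff)
  then have "fps_to_fls a = fls_shift (- frob) f"
    unfolding a_def by (intro fls_regpart_to_fls_trivial fls_subdegree_ge0I)
  moreover have "a \<in> carrier A"
    unfolding carrier_A
  proof (intro allI impI)
    fix n assume "fps_nth a n \<noteq> 0"
    then show "n \<in> \<Gamma>"
      using support[of "int n"] by (simp add: a_def GZ_iff)
  qed
  ultimately show "f \<in> (\<lambda>a. fls_shift frob (fps_to_fls a)) ` carrier A"
    by (intro image_eqI[of _ _ a]) simp_all
qed

section \<open>Multiplication by t^s and the derivations t^s E\<close>

definition pf_shift :: "int \<Rightarrow> 'k fps \<Rightarrow> 'k fps" where
  "pf_shift s a = fls_regpart (fls_shift (- s) (fps_to_fls a))"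

lemma pf_shift:
  assumes s: "s \<in> insert 0 pseudo_frob" and a: "a \<in> carrier A" "fps_nth a 0 = 0"
  shows "fps_to_fls (pf_shift s a) = fls_shift (- s) (fps_to_fls a)" "pf_shift s a \<in> carrier A"
proof -
  have support: "j \<in> GZ" if "fls_nth (fls_shift (- s) (fps_to_fls a)) j \<noteq> 0" for j
  proof -
    have nz: "j - s \<ge> 0" "fps_nth a (nat (j - s)) \<noteq> 0"
      using that by (auto split: if_splits)
    then have "j - s \<noteq> 0"
      using a(2) by (intro notI) simp
    then have "j - s \<in> GZ" "j - s > 0"
      using nz a(1) by (auto simp: GZ_iff carrier_A)
    moreover have "s = 0 \<or> (\<forall>g\<in>GZ. g > 0 \<longrightarrow> s + g \<in> GZ)"
      using s unfolding pseudo_frob_def by blast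
    ultimately have "s + (j - s) \<in> GZ"
      by (metis add_0)
    then show ?thesis by simp
  qed
  have "fls_nth (fls_shift (- s) (fps_to_fls a)) j = 0" if "j < 0" for j
  proof (rule ccontr)
    assume "fls_nth (fls_shift (- s) (fps_to_fls a)) j \<noteq> 0"
    from support[OF this] show False
      using that by (simp add: GZ_iff)
  qed
  then show "fps_to_fls (pf_shift s a) = fls_shift (- s) (fps_to_fls a)"
    unfolding pf_shift_def by (intro fls_regpart_to_fls_trivial fls_subdegree_ge0I)
  show "pf_shift s a \<in> carrier A"
    unfolding carrier_A
  proof (intro allI impI)
    fix n assume "fps_nth (pf_shift s a) n \<noteq> 0"
    then have "fls_nth (fls_shift (- s) (fps_to_fls a)) (int n) \<noteq> 0"
      by (simp add: pf_shift_def)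
    from support[OF this] show "n \<in> \<Gamma>"
      by (simp add: GZ_iff)
  qed
qed

definition shifted_euler :: "int \<Rightarrow> 'k fps \<Rightarrow> 'k fps" where
  "shifted_euler s f = pf_shift s (fps_X * fps_deriv f)"

lemma shifted_euler:
  assumes s: "s \<in> insert 0 pseudo_frob" and f: "f \<in> carrier A"
  shows "fps_to_fls (shifted_euler s f) = fls_shift (- s) (fps_to_fls (fps_X * fps_deriv f))"
    and "shifted_euler s f \<in> carrier A"
proof -
  have "fps_X * fps_deriv f \<in> carrier A" "fps_nth (fps_X * fps_deriv f) 0 = 0"
    using f by (auto simp: carrier_A fps_X_mult_nth split: if_splits)
  then show "fps_to_fls (shifted_euler s f) = fls_shift (- s) (fps_to_fls (fps_X * fps_deriv f))"
    and "shifted_euler s f \<in> carrier A"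
    unfolding shifted_euler_def by (rule pf_shift[OF s])+
qed

lemma derivation_carrier:
  "carrier (derivation_module base_field A) = {D \<in> module_hom K (regular_module A) (regular_module A) \<inter> extensional (carrier A).
    \<forall>a\<in>carrier A. \<forall>b\<in>carrier A. D (a * b) = a * D b + D a * b}"
  by (simp add: derivation_module_def Let_def)

lemma derivation_module_ops:
  "D \<oplus>\<^bsub>derivation_module base_field A\<^esub> D' = (\<lambda>x\<in>carrier A. D x + D' x)"
  "a \<odot>\<^bsub>derivation_module base_field A\<^esub> D = (\<lambda>x\<in>carrier A. a * D x)"
  by (simp_all add: derivation_module_def Let_def hom_module_def)

lemma end_module_ops:
  "carrier (end_module base_field A M) = module_hom K M M \<inter> extensional (carrier M)"
  "f \<oplus>\<^bsub>end_module base_field A M\<^esub> g = (\<lambda>x\<in>carrier M. f x \<oplus>\<^bsub>M\<^esub> g x)"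
  "a \<odot>\<^bsub>end_module base_field A M\<^esub> f = (\<lambda>x\<in>carrier M. a \<odot>\<^bsub>M\<^esub> f x)"
  by (simp_all add: end_module_def hom_module_def)

text \<open>Linearity over k comes from the Leibniz rule, as constants have derivative zero.\<close>

lemma shifted_euler_derivation:
  assumes s: "s \<in> insert 0 pseudo_frob"
  shows "restrict (shifted_euler s) (carrier A) \<in> carrier (derivation_module base_field A)"
proof -
  have eqI: "f = g" if "fps_to_fls f = fps_to_fls g" for f g :: "'k fps"
    using that by (simp only: fps_to_fls_eq_iff)
  have add: "shifted_euler s (f + g) = shifted_euler s f + shifted_euler s g"
    if "f \<in> carrier A" "g \<in> carrier A" for f g
    by (rule eqI) (simp add: shifted_euler[OF s] that distrib_left)
  have leibniz: "shifted_euler s (f * g) = f * shifted_euler s g + shifted_euler s f * g"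
    if "f \<in> carrier A" "g \<in> carrier A" for f g
  proof (rule eqI)
    have "fps_X * fps_deriv (f * g) = f * (fps_X * fps_deriv g) + (fps_X * fps_deriv f) * g"
      by (simp add: algebra_simps)
    then have "fps_to_fls (shifted_euler s (f * g)) =
        fls_shift (- s) (fps_to_fls f * fps_to_fls (fps_X * fps_deriv g) + fps_to_fls (fps_X * fps_deriv f) * fps_to_fls g)"
      using shifted_euler(1)[OF s, of "f * g"] that by (simp add: fls_times_fps_to_fls)
    then show "fps_to_fls (shifted_euler s (f * g)) = fps_to_fls (f * shifted_euler s g + shifted_euler s f * g)"
      using that by (simp add: fls_times_fps_to_fls shifted_euler(1)[OF s] fls_shifted_times_simps)
  qed
  have const: "shifted_euler s (fps_const c * f) = fps_const c * shifted_euler s f" if "f \<in> carrier A" for c f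
    using leibniz[OF A_closed(3) that, of c] by (simp add: shifted_euler_def pf_shift_def)
  show ?thesis
    unfolding derivation_carrier
    using shifted_euler(2)[OF s] add leibniz const
    by (auto intro!: module_homI simp: base_field_def)
qed

section \<open>Obstruction to connections, and their existence in the symmetric case\<close>

lemma connection_imp_pseudo_frob_unique:
  assumes M: "module A M" and iso: "dual_iso M \<Phi>" and con: "connection base_field A M cov"
    and inj: "inj (of_int :: int \<Rightarrow> 'k)" and p: "p \<in> pseudo_frob" and q: "q \<in> pseudo_frob"
  shows "p = q"
proof -
  interpret M: module A M by (rule M)
  define D where "D s = restrict (shifted_euler s) (carrier A)" for s
  define X where "X j = (fls_shift (- j) 1 :: 'k fls)" for j
  have X_nth: "fls_nth (X j) i = (if i = j then 1 else 0)" for i j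
    by (auto simp: X_def)
  have Phi_add: "\<Phi> (u \<oplus>\<^bsub>M\<^esub> v) = \<Phi> u + \<Phi> v" if "u \<in> carrier M" "v \<in> carrier M" for u v
    using iso that by (auto simp: dual_iso_def)
  have Phi_smult: "\<Phi> (a \<odot>\<^bsub>M\<^esub> u) = fps_to_fls a * \<Phi> u" if "a \<in> carrier A" "u \<in> carrier M" for a u
    using iso that by (auto simp: dual_iso_def)
  have Phi_inj: "u = v" if "\<Phi> u = \<Phi> v" "u \<in> carrier M" "v \<in> carrier M" for u v
    using iso that by (auto simp: dual_iso_def bij_betw_def inj_on_def)
  have Phi_dual: "\<Phi> u \<in> dual" if "u \<in> carrier M" for u
    using iso that by (auto simp: dual_iso_def bij_betw_def)
  have covhom: "cov \<in> module_hom A (derivation_module base_field A) (end_module base_field A M)"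
    using con by (simp add: connection_def)
  have D: "D s \<in> carrier (derivation_module base_field A)" if "s \<in> insert 0 pseudo_frob" for s
    unfolding D_def by (rule shifted_euler_derivation[OF that])
  have cov_closed: "cov (D s) u \<in> carrier M" if "s \<in> insert 0 pseudo_frob" "u \<in> carrier M" for s u
    using module_homD(1)[OF covhom D[OF that(1)]] that(2) module_homD(1)[of "cov (D s)" K M M]
    by (simp add: end_module_ops)
  define e where "e j = the_inv_into (carrier M) \<Phi> (X j)" for j
  have e: "e j \<in> carrier M" "\<Phi> (e j) = X j" if "- j \<notin> GZ" for j
  proof -
    have "X j \<in> dual"
      using that unfolding dual_def by (auto simp: X_nth)
    moreover have "inj_on \<Phi> (carrier M)" "\<Phi> ` carrier M = dual"
      using iso by (auto simp: dual_iso_def bij_betw_def)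
    ultimately show "e j \<in> carrier M" "\<Phi> (e j) = X j"
      unfolding e_def by (metis the_inv_into_into subset_refl, metis f_the_inv_into_f)
  qed
  \<comment> \<open>Writing the action of \<open>E\<close> on t^j as t^j (h + j) gives h = t^(-j)
    \<nabla>_E (t^j) - j; \<open>H j\<close> is this h computed from t^j.\<close>
  define H where "H j = fls_shift j (\<Phi> (cov (D 0) (e j))) - of_int j" for j
  have H_eq: "H i = H j" if i: "- i \<notin> GZ" and j: "- j \<notin> GZ" for i j
  proof -
    \<comment> \<open>t^N is a multiple of t^i and of t^j by monomials of \<open>A\<close>, so the
      Leibniz rule computes its h from either side. Since N is positive, t^N lies in
      \<open>dual\<close>.\<close>
    define N where "N = int cnd + \<bar>i\<bar> + \<bar>j\<bar>"
    have rep: "fls_shift N (\<Phi> (cov (D 0) v)) = H l + of_int N"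
      if l: "- l \<notin> GZ" "N - l \<ge> int cnd" and v: "v \<in> carrier M" "\<Phi> v = X N" for l v
    proof -
      define g where "g = nat (N - l)"
      have g: "g \<in> \<Gamma>" "int g = N - l"
        using l(2) by (auto simp: g_def intro: ge_cnd_in)
      have Xg: "fps_to_fls (fps_X ^ g) * f = fls_shift (- int g) f" for f :: "'k fls"
        by (simp add: fps_to_fls_power fls_X_power_times_conv_shift)
      have "\<Phi> v = \<Phi> (fps_X ^ g \<odot>\<^bsub>M\<^esub> e l)"
        unfolding Phi_smult[OF X_in_A[OF g(1)] e(1)[OF l(1)]] Xg v(2) e(2)[OF l(1)]
        by (simp add: X_def g)
      then have "v = fps_X ^ g \<odot>\<^bsub>M\<^esub> e l"
        by (rule Phi_inj) (use v g e l in auto)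
      then have "cov (D 0) v = fps_X ^ g \<odot>\<^bsub>M\<^esub> cov (D 0) (e l) \<oplus>\<^bsub>M\<^esub> D 0 (fps_X ^ g) \<odot>\<^bsub>M\<^esub> e l"
        using con D[of 0] X_in_A[OF g(1)] e(1)[OF l(1)] by (simp add: connection_def)
      moreover have "D 0 (fps_X ^ g) = of_nat g * fps_X ^ g"
      proof -
        have "fps_to_fls (shifted_euler 0 (fps_X ^ g)) = fps_to_fls (fps_X * fps_deriv (fps_X ^ g))"
          using shifted_euler(1)[of 0 "fps_X ^ g"] X_in_A[OF g(1)] by simp
        then have "shifted_euler 0 (fps_X ^ g) = fps_X * fps_deriv (fps_X ^ g)"
          by (simp only: fps_to_fls_eq_iff)
        also have "\<dots> = of_nat g * fps_X ^ g"
          by (rule fps_ext) (auto simp: fps_X_mult_nth fps_X_power_nth)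
        finally show ?thesis
          using X_in_A[OF g(1)] by (simp add: D_def)
      qed
      moreover have "of_nat g * fps_X ^ g \<in> carrier A"
        using X_in_A[OF g(1)] A_closed(3)[of "of_nat g"] by (metis A_mult_closed fps_of_nat)
      moreover have "\<Phi> ((of_nat g * fps_X ^ g) \<odot>\<^bsub>M\<^esub> e l) = of_nat g * X N"
        using Phi_smult[OF \<open>of_nat g * fps_X ^ g \<in> carrier A\<close> e(1)[OF l(1)]] e(2)[OF l(1)] Xg[of "X l"] g
        by (simp add: fls_times_fps_to_fls fps_to_fls_of_nat mult.assoc X_def)
      ultimately have "\<Phi> (cov (D 0) v) = fls_shift (- int g) (\<Phi> (cov (D 0) (e l))) + of_nat g * X N"
        using Phi_add Phi_smult[OF X_in_A[OF g(1)] cov_closed[OF _ e(1)[OF l(1)], of 0]] cov_closed[OF _ e(1)[OF l(1)], of 0]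
          X_in_A[OF g(1)] e(1)[OF l(1)] Xg by simp
      then have "fls_shift N (\<Phi> (cov (D 0) v)) = fls_shift l (\<Phi> (cov (D 0) (e l))) + of_nat g * fls_shift N (X N)"
        using g by (simp add: fls_shifted_times_simps)
      also have "fls_shift N (X N) = 1"
        by (simp add: X_def)
      also have "fls_shift l (\<Phi> (cov (D 0) (e l))) = H l + of_int l"
        by (simp add: H_def)
      also have "(of_nat g :: 'k fls) = of_int N - of_int l"
        using g(2) by (metis of_int_diff of_int_of_nat_eq)
      finally show ?thesis
        by simp
    qed
    have "int cnd > 0"
      using cnd_pos by simp
    then have "- N \<notin> GZ"
      by (auto simp: GZ_iff N_def)
    then show ?thesis
      using rep[of i "e N"] rep[of j "e N"] e[of N] i j by (auto simp: N_def)
  qed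
  have H0: "fls_nth (H (- s)) 0 = of_int s" if s: "s \<in> pseudo_frob" for s
  proof -
    have sG: "- (- s) \<notin> GZ"
      using s by (simp add: pseudo_frob_def)
    \<comment> \<open>t^s is not in \<open>A\<close>, so linearity in the derivation is applied to
      t^g (t^s E) = t^(g + s) E, with g large enough to have both monomials in
      \<open>A\<close>.\<close>
    define g where "g = nat (int cnd + \<bar>s\<bar>)"
    have g: "int g = int cnd + \<bar>s\<bar>" "g \<in> \<Gamma>"
      by (auto simp: g_def intro: ge_cnd_in)
    define h where "h = nat (int g + s)"
    have h: "int h = int g + s" "h \<in> \<Gamma>"
      using g by (auto simp: h_def intro: ge_cnd_in)
    have "fps_X ^ g \<odot>\<^bsub>derivation_module base_field A\<^esub> D s = fps_X ^ h \<odot>\<^bsub>derivation_module base_field A\<^esub> D 0"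
      unfolding derivation_module_ops
    proof (rule restrict_ext)
      fix f assume f: "f \<in> carrier A"
      have "fps_to_fls (fps_X ^ g * shifted_euler s f) = fps_to_fls (fps_X ^ h * shifted_euler 0 f)"
        using shifted_euler(1)[of s f] shifted_euler(1)[of 0 f] s f h(1)
        by (simp add: fls_times_fps_to_fls fps_to_fls_power fls_X_power_times_conv_shift add.commute)
      then have "fps_X ^ g * shifted_euler s f = fps_X ^ h * shifted_euler 0 f"
        by (simp only: fps_to_fls_eq_iff)
      then show "fps_X ^ g * D s f = fps_X ^ h * D 0 f"
        using f by (simp add: D_def)
    qed
    then have "fps_X ^ g \<odot>\<^bsub>end_module base_field A M\<^esub> cov (D s) = fps_X ^ h \<odot>\<^bsub>end_module base_field A M\<^esub> cov (D 0)"
      using module_homD(3)[OF covhom X_in_A[OF g(2)] D[of s]] module_homD(3)[OF covhom X_in_A[OF h(2)] D[of 0]] s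
      by simp
    then have "(fps_X ^ g \<odot>\<^bsub>end_module base_field A M\<^esub> cov (D s)) (e (- s)) =
        (fps_X ^ h \<odot>\<^bsub>end_module base_field A M\<^esub> cov (D 0)) (e (- s))"
      by (rule fun_cong)
    then have "fps_X ^ g \<odot>\<^bsub>M\<^esub> cov (D s) (e (- s)) = fps_X ^ h \<odot>\<^bsub>M\<^esub> cov (D 0) (e (- s))"
      using e(1)[OF sG] by (simp add: end_module_ops)
    then have "fps_to_fls (fps_X ^ g) * \<Phi> (cov (D s) (e (- s))) = fps_to_fls (fps_X ^ h) * \<Phi> (cov (D 0) (e (- s)))"
      using Phi_smult[OF X_in_A[OF g(2)] cov_closed[OF _ e(1)[OF sG], of s]]
        Phi_smult[OF X_in_A[OF h(2)] cov_closed[OF _ e(1)[OF sG], of 0]] s by simp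
    then have "fls_nth (fps_to_fls (fps_X ^ g) * \<Phi> (cov (D s) (e (- s)))) (int g) =
        fls_nth (fps_to_fls (fps_X ^ h) * \<Phi> (cov (D 0) (e (- s)))) (int g)"
      by simp
    then have "fls_nth (\<Phi> (cov (D s) (e (- s)))) 0 = fls_nth (\<Phi> (cov (D 0) (e (- s)))) (- s)"
      unfolding X_power_times_nth using h by simp
    \<comment> \<open>0 lies in \<Gamma>, so elements of \<open>dual\<close> have no constant
      term.\<close>
    moreover have "fls_nth (\<Phi> (cov (D s) (e (- s)))) 0 = 0"
      by (rule dual_nth[OF Phi_dual]) (use cov_closed[OF _ e(1)[OF sG], of s] s GZ_zero in auto)
    ultimately show ?thesis
      by (simp add: H_def fls_of_int_nth)
  qed
  have "(of_int p :: 'k) = of_int q"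
    using H0[OF p] H0[OF q] H_eq[of "- p" "- q"] p q by (simp add: pseudo_frob_def)
  then show ?thesis
    using inj by (simp add: inj_def)
qed

text \<open>On \<open>A\<close> itself, letting every derivation act as it stands is a connection.
  Symmetry makes \<open>dual\<close> a shift of \<open>A\<close>, so this connection is transported
  to \<open>M\<close> along \<Psi>.\<close>

lemma symmetric_dual_iso_imp_connection:
  assumes M: "module A M" and iso: "dual_iso M \<Phi>" and sym: symmetric_semigroup
  shows "\<exists>cov. connection base_field A M cov"
proof -
  interpret M: module A M by (rule M)
  have Phi_add: "\<Phi> (u \<oplus>\<^bsub>M\<^esub> v) = \<Phi> u + \<Phi> v" if "u \<in> carrier M" "v \<in> carrier M" for u v
    using iso that by (auto simp: dual_iso_def)
  have Phi_smult: "\<Phi> (a \<odot>\<^bsub>M\<^esub> u) = fps_to_fls a * \<Phi> u" if "a \<in> carrier A" "u \<in> carrier M" for a u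
    using iso that by (auto simp: dual_iso_def)
  have Phi_inj: "inj_on \<Phi> (carrier M)" and Phi_img: "\<Phi> ` carrier M = dual"
    using iso by (auto simp: dual_iso_def bij_betw_def)
  define \<Psi> where "\<Psi> u = fls_regpart (fls_shift (- frob) (\<Phi> u))" for u
  have ex: "\<exists>a\<in>carrier A. \<Phi> u = fls_shift frob (fps_to_fls a)" if "u \<in> carrier M" for u
    using Phi_img symmetric_dual[OF sym] that by blast
  have Psi: "fps_to_fls (\<Psi> u) = fls_shift (- frob) (\<Phi> u)" "\<Psi> u \<in> carrier A" if "u \<in> carrier M" for u
    using ex[OF that] by (auto simp: \<Psi>_def)
  note Psi_A = Psi(2)
  have Psi_inj: "u = v" if "u \<in> carrier M" "v \<in> carrier M" "\<Psi> u = \<Psi> v" for u v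
  proof -
    have "fls_shift (- frob) (\<Phi> u) = fls_shift (- frob) (\<Phi> v)"
      using Psi that by metis
    then have "fls_shift frob (fls_shift (- frob) (\<Phi> u)) = fls_shift frob (fls_shift (- frob) (\<Phi> v))"
      by (rule arg_cong)
    then have "\<Phi> u = \<Phi> v"
      by (simp add: fls_shift_fls_shift)
    then show ?thesis
      using Phi_inj that by (simp add: inj_on_def)
  qed
  have Psi_surj: "\<exists>u\<in>carrier M. \<Psi> u = a" if "a \<in> carrier A" for a
  proof -
    have "fls_shift frob (fps_to_fls a) \<in> dual"
      using symmetric_dual[OF sym] that by blast
    then obtain u where "u \<in> carrier M" "\<Phi> u = fls_shift frob (fps_to_fls a)"
      using Phi_img by (metis imageE)
    then show ?thesis
      by (intro bexI[of _ u]) (simp_all add: \<Psi>_def)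
  qed
  have Psi_add: "\<Psi> (u \<oplus>\<^bsub>M\<^esub> v) = \<Psi> u + \<Psi> v" if "u \<in> carrier M" "v \<in> carrier M" for u v
    using that by (simp add: \<Psi>_def Phi_add)
  have Psi_smult: "\<Psi> (a \<odot>\<^bsub>M\<^esub> u) = a * \<Psi> u" if "a \<in> carrier A" "u \<in> carrier M" for a u
  proof -
    have "fps_to_fls (\<Psi> (a \<odot>\<^bsub>M\<^esub> u)) = fps_to_fls (a * \<Psi> u)"
      using that by (simp add: Psi Phi_smult fls_times_fps_to_fls fls_shifted_times_simps)
    then show ?thesis
      by (simp only: fps_to_fls_eq_iff)
  qed
  define \<Theta> where "\<Theta> a = the_inv_into (carrier M) \<Psi> a" for a
  have "inj_on \<Psi> (carrier M)"
    using Psi_inj by (auto simp: inj_on_def)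
  moreover have "\<Psi> ` carrier M = carrier A"
    using Psi_A Psi_surj by (blast intro: rev_image_eqI)
  ultimately have Theta: "\<Theta> a \<in> carrier M" "\<Psi> (\<Theta> a) = a" if "a \<in> carrier A" for a
    unfolding \<Theta>_def using that by (metis the_inv_into_into subset_refl, metis f_the_inv_into_f)
  define cov where "cov D = (\<lambda>u\<in>carrier M. \<Theta> (D (\<Psi> u)))" for D
  have Dhom: "D \<in> module_hom K (regular_module A) (regular_module A)"
    if "D \<in> carrier (derivation_module base_field A)" for D
    using that unfolding derivation_carrier by blast
  have Dc: "D a \<in> carrier A" and Dadd: "b \<in> carrier A \<Longrightarrow> D (a + b) = D a + D b"
    and Dconst: "D (fps_const c * a) = fps_const c * D a"
    if "D \<in> carrier (derivation_module base_field A)" "a \<in> carrier A" for D a b c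
    using module_homD(1)[OF Dhom[OF that(1)], of a] module_homD(2)[OF Dhom[OF that(1)], of a b]
      module_homD(3)[OF Dhom[OF that(1)], of "fps_const c" a] that(2) by (auto simp: base_field_def)
  have Dleib: "D (b * a) = b * D a + D b * a"
    if "D \<in> carrier (derivation_module base_field A)" "a \<in> carrier A" "b \<in> carrier A" for D a b
    using that unfolding derivation_carrier by blast
  have eqI: "u = v" if "\<Psi> u = \<Psi> v" "u \<in> carrier M" "v \<in> carrier M" for u v
    using Psi_inj that by blast
  have "connection base_field A M cov"
    unfolding connection_def
  proof (intro conjI ballI)
    show "cov \<in> module_hom A (derivation_module base_field A) (end_module base_field A M)"
    proof (rule module_homI)
      fix D assume D: "D \<in> carrier (derivation_module base_field A)"
      show "cov D \<in> carrier (end_module base_field A M)"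
        unfolding end_module_ops
      proof (intro IntI module_homI)
        fix u assume u: "u \<in> carrier M"
        show "cov D u \<in> carrier M"
          using u Theta Dc[OF D Psi_A] by (simp add: cov_def)
        fix v assume v: "v \<in> carrier M"
        show "cov D (u \<oplus>\<^bsub>M\<^esub> v) = cov D u \<oplus>\<^bsub>M\<^esub> cov D v"
          by (rule eqI) (use u v Theta Dc[OF D] Psi_A Dadd[OF D] in \<open>simp_all add: cov_def Psi_add\<close>)
      next
        fix a u assume a: "a \<in> carrier K" and u: "u \<in> carrier M"
        then obtain c where c: "a = fps_const c"
          by (auto simp: base_field_def)
        show "cov D (a \<odot>\<^bsub>M\<^esub> u) = a \<odot>\<^bsub>M\<^esub> cov D u"
          by (rule eqI) (use u Theta Dc[OF D] Psi_A Dconst[OF D] in \<open>simp_all add: c cov_def Psi_smult\<close>)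
      qed (simp add: cov_def)
      fix D' assume D': "D' \<in> carrier (derivation_module base_field A)"
      show "cov (D \<oplus>\<^bsub>derivation_module base_field A\<^esub> D') = cov D \<oplus>\<^bsub>end_module base_field A M\<^esub> cov D'"
        unfolding end_module_ops derivation_module_ops cov_def
      proof (rule restrict_ext)
        fix u assume u: "u \<in> carrier M"
        show "\<Theta> ((\<lambda>x\<in>carrier A. D x + D' x) (\<Psi> u)) =
          (\<lambda>u\<in>carrier M. \<Theta> (D (\<Psi> u))) u \<oplus>\<^bsub>M\<^esub> (\<lambda>u\<in>carrier M. \<Theta> (D' (\<Psi> u))) u"
          by (rule eqI) (use u Theta Dc[OF D] Dc[OF D'] Psi_A in \<open>simp_all add: Psi_add\<close>)
      qed
    next
      fix a D assume a: "a \<in> carrier A" and D: "D \<in> carrier (derivation_module base_field A)"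
      show "cov (a \<odot>\<^bsub>derivation_module base_field A\<^esub> D) = a \<odot>\<^bsub>end_module base_field A M\<^esub> cov D"
        unfolding end_module_ops derivation_module_ops cov_def
      proof (rule restrict_ext)
        fix u assume u: "u \<in> carrier M"
        show "\<Theta> ((\<lambda>x\<in>carrier A. a * D x) (\<Psi> u)) = a \<odot>\<^bsub>M\<^esub> (\<lambda>u\<in>carrier M. \<Theta> (D (\<Psi> u))) u"
          by (rule eqI) (use a u Theta Dc[OF D] Psi_A in \<open>simp_all add: Psi_smult\<close>)
      qed
    qed
    fix D a u assume D: "D \<in> carrier (derivation_module base_field A)" and a: "a \<in> carrier A" and u: "u \<in> carrier M"
    show "cov D (a \<odot>\<^bsub>M\<^esub> u) = a \<odot>\<^bsub>M\<^esub> cov D u \<oplus>\<^bsub>M\<^esub> D a \<odot>\<^bsub>M\<^esub> u"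
      by (rule eqI) (use a u Theta Dc[OF D] Psi_A Dleib[OF D] in \<open>simp_all add: cov_def Psi_smult Psi_add\<close>)
  qed
  then show ?thesis by blast
qed

end

section \<open>Symmetric semigroups give Gorenstein rings\<close>

text \<open>An injective homomorphism becomes an inclusion once its source is identified with its
  image, and \<open>baer_extension\<close> handles submodules.\<close>

lemma baer_imp_injective:
  assumes E: "module R E"
    and baer: "\<And>I f. ideal I R \<Longrightarrow> f \<in> module_hom R (regular_module R\<lparr>carrier := I\<rparr>) E \<Longrightarrow>
       \<exists>z\<in>carrier E. \<forall>a\<in>I. f a = a \<odot>\<^bsub>E\<^esub> z"
  shows "injective_module R E"
  unfolding injective_module_def
proof (intro conjI allI impI)
  show "module R E" by (rule E)
  fix M N :: "('a, 'a) module" and f g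
  assume "module R M \<and> module R N \<and> f \<in> module_hom R M N \<and> inj_on f (carrier M) \<and> g \<in> module_hom R M E"
  then have M: "module R M" and N: "module R N" and f: "f \<in> module_hom R M N"
    and inj: "inj_on f (carrier M)" and g: "g \<in> module_hom R M E"
    by auto
  interpret M: module R M by (rule M)
  interpret N: module R N by (rule N)
  define H where "H = f ` carrier M"
  define k where "k x = g (the_inv_into (carrier M) f x)" for x
  have k: "k (f u) = g u" if "u \<in> carrier M" for u
    unfolding k_def using the_inv_into_f_f[OF inj that] by simp
  have "submodule H R N"
  proof (rule N.submoduleI)
    show "H \<subseteq> carrier N"
      unfolding H_def using module_homD(1)[OF f] by blast
    show "\<zero>\<^bsub>N\<^esub> \<in> H"
      unfolding H_def by (rule image_eqI[of _ _ "\<zero>\<^bsub>M\<^esub>"]) (simp_all add: module_hom_zero[OF M N f])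
    show "\<ominus>\<^bsub>N\<^esub> x \<in> H" if x: "x \<in> H" for x
    proof -
      obtain u where "u \<in> carrier M" "x = f u"
        using x unfolding H_def by blast
      then show ?thesis
        unfolding H_def using module_hom_uminus[OF M N f] by (intro image_eqI[of _ _ "\<ominus>\<^bsub>M\<^esub> u"]) auto
    qed
    show "x \<oplus>\<^bsub>N\<^esub> y \<in> H" if xy: "x \<in> H" "y \<in> H" for x y
    proof -
      obtain u v where "u \<in> carrier M" "x = f u" "v \<in> carrier M" "y = f v"
        using xy unfolding H_def by blast
      then show ?thesis
        unfolding H_def using module_homD(2)[OF f] by (intro image_eqI[of _ _ "u \<oplus>\<^bsub>M\<^esub> v"]) auto
    qed
    show "a \<odot>\<^bsub>N\<^esub> x \<in> H" if a: "a \<in> carrier R" and x: "x \<in> H" for a x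
    proof -
      obtain u where "u \<in> carrier M" "x = f u"
        using x unfolding H_def by blast
      then show ?thesis
        unfolding H_def using a module_homD(3)[OF f] by (intro image_eqI[of _ _ "a \<odot>\<^bsub>M\<^esub> u"]) auto
    qed
  qed
  moreover have "k \<in> module_hom R (N\<lparr>carrier := H\<rparr>) E"
  proof (rule module_homI)
    fix x assume "x \<in> carrier (N\<lparr>carrier := H\<rparr>)"
    then obtain u where u: "u \<in> carrier M" "x = f u"
      by (auto simp: H_def)
    show "k x \<in> carrier E"
      using k u module_homD(1)[OF g] by simp
    fix y assume "y \<in> carrier (N\<lparr>carrier := H\<rparr>)"
    then obtain v where v: "v \<in> carrier M" "y = f v"
      by (auto simp: H_def)
    have "x \<oplus>\<^bsub>N\<^esub> y = f (u \<oplus>\<^bsub>M\<^esub> v)"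
      using u v module_homD(2)[OF f] by simp
    then show "k (x \<oplus>\<^bsub>N\<lparr>carrier := H\<rparr>\<^esub> y) = k x \<oplus>\<^bsub>E\<^esub> k y"
      using k u v module_homD(2)[OF g] by simp
  next
    fix a x assume a: "a \<in> carrier R" and "x \<in> carrier (N\<lparr>carrier := H\<rparr>)"
    then obtain u where u: "u \<in> carrier M" "x = f u"
      by (auto simp: H_def)
    have "a \<odot>\<^bsub>N\<^esub> x = f (a \<odot>\<^bsub>M\<^esub> u)"
      using a u module_homD(3)[OF f] by simp
    then show "k (a \<odot>\<^bsub>N\<lparr>carrier := H\<rparr>\<^esub> x) = a \<odot>\<^bsub>E\<^esub> k x"
      using a k u module_homD(3)[OF g] by simp
  qed
  ultimately obtain h where "h \<in> module_hom R N E" "\<forall>x\<in>H. h x = k x"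
    using baer_extension[OF N E] baer by blast
  then show "\<exists>h\<in>module_hom R N E. \<forall>x\<in>carrier M. h (f x) = g x"
    using k by (auto simp: H_def intro!: bexI[of _ h])
qed

section \<open>Copies of modules in the universe of resolutions\<close>

definition transport_module :: "('b \<Rightarrow> 'c) \<Rightarrow> ('a, 'b) module \<Rightarrow> ('a, 'c) module" where
  "transport_module \<iota> M =
     \<lparr>carrier = \<iota> ` carrier M, mult = undefined, one = undefined, zero = \<iota> \<zero>\<^bsub>M\<^esub>,
      add = (\<lambda>x y. \<iota> (the_inv \<iota> x \<oplus>\<^bsub>M\<^esub> the_inv \<iota> y)), smult = (\<lambda>a x. \<iota> (a \<odot>\<^bsub>M\<^esub> the_inv \<iota> x))\<rparr>"

lemma transport_module_simps:
  assumes "inj \<iota>"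
  shows "carrier (transport_module \<iota> M) = \<iota> ` carrier M" "\<zero>\<^bsub>transport_module \<iota> M\<^esub> = \<iota> \<zero>\<^bsub>M\<^esub>"
    "\<iota> u \<oplus>\<^bsub>transport_module \<iota> M\<^esub> \<iota> v = \<iota> (u \<oplus>\<^bsub>M\<^esub> v)" "a \<odot>\<^bsub>transport_module \<iota> M\<^esub> \<iota> u = \<iota> (a \<odot>\<^bsub>M\<^esub> u)"
  using the_inv_f_f[OF assms] by (simp_all add: transport_module_def)

text \<open>The terms of a resolution must have their elements in one prescribed type, so the
  modules of Laurent series are copied there along an injection; Baer's criterion is insensitive to
  this.\<close>

lemma transport_injective_module:
  assumes inj: "inj \<iota>" and E: "module R E"
    and baer: "\<And>I f. ideal I R \<Longrightarrow> f \<in> module_hom R (regular_module R\<lparr>carrier := I\<rparr>) E \<Longrightarrow>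
       \<exists>z\<in>carrier E. \<forall>a\<in>I. f a = a \<odot>\<^bsub>E\<^esub> z"
  shows "injective_module R (transport_module \<iota> E)"
proof (rule baer_imp_injective)
  interpret E: module R E by (rule E)
  note simps = transport_module_simps[OF inj]
  show "module R (transport_module \<iota> E)"
  proof (rule moduleI)
    show "cring R" by (rule E.R.is_cring)
    show "abelian_group (transport_module \<iota> E)"
    proof (rule abelian_groupI)
      show "\<exists>y\<in>carrier (transport_module \<iota> E). y \<oplus>\<^bsub>transport_module \<iota> E\<^esub> x = \<zero>\<^bsub>transport_module \<iota> E\<^esub>"
        if "x \<in> carrier (transport_module \<iota> E)" for x
      proof -
        obtain u where u: "u \<in> carrier E" "x = \<iota> u"
          using \<open>x \<in> carrier (transport_module \<iota> E)\<close> by (auto simp: simps)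
        then show ?thesis
          by (intro bexI[of _ "\<iota> (\<ominus>\<^bsub>E\<^esub> u)"]) (auto simp: simps E.M.l_neg)
      qed
    qed (auto simp: simps E.M.a_ac)
  qed (auto simp: simps E.smult_l_distr E.smult_r_distr E.smult_assoc1)
  fix I f assume I: "ideal I R" and f: "f \<in> module_hom R (regular_module R\<lparr>carrier := I\<rparr>) (transport_module \<iota> E)"
  have fI: "\<exists>u\<in>carrier E. f a = \<iota> u" if "a \<in> I" for a
    using module_homD(1)[OF f, of a] that by (auto simp: simps)
  have "(\<lambda>a. the_inv \<iota> (f a)) \<in> module_hom R (regular_module R\<lparr>carrier := I\<rparr>) E"
  proof (rule module_homI)
    fix a assume "a \<in> carrier (regular_module R\<lparr>carrier := I\<rparr>)"
    then have a: "a \<in> I" by simp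
    obtain u where u: "u \<in> carrier E" "f a = \<iota> u"
      using fI[OF a] by blast
    show "the_inv \<iota> (f a) \<in> carrier E"
      using u the_inv_f_f[OF inj] by simp
    fix b assume "b \<in> carrier (regular_module R\<lparr>carrier := I\<rparr>)"
    then have b: "b \<in> I" by simp
    obtain v where v: "v \<in> carrier E" "f b = \<iota> v"
      using fI[OF b] by blast
    show "the_inv \<iota> (f (a \<oplus>\<^bsub>regular_module R\<lparr>carrier := I\<rparr>\<^esub> b)) = the_inv \<iota> (f a) \<oplus>\<^bsub>E\<^esub> the_inv \<iota> (f b)"
      using module_homD(2)[OF f, of a b] a b u v by (simp add: simps the_inv_f_f[OF inj])
  next
    fix c a assume c: "c \<in> carrier R" and "a \<in> carrier (regular_module R\<lparr>carrier := I\<rparr>)"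
    then have a: "a \<in> I" by simp
    obtain u where u: "u \<in> carrier E" "f a = \<iota> u"
      using fI[OF a] by blast
    show "the_inv \<iota> (f (c \<odot>\<^bsub>regular_module R\<lparr>carrier := I\<rparr>\<^esub> a)) = c \<odot>\<^bsub>E\<^esub> the_inv \<iota> (f a)"
      using module_homD(3)[OF f c, of a] a u by (simp add: simps the_inv_f_f[OF inj])
  qed
  from baer[OF I this] obtain z where z: "z \<in> carrier E" "\<And>a. a \<in> I \<Longrightarrow> the_inv \<iota> (f a) = a \<odot>\<^bsub>E\<^esub> z"
    by blast
  have "f a = a \<odot>\<^bsub>transport_module \<iota> E\<^esub> \<iota> z" if "a \<in> I" for a
    using fI[OF that] z(2)[OF that] by (auto simp: simps the_inv_f_f[OF inj])
  then show "\<exists>z\<in>carrier (transport_module \<iota> E). \<forall>a\<in>I. f a = a \<odot>\<^bsub>transport_module \<iota> E\<^esub> z"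
    using z(1) by (auto simp: simps)
qed

text \<open>A Laurent series is t^(-n) times a power series, with n the order of its pole or 0. The
  pair fits into the codomain of the universe type, where a constant function stores it.\<close>

definition fls_code :: "'k::field fls \<Rightarrow> nat \<times> 'k fps" where
  "fls_code f = (nat (- fls_subdegree f), fls_regpart (fls_shift (- int (nat (- fls_subdegree f))) f))"

lemma inj_fls_code: "inj fls_code"
proof (rule injI)
  have decode: "f = fls_shift (int (fst (fls_code f))) (fps_to_fls (snd (fls_code f)))" for f :: "'a::field fls"
  proof -
    have "fls_nth (fls_shift (- int (nat (- fls_subdegree f))) f) k = 0" if "k < 0" for k
      using that by (auto intro: fls_eq0_below_subdegree)
    then have "fps_to_fls (snd (fls_code f)) = fls_shift (- int (nat (- fls_subdegree f))) f"
      unfolding fls_code_def snd_conv by (intro fls_regpart_to_fls_trivial fls_subdegree_ge0I)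
    then show ?thesis
      by (simp add: fls_code_def)
  qed
  show "f = g" if "fls_code f = fls_code g" for f g :: "'a fls"
    using decode[of f] decode[of g] that by simp
qed

definition fls_embed :: "'k::field fls \<Rightarrow> ('k fps, 'k fps) universe" where
  "fls_embed f = (\<lambda>_. fls_code f)"

lemma inj_fls_embed: "inj fls_embed"
  using inj_fls_code unfolding inj_def fls_embed_def by metis

definition laurent_module :: "('k::field fps, 'k fls) module" where
  "laurent_module = \<lparr>carrier = UNIV, mult = undefined, one = undefined, zero = 0, add = (+),
     smult = (\<lambda>a f. fps_to_fls a * f)\<rparr>"

lemma laurent_module_simps [simp]:
  "carrier laurent_module = UNIV" "add laurent_module = (+)" "\<zero>\<^bsub>laurent_module\<^esub> = 0"
  "a \<odot>\<^bsub>laurent_module\<^esub> f = fps_to_fls a * f"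
  by (simp_all add: laurent_module_def)

section \<open>Injectivity of k((t)) and of k((t))/dual\<close>

context monomial_ring
begin

lemma laurent_module: "module A laurent_module"
proof (rule moduleI)
  show "abelian_group (laurent_module :: ('k fps, 'k fls) module)"
  proof (rule abelian_groupI)
    show "\<exists>y\<in>carrier laurent_module. y \<oplus>\<^bsub>laurent_module\<^esub> x = \<zero>\<^bsub>laurent_module\<^esub>" for x :: "'k fls"
      by (intro bexI[of _ "- x"]) auto
  qed (auto simp: add_ac)
qed (auto simp: cring_A algebra_simps fls_times_fps_to_fls)

text \<open>The quotient of f a by a is the same for all nonzero a in the ideal, as y f(a) = a
  f(y).\<close>

lemma laurent_module_baer:
  assumes I: "ideal I A" and f: "f \<in> module_hom A (regular_module A\<lparr>carrier := I\<rparr>) laurent_module"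
  shows "\<exists>z\<in>carrier laurent_module. \<forall>a\<in>I. f a = a \<odot>\<^bsub>laurent_module\<^esub> z"
proof -
  interpret I: ideal I A by (rule I)
  have IA: "I \<subseteq> carrier A"
    by (rule I.a_subset)
  have sm: "f (b * a) = fps_to_fls b * f a" if "b \<in> carrier A" "a \<in> I" for a b
    using module_homD(3)[OF f that(1), of a] that(2) by simp
  show ?thesis
  proof (cases "I \<subseteq> {0}")
    case True
    have "f 0 = 0"
      using sm[of 0 0] I.zero_closed by simp
    then show ?thesis
      using True by (intro bexI[of _ 0]) auto
  next
    case False
    then obtain y where y: "y \<in> I" "y \<noteq> 0"
      by blast
    have "f a = fps_to_fls a * (f y / fps_to_fls y)" if a: "a \<in> I" for a
    proof -
      have "fps_to_fls y * f a = fps_to_fls a * f y"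
        using sm[of y a] sm[of a y] a y(1) IA by (auto simp: mult.commute)
      then show ?thesis
        using y(2) by (simp add: field_simps)
    qed
    then show ?thesis
      by (intro bexI[of _ "f y / fps_to_fls y"]) auto
  qed
qed

definition polar :: "'k fls \<Rightarrow> 'k fls" where
  "polar f = Abs_fls (\<lambda>j. if - j \<in> GZ then fls_nth f j else 0)"

lemma polar_nth [simp]: "fls_nth (polar f) j = (if - j \<in> GZ then fls_nth f j else 0)"
  unfolding polar_def
  by (intro nth_Abs_fls_lower_bound[of "fls_subdegree f"]) auto

lemma polar_add: "polar (f + g) = polar f + polar g"
  and polar_diff: "polar (f - g) = polar f - polar g"
  and polar_polar: "polar (polar f) = polar f"
  and polar_zero: "polar 0 = 0"
  by (auto intro!: fls_eqI)

lemma polar_eq_zero_iff: "polar f = 0 \<longleftrightarrow> f \<in> dual"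
proof
  assume "polar f = 0"
  then have "fls_nth (polar f) j = 0" for j
    by simp
  then have "- j \<in> GZ \<Longrightarrow> fls_nth f j = 0" for j
    by (metis polar_nth)
  then show "f \<in> dual"
    by (auto simp: dual_def)
next
  assume "f \<in> dual"
  then show "polar f = 0"
    using dual_nth by (intro fls_eqI) auto
qed

text \<open>\<open>f\<close> and \<open>polar f\<close> differ by an element of \<open>dual\<close>,
  which is stable under \<open>A\<close>. This makes the action on representatives associative and
  \<open>polar\<close> linear over \<open>A\<close>.\<close>

lemma polar_smult_polar:
  assumes "a \<in> carrier A" shows "polar (fps_to_fls a * polar f) = polar (fps_to_fls a * f)"
proof -
  have "f - polar f \<in> dual"
    using polar_eq_zero_iff[of "f - polar f"] by (simp add: polar_diff polar_polar)
  then have "fps_to_fls a * (f - polar f) \<in> dual"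
    by (rule dual_smult[OF assms])
  then have "polar (fps_to_fls a * f - fps_to_fls a * polar f) = 0"
    using polar_eq_zero_iff by (simp add: algebra_simps)
  then show ?thesis
    by (simp add: polar_diff)
qed

text \<open>A model of \<open>k((t))/dual\<close>: every class is represented by its unique element with exponents in
  \<open>-\<Gamma>\<close>.\<close>

definition polar_module :: "('k fps, 'k fls) module" where
  "polar_module = \<lparr>carrier = range polar, mult = undefined, one = undefined, zero = 0, add = (+),
     smult = (\<lambda>a f. polar (fps_to_fls a * f))\<rparr>"

lemma polar_module_simps [simp]:
  "carrier polar_module = range polar" "add polar_module = (+)" "\<zero>\<^bsub>polar_module\<^esub> = 0"
  "a \<odot>\<^bsub>polar_module\<^esub> f = polar (fps_to_fls a * f)"
  by (simp_all add: polar_module_def)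

lemma polar_range: "f \<in> range polar \<longleftrightarrow> polar f = f"
  using polar_polar by (metis rangeE rangeI)

lemma zero_polar: "0 \<in> range polar"
  by (simp add: polar_range polar_zero)

lemma polar_module: "module A polar_module"
proof (rule moduleI)
  show "abelian_group polar_module"
  proof (rule abelian_groupI)
    show "\<exists>y\<in>carrier polar_module. y \<oplus>\<^bsub>polar_module\<^esub> x = \<zero>\<^bsub>polar_module\<^esub>"
      if "x \<in> carrier polar_module" for x :: "'k fls"
    proof (intro bexI)
      show "- x \<in> carrier polar_module"
        using that polar_diff[of 0 x] unfolding polar_module_simps polar_range by (simp add: polar_zero)
    qed auto
  qed (auto simp: add_ac polar_range polar_add polar_zero polar_polar)
next
  fix a b f assume ab: "a \<in> carrier A" "b \<in> carrier A" and f: "f \<in> carrier polar_module"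
  show "(a \<oplus>\<^bsub>A\<^esub> b) \<odot>\<^bsub>polar_module\<^esub> f = a \<odot>\<^bsub>polar_module\<^esub> f \<oplus>\<^bsub>polar_module\<^esub> b \<odot>\<^bsub>polar_module\<^esub> f"
    by (simp add: distrib_right polar_add)
  show "(a \<otimes>\<^bsub>A\<^esub> b) \<odot>\<^bsub>polar_module\<^esub> f = a \<odot>\<^bsub>polar_module\<^esub> (b \<odot>\<^bsub>polar_module\<^esub> f)"
    using ab by (simp add: fls_times_fps_to_fls polar_smult_polar mult.assoc)
qed (auto simp: cring_A distrib_left polar_add polar_polar)

text \<open>The coefficient of an element at t^(-m) is the constant coefficient of its multiple by
  t^m, so a homomorphism into k((t))/dual is determined by the functional that takes the constant
  coefficient. Extending this functional from \<open>I\<close> to \<open>A\<close> extends the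
  homomorphism, provided that the extension is represented by a Laurent polynomial.\<close>

lemma polar_module_baer:
  assumes I: "ideal I A" and g: "g \<in> module_hom A (regular_module A\<lparr>carrier := I\<rparr>) polar_module"
  shows "\<exists>z\<in>carrier polar_module. \<forall>a\<in>I. g a = a \<odot>\<^bsub>polar_module\<^esub> z"
proof -
  interpret I: ideal I A by (rule I)
  have IA: "I \<subseteq> carrier A"
    by (rule I.a_subset)
  have Imult: "b * a \<in> I" if "b \<in> carrier A" "a \<in> I" for a b
    using I.I_l_closed that by simp
  have gp: "polar (g a) = g a" if "a \<in> I" for a
    using module_homD(1)[OF g, of a] that polar_range by simp
  have gsm: "g (b * a) = polar (fps_to_fls b * g a)" if "b \<in> carrier A" "a \<in> I" for a b
    using module_homD(3)[OF g that(1), of a] that(2) by simp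
  have gadd: "g (a + b) = g a + g b" if "a \<in> I" "b \<in> I" for a b
    using module_homD(2)[OF g, of a b] that by simp
  show ?thesis
  proof (cases "I \<subseteq> {0}")
    case True
    have "g 0 = 0"
      using gsm[of 0 0] I.zero_closed by (simp add: polar_zero)
    then show ?thesis
      using True by (intro bexI[of _ 0]) (auto simp: polar_range polar_zero)
  next
    case False
    then obtain y where y: "y \<in> I" "y \<noteq> 0"
      by blast
    \<comment> \<open>Subtracting multiplication by \<open>q\<close> makes the homomorphism vanish
      at \<open>y\<close>, hence on all series of order at least \<open>N\<close>. Otherwise the
      extended functional could require infinitely many negative exponents.\<close>
    define q where "q = g y / fps_to_fls y"
    define g' where "g' a = g a - polar (fps_to_fls a * q)" for a
    have g'y: "g' y = 0"
      using y gp by (simp add: g'_def q_def)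
    have g'p: "polar (g' a) = g' a" if "a \<in> I" for a
      using gp[OF that] by (simp add: g'_def polar_diff polar_polar)
    have g'sm: "g' (b * a) = polar (fps_to_fls b * g' a)" if "b \<in> carrier A" "a \<in> I" for a b
      using gsm[OF that] polar_smult_polar[OF that(1), of "fps_to_fls a * q"]
      by (simp add: g'_def polar_diff fls_times_fps_to_fls right_diff_distrib mult.assoc)
    have g'add: "g' (a + b) = g' a + g' b" if "a \<in> I" "b \<in> I" for a b
      using gadd[OF that] by (simp add: g'_def distrib_right polar_add)
    define N where "N = subdegree y + cnd"
    have high: "a \<in> I \<and> g' a = 0" if a: "\<And>i. i < N \<Longrightarrow> fps_nth a i = 0" for a
    proof -
      obtain b where b: "b \<in> carrier A" "a = b * y"
        by (rule high_order_multiple[OF y(2), of a]) (use a in \<open>auto simp: N_def\<close>)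
      show ?thesis
        using g'sm[OF b(1) y(1)] Imult[OF b(1) y(1)] g'y by (simp add: b(2) polar_zero)
    qed
    define \<phi> where "\<phi> a = fls_nth (g' a) 0" for a
    have "functional (regular_module A) I \<phi>"
      unfolding functional_def using g'add g'sm GZ_zero by (auto simp: \<phi>_def)
    moreover have "I \<noteq> {}"
      using y by blast
    ultimately obtain h where h: "functional (regular_module A) (carrier A) h" "\<And>a. a \<in> I \<Longrightarrow> h a = \<phi> a"
      using functional_extend[OF regular_module[OF cring_A], of I \<phi>] IA Imult I.a_closed by auto
    have hadd: "h (a + b) = h a + h b" if "a \<in> carrier A" "b \<in> carrier A" for a b
      using h(1) that by (simp add: functional_def)
    have hconst: "h (fps_const c * a) = c * h a" if "a \<in> carrier A" for a c
      using h(1) that by (simp add: functional_def)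
    have h0: "h 0 = 0"
      using hconst[of 0 0] by simp
    \<comment> \<open>The coefficient at t^(-n) is h (t^n), so that b z has constant coefficient h
      b; the sum may stop at \<open>N\<close> because h kills all series of order at least
      \<open>N\<close>.\<close>
    define z where "z = (\<Sum>n<N. fls_const (if n \<in> \<Gamma> then h (fps_X ^ n) else 0) * fls_shift (int n) 1)"
    have trunc: "(\<Sum>i<m. fps_const (fps_nth b i) * fps_X ^ i) \<in> carrier A \<and>
        h (\<Sum>i<m. fps_const (fps_nth b i) * fps_X ^ i) = (\<Sum>i<m. fps_nth b i * (if i \<in> \<Gamma> then h (fps_X ^ i) else 0))"
      if b: "b \<in> carrier A" for b m
    proof (induction m)
      case 0
      then show ?case by (simp add: h0)
    next
      case (Suc m)
      show ?case
      proof (cases "fps_nth b m = 0")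
        case True
        then show ?thesis using Suc by simp
      next
        case False
        then have m: "m \<in> \<Gamma>"
          using b by (simp add: carrier_A)
        then show ?thesis
          using Suc X_in_A[OF m] by (simp add: hadd hconst)
      qed
    qed
    have zh: "fls_nth (fps_to_fls b * z) 0 = h b" if b: "b \<in> carrier A" for b
    proof -
      define p where "p = (\<Sum>i<N. fps_const (fps_nth b i) * fps_X ^ i)"
      have p: "p \<in> carrier A" "h p = (\<Sum>i<N. fps_nth b i * (if i \<in> \<Gamma> then h (fps_X ^ i) else 0))"
        using trunc[OF b] by (auto simp: p_def)
      have "fps_nth (b - p) i = 0" if "i < N" for i
        using that by (simp add: p_def fps_sum_nth if_distrib cong: if_cong)
      then have "h (b - p) = 0"
        using high h(2) by (simp add: \<phi>_def)
      then have "h b = h p"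
        using hadd[OF p(1), of "b - p"] b p(1) by simp
      moreover have "fls_nth (fps_to_fls b * z) 0 = (\<Sum>i<N. fps_nth b i * (if i \<in> \<Gamma> then h (fps_X ^ i) else 0))"
      proof -
        have "fls_nth (fps_to_fls b * (fls_const c * fls_shift (int n) 1)) 0 = fps_nth b n * c" for c n
        proof -
          have "fps_to_fls b * (fls_const c * fls_shift (int n) 1) = fls_const c * fls_shift (int n) (fps_to_fls b)"
            by (simp only: mult.left_commute[of "fps_to_fls b"] fls_shifted_times_simps mult_1_left mult_1_right mult.commute)
          then show ?thesis
            by (simp only: fls_mult_const_nth fls_shift_nth) (simp add: mult.commute)
        qed
        then show ?thesis
          unfolding z_def sum_distrib_left fls_nth_sum by simp
      qed
      ultimately show ?thesis
        using p(2) by simp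
    qed
    have "g a = polar (fps_to_fls a * (polar (z + q)))" if a: "a \<in> I" for a
    proof -
      have aA: "a \<in> carrier A"
        using a IA by blast
      have "g' a = polar (fps_to_fls a * z)"
      proof (rule fls_eqI)
        fix j
        show "fls_nth (g' a) j = fls_nth (polar (fps_to_fls a * z)) j"
        proof (cases "- j \<in> GZ")
          case False
          then show ?thesis
            using g'p[OF a] polar_nth[of "g' a" j] by simp
        next
          case True
          then obtain m where "m \<in> \<Gamma>" "- j = int m"
            by blast
          then have m: "m \<in> \<Gamma>" "j = - int m"
            by auto
          have "fls_nth (fps_to_fls a * z) j = fls_nth (fps_to_fls (fps_X ^ m) * (fps_to_fls a * z)) 0"
            unfolding X_power_times_nth using m by simp
          also have "\<dots> = h (fps_X ^ m * a)"
            using zh[of "fps_X ^ m * a"] X_in_A[OF m(1)] aA by (simp only: fls_times_fps_to_fls mult.assoc A_mult_closed)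
          also have "\<dots> = fls_nth (g' (fps_X ^ m * a)) 0"
            using h(2)[OF Imult[OF X_in_A[OF m(1)] a]] by (simp add: \<phi>_def)
          also have "\<dots> = fls_nth (fps_to_fls (fps_X ^ m) * g' a) 0"
            unfolding g'sm[OF X_in_A[OF m(1)] a] using GZ_zero by simp
          also have "\<dots> = fls_nth (g' a) j"
            unfolding X_power_times_nth using m by simp
          finally show ?thesis
            using True by simp
        qed
      qed
      then have "g a = polar (fps_to_fls a * (z + q))"
        by (simp add: g'_def distrib_left polar_add algebra_simps)
      then show ?thesis
        by (simp add: polar_smult_polar[OF aA])
    qed
    then show ?thesis
      by (intro bexI[of _ "polar (z + q)"]) auto
  qed
qed

text \<open>The kernel of \<open>polar\<close> is \<open>dual\<close>, so \<open>A\<close> enters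
  the resolution through its shift t^(-frob) A = dual and not by inclusion. The terms from index 2
  on are zero.\<close>

lemma symmetric_imp_gorenstein:
  assumes sym: symmetric_semigroup shows "gorenstein A"
proof -
  define \<iota> where "\<iota> = (fls_embed :: 'k fls \<Rightarrow> _)"
  have inj: "inj \<iota>"
    unfolding \<iota>_def by (rule inj_fls_embed)
  define Z where "Z = (polar_module\<lparr>carrier := {0}\<rparr> :: ('k fps, 'k fls) module)"
  have "submodule {0} A polar_module"
    by (rule module.submoduleI[OF polar_module])
       (auto simp: polar_zero zero_polar intro!: module.smult_r_null[OF polar_module, simplified]
         abelian_group.minus_equality[OF module.axioms(2)[OF polar_module], simplified])
  then have Z: "module A Z"
    unfolding Z_def using submodule.submodule_is_module polar_module by blast
  have Z_baer: "\<exists>z\<in>carrier Z. \<forall>a\<in>I. f a = a \<odot>\<^bsub>Z\<^esub> z"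
    if "ideal I A" "f \<in> module_hom A (regular_module A\<lparr>carrier := I\<rparr>) Z" for I f
    using module_homD(1)[OF that(2)] by (auto simp: Z_def polar_zero)
  define B where "B i = (if i = 0 then laurent_module else if i = 1 then polar_module else Z)" for i :: nat
  define I where "I i = transport_module \<iota> (B i)" for i
  define d where "d i x = (if i = 0 then \<iota> (polar (the_inv \<iota> x)) else \<iota> 0)" for i :: nat and x
  define \<epsilon> where "\<epsilon> a = \<iota> (fls_shift frob (fps_to_fls a))" for a
  note simps = transport_module_simps[OF inj]
  have B0: "\<zero>\<^bsub>B i\<^esub> = 0" for i
    by (simp add: B_def Z_def)
  have I: "carrier (I 0) = range \<iota>" "carrier (I 1) = \<iota> ` range polar" "\<zero>\<^bsub>I i\<^esub> = \<iota> 0" for i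
    unfolding I_def simps B0 by (simp_all add: B_def)
  have I2: "carrier (I i) = {\<iota> 0}" if "i > 1" for i
    unfolding I_def simps using that by (simp add: B_def Z_def)
  have Imod: "injective_module A (I i)" for i
    unfolding I_def B_def
    using transport_injective_module[OF inj laurent_module laurent_module_baer]
      transport_injective_module[OF inj polar_module polar_module_baer]
      transport_injective_module[OF inj Z Z_baer] by simp
  have modI: "module A (I i)" for i
    using Imod by (simp add: injective_module_def)
  have d0: "d 0 (\<iota> f) = \<iota> (polar f)" for f
    by (simp add: d_def the_inv_f_f[OF inj])
  have dS: "d (Suc i) x = \<iota> 0" for i x
    by (simp add: d_def)
  have zero_in: "\<iota> 0 \<in> carrier (I i)" for i
    using abelian_group.axioms(1)[OF module.axioms(2)[OF modI]] I(3)[of i] abelian_monoid.zero_closed by metis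
  have "injective_resolution A (regular_module A) \<epsilon> I d"
    unfolding injective_resolution_def
  proof (intro conjI allI)
    show "injective_module A (I i)" for i by (rule Imod)
    show "\<epsilon> \<in> module_hom A (regular_module A) (I 0)"
      by (rule module_homI)
         (auto simp: \<epsilon>_def I I_def B_def simps fls_times_fps_to_fls fls_shifted_times_simps)
    show "inj_on \<epsilon> (carrier (regular_module A))"
    proof (rule inj_onI)
      fix a b assume "\<epsilon> a = \<epsilon> b"
      then have "fls_shift frob (fps_to_fls a) = fls_shift frob (fps_to_fls b)"
        using inj by (simp add: \<epsilon>_def inj_def)
      then have "fls_shift (- frob) (fls_shift frob (fps_to_fls a)) = fls_shift (- frob) (fls_shift frob (fps_to_fls b))"
        by (rule arg_cong)
      then show "a = b"
        by simp
    qed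
    show "d i \<in> module_hom A (I i) (I (Suc i))" for i
    proof (cases i)
      case 0
      have "d 0 \<in> module_hom A (I 0) (I 1)"
        by (rule module_homI) (auto simp: I d0 I_def B_def simps polar_add polar_smult_polar)
      then show ?thesis
        using 0 by simp
    next
      case (Suc j)
      have "a \<odot>\<^bsub>I (Suc i)\<^esub> \<iota> 0 = \<iota> 0" if "a \<in> carrier A" for a
        using module.smult_r_null[OF modI that, of "Suc i"] I(3) by metis
      moreover have "\<iota> 0 \<oplus>\<^bsub>I (Suc i)\<^esub> \<iota> 0 = \<iota> 0"
        by (simp add: I_def B_def Z_def simps)
      ultimately show ?thesis
        using Suc dS zero_in by (intro module_homI) auto
    qed
    show "\<epsilon> ` carrier (regular_module A) = {x \<in> carrier (I 0). d 0 x = \<zero>\<^bsub>I 1\<^esub>}"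
    proof -
      have "{x \<in> carrier (I 0). d 0 x = \<zero>\<^bsub>I 1\<^esub>} = \<iota> ` dual"
      proof -
        have "\<iota> (polar f) = \<iota> 0 \<longleftrightarrow> f \<in> dual" for f
          using inj polar_eq_zero_iff[of f] by (simp add: inj_eq)
        then show ?thesis
          by (auto simp: I d0)
      qed
      moreover note symmetric_dual[OF sym]
      ultimately show ?thesis
        unfolding regular_module_simps \<epsilon>_def by (metis image_image)
    qed
    show "d i ` carrier (I i) = {x \<in> carrier (I (Suc i)). d (Suc i) x = \<zero>\<^bsub>I (Suc (Suc i))\<^esub>}" for i
    proof (cases i)
      case 0
      have "d 0 ` carrier (I 0) = carrier (I 1)"
        unfolding I(1,2) by (auto simp: d0 image_iff)
      then show ?thesis
        using 0 dS I(3) by simp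
    next
      case (Suc j)
      have "d i ` carrier (I i) = {\<iota> 0}"
        using Suc dS zero_in by auto
      then show ?thesis
        using Suc dS I(3) I2[of "Suc i"] by auto
    qed
  qed
  moreover have "\<forall>i>1. carrier (I i) = {\<zero>\<^bsub>I i\<^esub>}"
    using I2 I(3) by simp
  ultimately show ?thesis
    unfolding gorenstein_def finite_injective_dimension_def by blast
qed

section \<open>Finite injective dimension forces symmetry\<close>

definition monomial_set :: "nat set \<Rightarrow> bool" where
  "monomial_set S \<longleftrightarrow> S \<subseteq> \<Gamma> \<and> (\<forall>s\<in>S. \<forall>g\<in>\<Gamma>. s + g \<in> S) \<and> finite (\<Gamma> - S)"

definition monomial_ideal :: "nat set \<Rightarrow> 'k fps set" where
  "monomial_ideal S = {f. \<forall>n. fps_nth f n \<noteq> 0 \<longrightarrow> n \<in> S}"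

lemma monomial_ideal_nth: "f \<in> monomial_ideal S \<Longrightarrow> n \<notin> S \<Longrightarrow> fps_nth f n = 0"
  by (auto simp: monomial_ideal_def)

lemma monomial_ideal_subset: "S \<subseteq> \<Gamma> \<Longrightarrow> monomial_ideal S \<subseteq> carrier A"
  unfolding monomial_ideal_def using carrier_A by blast

lemma X_in_monomial_ideal: "n \<in> S \<Longrightarrow> fps_X ^ n \<in> monomial_ideal S"
  by (auto simp: monomial_ideal_def split: if_splits)

lemma monomial_ideal_add: "f \<in> monomial_ideal S \<Longrightarrow> g \<in> monomial_ideal S \<Longrightarrow> f + g \<in> monomial_ideal S"
proof -
  assume f: "f \<in> monomial_ideal S" and g: "g \<in> monomial_ideal S"
  have "n \<in> S" if "fps_nth (f + g) n \<noteq> 0" for n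
    by (rule ccontr) (use that monomial_ideal_nth[OF f] monomial_ideal_nth[OF g] in simp)
  then show ?thesis
    by (simp add: monomial_ideal_def)
qed

lemma monomial_ideal_ideal:
  assumes "monomial_set S" shows "ideal (monomial_ideal S) A"
proof (rule ideal_A_I)
  have S: "S \<subseteq> \<Gamma>" "\<And>s g. s \<in> S \<Longrightarrow> g \<in> \<Gamma> \<Longrightarrow> s + g \<in> S"
    using assms by (auto simp: monomial_set_def)
  show "monomial_ideal S \<subseteq> carrier A"
    by (rule monomial_ideal_subset[OF S(1)])
  show "b * a \<in> monomial_ideal S" if a: "a \<in> monomial_ideal S" and b: "b \<in> carrier A" for a b
    unfolding monomial_ideal_def
  proof (intro CollectI allI impI)
    fix n assume "fps_nth (b * a) n \<noteq> 0"
    then obtain i j where "i + j = n" "fps_nth b i \<noteq> 0" "fps_nth a j \<noteq> 0"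
      by (rule fps_mult_nth_nonzeroE)
    then show "n \<in> S"
      using S(2)[of j i] a b by (auto simp: monomial_ideal_def carrier_A add.commute)
  qed
  show "0 \<in> monomial_ideal S"
    by (simp add: monomial_ideal_def)
qed (rule monomial_ideal_add)

text \<open>The condition on \<open>w\<close> says that t^w is no proper multiple of a monomial of
  the ideal. So the coefficient at \<open>w\<close> vanishes on the maximal ideal times this ideal
  and is a homomorphism to k, which is composed with the map from k to \<open>N\<close> given by the
  socle element \<open>y\<close>.\<close>

lemma coefficient_hom:
  assumes N: "module A N" and S: "monomial_set S"
    and w: "\<And>j g. j \<in> S \<Longrightarrow> g \<in> \<Gamma> \<Longrightarrow> g > 0 \<Longrightarrow> j + g \<noteq> w"
    and y: "y \<in> carrier N" "\<And>a. a \<in> carrier A \<Longrightarrow> fps_nth a 0 = 0 \<Longrightarrow> a \<odot>\<^bsub>N\<^esub> y = \<zero>\<^bsub>N\<^esub>"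
  shows "(\<lambda>f. fps_const (fps_nth f w) \<odot>\<^bsub>N\<^esub> y) \<in> module_hom A (regular_module A\<lparr>carrier := monomial_ideal S\<rparr>) N"
proof (rule module_hom_compose[of "\<lambda>f. fps_nth f w" A _ residue_module "\<lambda>c. fps_const c \<odot>\<^bsub>N\<^esub> y"])
  show "(\<lambda>c. fps_const c \<odot>\<^bsub>N\<^esub> y) \<in> module_hom A residue_module N"
    by (rule residue_homI[OF N y])
  show "(\<lambda>f. fps_nth f w) \<in> module_hom A (regular_module A\<lparr>carrier := monomial_ideal S\<rparr>) residue_module"
  proof (rule module_homI)
    fix a f assume a: "a \<in> carrier A" and "f \<in> carrier (regular_module A\<lparr>carrier := monomial_ideal S\<rparr>)"
    then have f: "f \<in> monomial_ideal S" by simp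
    have "fps_nth ((a - fps_const (fps_nth a 0)) * f) w = 0"
    proof (rule ccontr)
      assume "fps_nth ((a - fps_const (fps_nth a 0)) * f) w \<noteq> 0"
      then obtain i j where "i + j = w" "fps_nth (a - fps_const (fps_nth a 0)) i \<noteq> 0" "fps_nth f j \<noteq> 0"
        by (rule fps_mult_nth_nonzeroE)
      moreover then have "i > 0" "i \<in> \<Gamma>" "j \<in> S"
        using a f by (auto simp: carrier_A monomial_ideal_def intro: gr0I split: if_splits)
      ultimately show False
        using w[of j i] by (simp add: add.commute)
    qed
    then show "fps_nth (a \<odot>\<^bsub>regular_module A\<lparr>carrier := monomial_ideal S\<rparr>\<^esub> f) w = a \<odot>\<^bsub>residue_module\<^esub> fps_nth f w"
      by (simp add: left_diff_distrib)
  qed auto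
qed

text \<open>For an injective resolution of \<open>A\<close> and \<open>i > 0\<close> this says \<open>Ext^(i+1)(A/J, A) = 0\<close> for the
  monomial ideal \<open>J\<close> of \<open>S\<close>.\<close>

definition extends_to_cycles ::
  "(nat \<Rightarrow> ('k fps, 'u) module) \<Rightarrow> (nat \<Rightarrow> 'u \<Rightarrow> 'u) \<Rightarrow> nat \<Rightarrow> nat set \<Rightarrow> bool" where
  "extends_to_cycles I d i S \<longleftrightarrow>
     (\<forall>g\<in>module_hom A (regular_module A\<lparr>carrier := monomial_ideal S\<rparr>) (I i).
        (\<forall>a\<in>monomial_ideal S. d i (g a) = \<zero>\<^bsub>I (Suc i)\<^esub>) \<longrightarrow>
        (\<exists>z\<in>carrier (I i). d i z = \<zero>\<^bsub>I (Suc i)\<^esub> \<and> (\<forall>a\<in>monomial_ideal S. g a = a \<odot>\<^bsub>I i\<^esub> z)))"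

lemma extends_to_cyclesE:
  assumes "extends_to_cycles I d i S" "g \<in> module_hom A (regular_module A\<lparr>carrier := monomial_ideal S\<rparr>) (I i)"
    and "\<forall>a\<in>monomial_ideal S. d i (g a) = \<zero>\<^bsub>I (Suc i)\<^esub>"
  obtains z where "z \<in> carrier (I i)" "d i z = \<zero>\<^bsub>I (Suc i)\<^esub>" "\<forall>a\<in>monomial_ideal S. g a = a \<odot>\<^bsub>I i\<^esub> z"
  using bspec[OF assms(1)[unfolded extends_to_cycles_def] assms(2), THEN mp, OF assms(3)] by auto

lemma monomial_set_max: "monomial_set (\<Gamma> - {0})"
  using add_in finite_subset[of "\<Gamma> - (\<Gamma> - {0})" "{0}"] by (auto simp: monomial_set_def)

lemma max_monomial_ideal: "monomial_ideal (\<Gamma> - {0}) = {f \<in> carrier A. fps_nth f 0 = 0}"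
  by (auto simp: monomial_ideal_def carrier_A) (metis gr0I)

text \<open>Induction on the colength. For the largest exponent u of \<Gamma> missing in
  \<open>S\<close>, adding t^u enlarges the ideal by a copy of k, so vanishing for k and for the
  larger ideal gives it for \<open>S\<close>.\<close>

lemma extends_from_max:
  assumes I: "module A (I i)" "module A (I (Suc i))" and d: "d i \<in> module_hom A (I i) (I (Suc i))"
    and max: "extends_to_cycles I d i (\<Gamma> - {0})"
  shows "monomial_set S \<Longrightarrow> extends_to_cycles I d i S"
proof (induction "card (\<Gamma> - S)" arbitrary: S rule: less_induct)
  case less
  interpret Ii: module A "I i" by (rule I)
  interpret Is: module A "I (Suc i)" by (rule I)
  have S: "S \<subseteq> \<Gamma>" "\<And>s g. s \<in> S \<Longrightarrow> g \<in> \<Gamma> \<Longrightarrow> s + g \<in> S" "finite (\<Gamma> - S)"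
    using less.prems by (auto simp: monomial_set_def)
  have SA: "a \<in> carrier A" if "a \<in> monomial_ideal S" for a
    using monomial_ideal_subset[OF S(1)] that by blast
  show ?case
    unfolding extends_to_cycles_def
  proof (intro ballI impI)
    fix g assume g: "g \<in> module_hom A (regular_module A\<lparr>carrier := monomial_ideal S\<rparr>) (I i)"
      and dg: "\<forall>a\<in>monomial_ideal S. d i (g a) = \<zero>\<^bsub>I (Suc i)\<^esub>"
    have gc: "g a \<in> carrier (I i)" if "a \<in> monomial_ideal S" for a
      using module_homD(1)[OF g, of a] that by simp
    have gadd: "g (a + b) = g a \<oplus>\<^bsub>I i\<^esub> g b" if "a \<in> monomial_ideal S" "b \<in> monomial_ideal S" for a b
      using module_homD(2)[OF g, of a b] that by simp
    have gsm: "g (b * a) = b \<odot>\<^bsub>I i\<^esub> g a" if "b \<in> carrier A" "a \<in> monomial_ideal S" for a b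
      using module_homD(3)[OF g that(1), of a] that(2) by simp
    show "\<exists>z\<in>carrier (I i). d i z = \<zero>\<^bsub>I (Suc i)\<^esub> \<and> (\<forall>a\<in>monomial_ideal S. g a = a \<odot>\<^bsub>I i\<^esub> z)"
    proof (cases "\<Gamma> - S = {}")
      case True
      then have 1: "1 \<in> monomial_ideal S"
        using zero_in by (auto simp: monomial_ideal_def)
      have "g a = a \<odot>\<^bsub>I i\<^esub> g 1" if "a \<in> monomial_ideal S" for a
        using gsm[OF SA[OF that] 1] by simp
      then show ?thesis
        using gc[OF 1] dg 1 by blast
    next
      case False
      define u where "u = Max (\<Gamma> - S)"
      have u: "u \<in> \<Gamma>" "u \<notin> S" "\<And>v. v \<in> \<Gamma> \<Longrightarrow> v \<notin> S \<Longrightarrow> v \<le> u"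
        using Max_in[OF S(3) False] Max_ge[OF S(3)] by (auto simp: u_def)
      have uS: "u + n \<in> S" if "n \<in> \<Gamma>" "n > 0" for n
        using u(3)[of "u + n"] add_in[OF u(1) that(1)] that(2) by (cases "u + n \<in> S") auto
      define S' where "S' = insert u S"
      have S': "monomial_set S'"
        unfolding monomial_set_def S'_def
      proof (intro conjI ballI)
        show "s + n \<in> insert u S" if "s \<in> insert u S" "n \<in> \<Gamma>" for s n
          using that uS[OF that(2)] S(2) by (cases "n = 0") auto
      qed (use u S in \<open>auto intro: finite_subset[OF _ S(3)]\<close>)
      have "card (\<Gamma> - S') < card (\<Gamma> - S)"
        using u S(3) by (intro psubset_card_mono) (auto simp: S'_def)
      then have ext: "extends_to_cycles I d i S'"
        using less.hyps S' by blast
      have uX: "a * fps_X ^ u \<in> monomial_ideal S" if a: "a \<in> carrier A" "fps_nth a 0 = 0" for a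
        unfolding monomial_ideal_def
      proof (intro CollectI allI impI)
        fix n assume "fps_nth (a * fps_X ^ u) n \<noteq> 0"
        then have "n \<ge> u" "fps_nth a (n - u) \<noteq> 0"
          by (auto simp: fps_X_power_mult_right_nth split: if_splits)
        then show "n \<in> S"
          using uS[of "n - u"] a by (cases "n - u = 0") (auto simp: carrier_A)
      qed
      \<comment> \<open>t^u is outside the ideal of \<open>S\<close>, but its multiples by the
        maximal ideal are inside. The case of the maximal ideal yields \<open>z\<close>, the value
        to be given to t^u.\<close>
      have 1: "(\<lambda>a. g (a * fps_X ^ u)) \<in> module_hom A (regular_module A\<lparr>carrier := monomial_ideal (\<Gamma> - {0})\<rparr>) (I i)"
        unfolding max_monomial_ideal
        by (rule module_homI) (use gc uX gadd gsm in \<open>auto simp: distrib_right mult.assoc\<close>)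
      have 2: "\<forall>a\<in>monomial_ideal (\<Gamma> - {0}). d i (g (a * fps_X ^ u)) = \<zero>\<^bsub>I (Suc i)\<^esub>"
        unfolding max_monomial_ideal using dg uX by blast
      obtain z where z: "z \<in> carrier (I i)" "d i z = \<zero>\<^bsub>I (Suc i)\<^esub>"
        "\<forall>a\<in>monomial_ideal (\<Gamma> - {0}). g (a * fps_X ^ u) = a \<odot>\<^bsub>I i\<^esub> z"
        by (rule extends_to_cyclesE[OF max 1 2])
      define r where "r f = f - fps_const (fps_nth f u) * fps_X ^ u" for f :: "'k fps"
      have rS: "r f \<in> monomial_ideal S" if "f \<in> monomial_ideal S'" for f
        using that unfolding monomial_ideal_def by (auto simp: r_def S'_def)
      define g' where "g' f = g (r f) \<oplus>\<^bsub>I i\<^esub> fps_const (fps_nth f u) \<odot>\<^bsub>I i\<^esub> z" for f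
      have 3: "g' \<in> module_hom A (regular_module A\<lparr>carrier := monomial_ideal S'\<rparr>) (I i)"
      proof (rule module_homI)
        fix f assume "f \<in> carrier (regular_module A\<lparr>carrier := monomial_ideal S'\<rparr>)"
        then have f: "f \<in> monomial_ideal S'" by simp
        show "g' f \<in> carrier (I i)"
          using gc[OF rS[OF f]] z(1) by (simp add: g'_def)
        fix h assume "h \<in> carrier (regular_module A\<lparr>carrier := monomial_ideal S'\<rparr>)"
        then have h: "h \<in> monomial_ideal S'" by simp
        have "r (f + h) = r f + r h"
          by (simp add: r_def algebra_simps flip: fps_const_add)
        then have "g' (f + h) = (g (r f) \<oplus>\<^bsub>I i\<^esub> g (r h)) \<oplus>\<^bsub>I i\<^esub> (fps_const (fps_nth f u) \<odot>\<^bsub>I i\<^esub> z \<oplus>\<^bsub>I i\<^esub> fps_const (fps_nth h u) \<odot>\<^bsub>I i\<^esub> z)"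
          using gadd[OF rS[OF f] rS[OF h]] Ii.smult_l_distr[of "fps_const (fps_nth f u)" "fps_const (fps_nth h u)" z] z(1)
          by (simp add: g'_def)
        then show "g' (f \<oplus>\<^bsub>regular_module A\<lparr>carrier := monomial_ideal S'\<rparr>\<^esub> h) = g' f \<oplus>\<^bsub>I i\<^esub> g' h"
          using gc[OF rS[OF f]] gc[OF rS[OF h]] z(1) by (simp add: g'_def Ii.M.a_ac)
      next
        fix a f assume a: "a \<in> carrier A" and "f \<in> carrier (regular_module A\<lparr>carrier := monomial_ideal S'\<rparr>)"
        then have f: "f \<in> monomial_ideal S'" by simp
        define a0 where "a0 = fps_nth a 0"
        define c where "c = fps_nth f u"
        \<comment> \<open>\<open>b\<close> is the part of \<open>a\<close> without constant term,
          times the coefficient of \<open>f\<close> at t^u. Its product with t^u falls back into the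
          ideal of \<open>S\<close>, where \<open>g\<close> is multiplication of \<open>b\<close>
          with \<open>z\<close>.\<close>
        define b where "b = (a - fps_const a0) * fps_const c"
        have b: "b \<in> carrier A" "fps_nth b 0 = 0"
          using a by (auto simp: b_def a0_def)
        have arf: "a * r f \<in> monomial_ideal S"
          using monomial_ideal_ideal[OF less.prems] rS[OF f] a ideal.I_l_closed[of "monomial_ideal S" A "r f" a] by simp
        have "fps_nth (a * f) u = a0 * c"
        proof -
          have "a * f = a * r f + b * fps_X ^ u + fps_const (a0 * c) * fps_X ^ u"
            by (simp add: r_def b_def c_def algebra_simps flip: fps_const_mult)
          then show ?thesis
            using monomial_ideal_nth[OF arf u(2)] monomial_ideal_nth[OF uX[OF b] u(2)] by simp
        qed
        then have "r (a * f) = a * r f + b * fps_X ^ u"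
          by (simp add: r_def b_def c_def algebra_simps flip: fps_const_mult)
        then have "g' (a * f) = (a \<odot>\<^bsub>I i\<^esub> g (r f) \<oplus>\<^bsub>I i\<^esub> b \<odot>\<^bsub>I i\<^esub> z) \<oplus>\<^bsub>I i\<^esub> fps_const (a0 * c) \<odot>\<^bsub>I i\<^esub> z"
          using gadd[OF arf uX[OF b]] gsm[OF a rS[OF f]] z(3) b \<open>fps_nth (a * f) u = a0 * c\<close>
          by (simp add: g'_def max_monomial_ideal)
        also have "\<dots> = a \<odot>\<^bsub>I i\<^esub> g (r f) \<oplus>\<^bsub>I i\<^esub> (b + fps_const (a0 * c)) \<odot>\<^bsub>I i\<^esub> z"
          using Ii.smult_l_distr[of b "fps_const (a0 * c)" z] a b z(1) gc[OF rS[OF f]] by (simp add: Ii.M.a_assoc)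
        also have "b + fps_const (a0 * c) = a * fps_const c"
          by (simp add: b_def algebra_simps)
        also have "a \<odot>\<^bsub>I i\<^esub> g (r f) \<oplus>\<^bsub>I i\<^esub> (a * fps_const c) \<odot>\<^bsub>I i\<^esub> z = a \<odot>\<^bsub>I i\<^esub> g' f"
          using Ii.smult_assoc1[of a "fps_const c" z] a z(1) gc[OF rS[OF f]] by (simp add: g'_def c_def Ii.smult_r_distr)
        finally show "g' (a \<odot>\<^bsub>regular_module A\<lparr>carrier := monomial_ideal S'\<rparr>\<^esub> f) = a \<odot>\<^bsub>I i\<^esub> g' f"
          by simp
      qed
      have 4: "\<forall>f\<in>monomial_ideal S'. d i (g' f) = \<zero>\<^bsub>I (Suc i)\<^esub>"
      proof
        fix f assume f: "f \<in> monomial_ideal S'"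
        have "d i (g' f) = d i (g (r f)) \<oplus>\<^bsub>I (Suc i)\<^esub> fps_const (fps_nth f u) \<odot>\<^bsub>I (Suc i)\<^esub> d i z"
          using module_homD(2)[OF d, of "g (r f)" "fps_const (fps_nth f u) \<odot>\<^bsub>I i\<^esub> z"]
            module_homD(3)[OF d _ z(1), of "fps_const (fps_nth f u)"] gc[OF rS[OF f]] z(1)
          by (simp add: g'_def)
        then show "d i (g' f) = \<zero>\<^bsub>I (Suc i)\<^esub>"
          using dg rS[OF f] z(2) by simp
      qed
      obtain z' where z': "z' \<in> carrier (I i)" "d i z' = \<zero>\<^bsub>I (Suc i)\<^esub>"
        "\<forall>f\<in>monomial_ideal S'. g' f = f \<odot>\<^bsub>I i\<^esub> z'"
        by (rule extends_to_cyclesE[OF ext 3 4])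
      have "g f = f \<odot>\<^bsub>I i\<^esub> z'" if f: "f \<in> monomial_ideal S" for f
      proof -
        have "f \<in> monomial_ideal S'"
          using f by (auto simp: monomial_ideal_def S'_def)
        moreover have "g' f = g f"
        proof -
          have fu: "fps_nth f u = 0"
            by (rule monomial_ideal_nth[OF f u(2)])
          have "\<zero>\<^bsub>A\<^esub> \<odot>\<^bsub>I i\<^esub> z = \<zero>\<^bsub>I i\<^esub>"
            by (rule Ii.smult_l_null[OF z(1)])
          then show ?thesis
            using gc[OF f] by (simp add: g'_def r_def fu)
        qed
        ultimately show ?thesis
          using z'(3) by simp
      qed
      then show ?thesis
        using z' by blast
    qed
  qed
qed

section \<open>Ideals isomorphic to A extended by pseudo-Frobenius monomials\<close>

definition pf_set :: "nat \<Rightarrow> int set \<Rightarrow> nat set" where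
  "pf_set e T = {n. int n - int e \<in> GZ \<union> T}"

text \<open>These are the exponents of t^e (A + the span of the t^s with s in \<open>T\<close>). The
  sum is stable under \<open>A\<close> because the maximal ideal sends t^s into \<open>A\<close>,
  and the factor t^e moves it into \<open>A\<close>.\<close>

lemma monomial_set_pf_set:
  assumes T: "T \<subseteq> pseudo_frob" and e: "e \<in> \<Gamma>" "\<And>t. t \<in> T \<Longrightarrow> int e + t \<in> GZ"
  shows "monomial_set (pf_set e T)"
  unfolding monomial_set_def
proof (intro conjI ballI)
  show "pf_set e T \<subseteq> \<Gamma>"
  proof
    fix n assume "n \<in> pf_set e T"
    then have "int e + (int n - int e) \<in> GZ"
      using GZ_add[of "int e" "int n - int e"] e(1) e(2)[of "int n - int e"] by (auto simp: pf_set_def)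
    then show "n \<in> \<Gamma>"
      by (simp add: GZ_iff)
  qed
  show "n + g \<in> pf_set e T" if n: "n \<in> pf_set e T" and g: "g \<in> \<Gamma>" for n g
  proof (cases "g = 0")
    case True
    then show ?thesis using n by simp
  next
    case False
    have "(int n - int e) + int g \<in> GZ"
    proof (cases "int n - int e \<in> GZ")
      case True
      then show ?thesis
        using g by (intro GZ_add) auto
    next
      case False
      then have "int n - int e \<in> pseudo_frob"
        using n T by (auto simp: pf_set_def)
      then show ?thesis
        using g \<open>g \<noteq> 0\<close> by (auto simp: pseudo_frob_def)
    qed
    then show ?thesis
      by (simp add: pf_set_def algebra_simps)
  qed
  have "n < e + cnd" if n: "n \<in> \<Gamma> - pf_set e T" for n
  proof (rule ccontr)
    assume "\<not> n < e + cnd"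
    then have "int n - int e \<in> GZ"
      by (auto simp: GZ_iff intro: ge_cnd_in)
    then show False
      using n by (simp add: pf_set_def)
  qed
  then show "finite (\<Gamma> - pf_set e T)"
    by (meson bounded_nat_set_is_finite)
qed

text \<open>A positive element of \<Gamma> moves \<Gamma> and \<open>T\<close> into \<Gamma>, which
  does not contain p. So \<open>coefficient_hom\<close> applies at the exponent e + p.\<close>

lemma pf_set_coefficient:
  assumes T: "T \<subseteq> pseudo_frob" and p: "p \<in> pseudo_frob" "int w = int e + p"
    and j: "j \<in> pf_set e T" and g: "g \<in> \<Gamma>" "g > 0"
  shows "j + g \<noteq> w"
proof
  assume "j + g = w"
  then have eq: "int j - int e + int g = p"
    using p(2) by simp
  have "int j - int e + int g \<in> GZ"
  proof (cases "int j - int e \<in> GZ")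
    case True
    then show ?thesis
      using g by (intro GZ_add) auto
  next
    case False
    then have "int j - int e \<in> pseudo_frob"
      using j T by (auto simp: pf_set_def)
    then show ?thesis
      using g by (auto simp: pseudo_frob_def)
  qed
  then show False
    using eq p(1) by (simp add: pseudo_frob_def)
qed

lemma pf_shift_mult_X:
  assumes s: "s \<in> pseudo_frob" and a: "a \<in> carrier A" "fps_nth a 0 = 0" and w: "int w = int e + s"
  shows "a * fps_X ^ w = pf_shift s a * fps_X ^ e"
proof -
  have "fps_to_fls (a * fps_X ^ w) = fls_shift (- int w) (fps_to_fls a)"
    by (simp only: fls_times_fps_to_fls fps_to_fls_power fps_X_to_fls fls_X_power_times_conv_shift)
  also have "\<dots> = fls_shift (- int e) (fls_shift (- s) (fps_to_fls a))"
    by (simp add: w algebra_simps)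
  also have "\<dots> = fps_to_fls (pf_shift s a * fps_X ^ e)"
    by (simp only: fls_times_fps_to_fls fps_to_fls_power fps_X_to_fls fls_X_power_times_conv_shift pf_shift(1)[OF insertI2[OF s] a])
  finally show ?thesis
    by (simp only: fps_to_fls_eq_iff)
qed

text \<open>The map b a \<mapsto> b v on the principal ideal of \<open>a\<close> is well defined
  because k[[t]] is a domain; an element that represents it is the quotient of \<open>v\<close> by
  \<open>a\<close>.\<close>

lemma injective_divisible:
  assumes E: "injective_module A E" and a: "a \<in> carrier A" "a \<noteq> 0" and v: "v \<in> carrier E"
  obtains u where "u \<in> carrier E" "a \<odot>\<^bsub>E\<^esub> u = v"
proof -
  have "module A E"
    using E by (simp add: injective_module_def)
  then interpret E: module A E .
  define J where "J = {b * a | b. b \<in> carrier A}"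
  have J: "ideal J A"
  proof (rule ideal_A_I)
    show "0 \<in> J"
      unfolding J_def by (intro CollectI exI[of _ 0]) auto
    show "x + y \<in> J" if xy: "x \<in> J" "y \<in> J" for x y
    proof -
      obtain b c where "x = b * a" "y = c * a" "b \<in> carrier A" "c \<in> carrier A"
        using xy unfolding J_def by blast
      then show ?thesis
        unfolding J_def by (intro CollectI exI[of _ "b + c"]) (auto simp: distrib_right)
    qed
    show "c * x \<in> J" if x: "x \<in> J" and c: "c \<in> carrier A" for x c
    proof -
      obtain b where "x = b * a" "b \<in> carrier A"
        using x unfolding J_def by blast
      then show ?thesis
        unfolding J_def using c by (intro CollectI exI[of _ "c * b"]) (auto simp: mult.assoc)
    qed
  qed (use a in \<open>auto simp: J_def\<close>)
  have q: "(b * a) div a = b" for b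
    using a(2) by simp
  have "(\<lambda>x. (x div a) \<odot>\<^bsub>E\<^esub> v) \<in> module_hom A (regular_module A\<lparr>carrier := J\<rparr>) E"
  proof (rule module_homI)
    fix x assume "x \<in> carrier (regular_module A\<lparr>carrier := J\<rparr>)"
    then obtain b where b: "x = b * a" "b \<in> carrier A"
      by (auto simp: J_def)
    show "(x div a) \<odot>\<^bsub>E\<^esub> v \<in> carrier E"
      using b v by (simp add: q)
    fix y assume "y \<in> carrier (regular_module A\<lparr>carrier := J\<rparr>)"
    then obtain c where c: "y = c * a" "c \<in> carrier A"
      by (auto simp: J_def)
    have "(x + y) div a = b + c"
      using q[of "b + c"] by (simp add: b c distrib_right)
    then show "((x \<oplus>\<^bsub>regular_module A\<lparr>carrier := J\<rparr>\<^esub> y) div a) \<odot>\<^bsub>E\<^esub> v = (x div a) \<odot>\<^bsub>E\<^esub> v \<oplus>\<^bsub>E\<^esub> (y div a) \<odot>\<^bsub>E\<^esub> v"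
      using b c v E.smult_l_distr[of b c v] by (simp add: q)
  next
    fix c x assume c: "c \<in> carrier A" and "x \<in> carrier (regular_module A\<lparr>carrier := J\<rparr>)"
    then obtain b where b: "x = b * a" "b \<in> carrier A"
      by (auto simp: J_def)
    have "(c * x) div a = c * b"
      using q[of "c * b"] by (simp add: b mult.assoc)
    then show "((c \<odot>\<^bsub>regular_module A\<lparr>carrier := J\<rparr>\<^esub> x) div a) \<odot>\<^bsub>E\<^esub> v = c \<odot>\<^bsub>E\<^esub> ((x div a) \<odot>\<^bsub>E\<^esub> v)"
      using b c v E.smult_assoc1[of c b v] by (simp add: q)
  qed
  from injective_module_extend_ideal[OF E J this] obtain u where
    u: "u \<in> carrier E" "\<forall>x\<in>J. (x div a) \<odot>\<^bsub>E\<^esub> v = x \<odot>\<^bsub>E\<^esub> u"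
    by blast
  have "a \<in> J"
    unfolding J_def by (intro CollectI exI[of _ 1]) auto
  then have "a \<odot>\<^bsub>E\<^esub> u = (a div a) \<odot>\<^bsub>E\<^esub> v"
    using u(2) by simp
  then show thesis
    using that[OF u(1)] a(2) v E.smult_one[OF v] by simp
qed

text \<open>Dimension shifting: the residue field embeds into \<open>A/xc\<close> (the socle element is
  \<open>t^(cnd + frob)\<close>), which has projective dimension 1.\<close>

lemma extends_max_step:
  assumes inj: "\<And>i. injective_module A (I i)" and d: "\<And>i. d i \<in> module_hom A (I i) (I (Suc i))"
    and exact: "\<And>i. d i ` carrier (I i) = {x \<in> carrier (I (Suc i)). d (Suc i) x = \<zero>\<^bsub>I (Suc (Suc i))\<^esub>}"
    and ext: "\<And>S. monomial_set S \<Longrightarrow> extends_to_cycles I d (Suc (Suc k)) S"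
  shows "extends_to_cycles I d (Suc k) (\<Gamma> - {0})"
  unfolding extends_to_cycles_def
proof (intro ballI impI)
  define i where "i = Suc k"
  have I: "module A (I j)" for j
    using inj by (simp add: injective_module_def)
  interpret Ik: module A "I k" by (rule I)
  interpret Ii: module A "I i" by (rule I)
  interpret Is: module A "I (Suc i)" by (rule I)
  have dd: "d (Suc j) (d j u) = \<zero>\<^bsub>I (Suc (Suc j))\<^esub>" if "u \<in> carrier (I j)" for j u
    using exact[of j] that by blast
  have dc: "d j u \<in> carrier (I (Suc j))" if "u \<in> carrier (I j)" for j u
    using module_homD(1)[OF d that] .
  have lift: "\<exists>u\<in>carrier (I j). d j u = y" if "y \<in> carrier (I (Suc j))" "d (Suc j) y = \<zero>\<^bsub>I (Suc (Suc j))\<^esub>" for j y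
  proof -
    have "y \<in> d j ` carrier (I j)"
      unfolding exact using that by simp
    then show ?thesis by blast
  qed
  fix g assume g: "g \<in> module_hom A (regular_module A\<lparr>carrier := monomial_ideal (\<Gamma> - {0})\<rparr>) (I (Suc k))"
    and dg: "\<forall>a\<in>monomial_ideal (\<Gamma> - {0}). d (Suc k) (g a) = \<zero>\<^bsub>I (Suc (Suc k))\<^esub>"
  obtain z where z: "z \<in> carrier (I i)" "\<And>a. a \<in> monomial_ideal (\<Gamma> - {0}) \<Longrightarrow> g a = a \<odot>\<^bsub>I i\<^esub> z"
    using injective_module_extend_ideal[OF inj monomial_ideal_ideal[OF monomial_set_max] g]
    unfolding i_def by blast
  \<comment> \<open>\<open>z\<close> represents \<open>g\<close> but need not be a cycle. Its defect
    \<open>y0\<close> is killed by the maximal ideal, because \<open>g\<close> takes values in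
    cycles.\<close>
  define y0 where "y0 = d i z"
  have y0: "y0 \<in> carrier (I (Suc i))" "d (Suc i) y0 = \<zero>\<^bsub>I (Suc (Suc i))\<^esub>"
    using dc[OF z(1)] dd[OF z(1)] by (auto simp: y0_def)
  have kill: "a \<odot>\<^bsub>I (Suc i)\<^esub> y0 = \<zero>\<^bsub>I (Suc i)\<^esub>" if "a \<in> carrier A" "fps_nth a 0 = 0" for a
  proof -
    have "a \<in> monomial_ideal (\<Gamma> - {0})"
      using that by (simp add: max_monomial_ideal)
    then show ?thesis
      using module_homD(3)[OF d that(1) z(1)] z(2) dg by (simp add: y0_def i_def)
  qed
  define w where "w = nat (int cnd + frob)"
  have w: "int w = int cnd + frob"
    using cnd_pos by (simp add: w_def frob_def)
  have wG: "int cnd + frob \<in> GZ"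
    using cnd_pos by (intro gt_frob_in_GZ) simp
  \<comment> \<open>The exponents of the ideal generated by \<open>xc\<close> and t^w, whose
    quotient is the cokernel of k \<rightarrow> A/xc. The coefficient at t^w times \<open>y0\<close>
    is a homomorphism from this ideal into the cycles of the next degree.\<close>
  define S where "S = pf_set cnd {frob}"
  have S: "monomial_set S"
    unfolding S_def by (rule monomial_set_pf_set) (use frob_pseudo_frob wG ge_cnd_in in auto)
  have w_notin: "j + g \<noteq> w" if "j \<in> S" "g \<in> \<Gamma>" "g > 0" for j g
    using pf_set_coefficient[of "{frob}" frob w cnd j g] frob_pseudo_frob w that by (simp add: S_def)
  have 1: "(\<lambda>f. fps_const (fps_nth f w) \<odot>\<^bsub>I (Suc i)\<^esub> y0) \<in>
      module_hom A (regular_module A\<lparr>carrier := monomial_ideal S\<rparr>) (I (Suc i))"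
    by (rule coefficient_hom[OF I S w_notin y0(1) kill])
  have 2: "\<forall>f\<in>monomial_ideal S. d (Suc i) (fps_const (fps_nth f w) \<odot>\<^bsub>I (Suc i)\<^esub> y0) = \<zero>\<^bsub>I (Suc (Suc i))\<^esub>"
    using module_homD(3)[OF d _ y0(1)] y0(2) module.smult_r_null[OF I] by simp
  obtain y where y: "y \<in> carrier (I (Suc i))" "d (Suc i) y = \<zero>\<^bsub>I (Suc (Suc i))\<^esub>"
    "\<forall>f\<in>monomial_ideal S. fps_const (fps_nth f w) \<odot>\<^bsub>I (Suc i)\<^esub> y0 = f \<odot>\<^bsub>I (Suc i)\<^esub> y"
    by (rule extends_to_cyclesE[OF ext[OF S, folded i_def] 1 2])
  have "w \<in> S" "cnd \<in> S"
    using w GZ_zero by (auto simp: S_def pf_set_def)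
  then have XS: "fps_X ^ w \<in> monomial_ideal S" "xc \<in> monomial_ideal S"
    by (auto intro: X_in_monomial_ideal)
  have wA: "fps_X ^ w \<in> carrier A"
    using w wG by (intro X_in_A) (metis GZ_iff nat_int)
  have Xwy: "fps_X ^ w \<odot>\<^bsub>I (Suc i)\<^esub> y = y0"
    using bspec[OF y(3) XS(1)] Is.smult_one[OF y0(1)] by simp
  have "frob \<noteq> 0"
    using frob_notin_GZ GZ_zero by auto
  then have "fps_nth xc w = 0"
    using w by auto
  then have xy: "xc \<odot>\<^bsub>I (Suc i)\<^esub> y = \<zero>\<^bsub>I (Suc i)\<^esub>"
    using bspec[OF y(3) XS(2)] Is.smult_l_null[OF y0(1)] by simp
  obtain y' where y': "y' \<in> carrier (I i)" "d i y' = y"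
    using lift[OF y(1,2)] by blast
  have "d i (xc \<odot>\<^bsub>I i\<^esub> y') = \<zero>\<^bsub>I (Suc i)\<^esub>"
    using module_homD(3)[OF d xc(1) y'(1)] y'(2) xy by simp
  moreover have "xc \<odot>\<^bsub>I i\<^esub> y' \<in> carrier (I i)"
    by (rule Ii.smult_closed[OF xc(1) y'(1)])
  ultimately obtain v where v: "v \<in> carrier (I k)" "d k v = xc \<odot>\<^bsub>I i\<^esub> y'"
    using lift[of "xc \<odot>\<^bsub>I i\<^esub> y'" k] unfolding i_def by blast
  \<comment> \<open>\<open>y'\<close> need not be killed by \<open>xc\<close>, but
    \<open>xc y'\<close> is a boundary, the image of \<open>v\<close>. Divisibility of the injective
    module \<open>I k\<close> gives v = xc v', and subtracting the image of \<open>v'\<close>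
    corrects \<open>y'\<close>.\<close>
  obtain v' where v': "v' \<in> carrier (I k)" "xc \<odot>\<^bsub>I k\<^esub> v' = v"
    by (rule injective_divisible[OF inj xc(1,3) v(1)])
  define y'' where "y'' = y' \<ominus>\<^bsub>I i\<^esub> d k v'"
  have dkv': "d k v' \<in> carrier (I i)"
    using dc[OF v'(1)] by (simp add: i_def)
  have y'': "y'' \<in> carrier (I i)"
    using y'(1) dkv' by (simp add: y''_def)
  have self_minus: "u \<ominus>\<^bsub>I j\<^esub> u = \<zero>\<^bsub>I j\<^esub>" if "u \<in> carrier (I j)" for u j
    using abelian_group.r_neg[OF module.axioms(2)[OF I] that] by (simp add: a_minus_def)
  have minus_zero: "u \<ominus>\<^bsub>I j\<^esub> \<zero>\<^bsub>I j\<^esub> = u" if "u \<in> carrier (I j)" for u j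
  proof -
    interpret module A "I j" by (rule I)
    show ?thesis
      using that by (simp add: a_minus_def)
  qed
  have "xc \<odot>\<^bsub>I i\<^esub> d k v' = xc \<odot>\<^bsub>I i\<^esub> y'"
    using module_homD(3)[OF d xc(1) v'(1)] v v' by (simp add: i_def)
  then have xy'': "xc \<odot>\<^bsub>I i\<^esub> y'' = \<zero>\<^bsub>I i\<^esub>"
    using Ii.smult_minus_r[OF xc(1) y'(1) dkv'] self_minus[of "xc \<odot>\<^bsub>I i\<^esub> y'" i] y'(1) xc(1)
    by (simp add: y''_def)
  have dy'': "d i y'' = y"
  proof -
    have "d i y'' = d i y' \<ominus>\<^bsub>I (Suc i)\<^esub> d i (d k v')"
      unfolding y''_def by (rule module_hom_minus[OF I I d y'(1) dkv'])
    also have "d i (d k v') = \<zero>\<^bsub>I (Suc i)\<^esub>"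
      using dd[OF v'(1)] by (simp add: i_def)
    finally show ?thesis
      using minus_zero y(1) y'(2) by simp
  qed
  define z' where "z' = z \<ominus>\<^bsub>I i\<^esub> fps_X ^ w \<odot>\<^bsub>I i\<^esub> y''"
  have Xy'': "fps_X ^ w \<odot>\<^bsub>I i\<^esub> y'' \<in> carrier (I i)"
    using wA y'' by simp
  have z': "z' \<in> carrier (I i)"
    using z(1) Xy'' by (simp add: z'_def)
  moreover have "d i z' = \<zero>\<^bsub>I (Suc i)\<^esub>"
    using module_hom_minus[OF I I d z(1) Xy''] module_homD(3)[OF d wA y''] dy'' Xwy y0_def self_minus[OF y0(1)]
    by (simp add: z'_def)
  \<comment> \<open>For \<open>a\<close> in the maximal ideal, a t^w is a multiple of
    \<open>xc\<close>, which kills \<open>y''\<close>. So the correction of \<open>z\<close> does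
    not change its products with this ideal.\<close>
  moreover have "g a = a \<odot>\<^bsub>I i\<^esub> z'" if a: "a \<in> monomial_ideal (\<Gamma> - {0})" for a
  proof -
    have aA: "a \<in> carrier A" "fps_nth a 0 = 0"
      using a by (auto simp: max_monomial_ideal)
    have "a \<odot>\<^bsub>I i\<^esub> (fps_X ^ w \<odot>\<^bsub>I i\<^esub> y'') = (a * fps_X ^ w) \<odot>\<^bsub>I i\<^esub> y''"
      using Ii.smult_assoc1[OF aA(1) wA y''] by simp
    also have "\<dots> = (pf_shift frob a * xc) \<odot>\<^bsub>I i\<^esub> y''"
      using pf_shift_mult_X[OF frob_pseudo_frob aA w] by simp
    also have "\<dots> = \<zero>\<^bsub>I i\<^esub>"
      using Ii.smult_assoc1[OF pf_shift(2)[OF insertI2[OF frob_pseudo_frob] aA] xc(1) y''] xy''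
        pf_shift(2)[OF insertI2[OF frob_pseudo_frob] aA] by simp
    finally show ?thesis
      using z(2)[OF a] Ii.smult_minus_r[OF aA(1) z(1) Xy''] minus_zero[of "a \<odot>\<^bsub>I i\<^esub> z" i] z(1) aA(1)
      by (simp add: z'_def)
  qed
  ultimately show "\<exists>z\<in>carrier (I (Suc k)). d (Suc k) z = \<zero>\<^bsub>I (Suc (Suc k))\<^esub> \<and>
      (\<forall>a\<in>monomial_ideal (\<Gamma> - {0}). g a = a \<odot>\<^bsub>I (Suc k)\<^esub> z)"
    unfolding i_def by blast
qed

text \<open>Descending induction from the end of the resolution, with n - k as measure: if it is 0,
  then \<open>I (Suc k)\<close> is zero. In each step, vanishing for all monomial ideals one degree
  higher gives the case of the maximal ideal, and this gives all others.\<close>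

lemma finite_resolution_extends:
  assumes inj: "\<And>i. injective_module A (I i)" and d: "\<And>i. d i \<in> module_hom A (I i) (I (Suc i))"
    and exact: "\<And>i. d i ` carrier (I i) = {x \<in> carrier (I (Suc i)). d (Suc i) x = \<zero>\<^bsub>I (Suc (Suc i))\<^esub>}"
    and zero: "\<And>i. i > n \<Longrightarrow> carrier (I i) = {\<zero>\<^bsub>I i\<^esub>}"
  shows "monomial_set S \<Longrightarrow> extends_to_cycles I d (Suc k) S"
proof (induction "n - k" arbitrary: k S)
  case 0
  then have k: "carrier (I (Suc k)) = {\<zero>\<^bsub>I (Suc k)\<^esub>}"
    by (intro zero) simp
  have I: "module A (I j)" for j
    using inj by (simp add: injective_module_def)
  have SA: "monomial_ideal S \<subseteq> carrier A"
    using 0 by (intro monomial_ideal_subset) (simp add: monomial_set_def)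
  show ?case
    unfolding extends_to_cycles_def
  proof (intro ballI impI bexI conjI)
    fix g a assume "g \<in> module_hom A (regular_module A\<lparr>carrier := monomial_ideal S\<rparr>) (I (Suc k))"
      and a: "a \<in> monomial_ideal S"
    then have "g a \<in> carrier (I (Suc k))"
      using module_homD(1)[of g A _ "I (Suc k)" a] by simp
    then show "g a = a \<odot>\<^bsub>I (Suc k)\<^esub> \<zero>\<^bsub>I (Suc k)\<^esub>"
      using k module.smult_r_null[OF I, of a "Suc k"] a SA by auto
  next
    show "d (Suc k) \<zero>\<^bsub>I (Suc k)\<^esub> = \<zero>\<^bsub>I (Suc (Suc k))\<^esub>"
      by (rule module_hom_zero[OF I I d])
  qed (simp add: k)
next
  case (Suc m)
  have I: "module A (I j)" for j
    using inj by (simp add: injective_module_def)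
  have "m = n - Suc k"
    using Suc.hyps(2) by simp
  then have max: "extends_to_cycles I d (Suc k) (\<Gamma> - {0})"
    by (intro extends_max_step[where I = I and d = d] inj d exact Suc.hyps(1))
  show ?case
    by (rule extends_from_max[where I = I and d = d and i = "Suc k", OF I I d max Suc.prems])
qed

text \<open>Let J = t^e (A + k t^p + k t^q) with e large. The coefficient at t^(e+p) times the class
  of t^p in Ext^1(k, A) is a homomorphism on J. If it comes from an element \<open>z\<close> of
  \<open>I 0\<close>, then b = t^e z lies in \<open>A\<close>, and modulo \<open>A\<close> the
  product t^p b is t^p while t^q b is 0. The first forces constant term 1 on b, the second constant
  term 0.\<close>

lemma gorenstein_imp_pseudo_frob_unique:
  assumes "gorenstein A" and p: "p \<in> pseudo_frob" and q: "q \<in> pseudo_frob"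
  shows "p = q"
proof (rule ccontr)
  assume pq: "p \<noteq> q"
  obtain \<epsilon> I d n where res: "injective_resolution A (regular_module A) \<epsilon> (I :: nat \<Rightarrow> ('k fps, ('k fps, 'k fps) universe) module) d"
    and zero: "\<forall>i>n. carrier (I i) = {\<zero>\<^bsub>I i\<^esub>}"
    using assms(1) unfolding gorenstein_def finite_injective_dimension_def by blast
  have inj: "injective_module A (I i)" for i
    using res by (simp add: injective_resolution_def)
  then have I: "module A (I i)" for i
    by (simp add: injective_module_def)
  interpret I0: module A "I 0" by (rule I)
  interpret I1: module A "I (Suc 0)" by (rule I)
  have d: "d i \<in> module_hom A (I i) (I (Suc i))" for i
    using res by (simp add: injective_resolution_def)
  have exact: "d i ` carrier (I i) = {x \<in> carrier (I (Suc i)). d (Suc i) x = \<zero>\<^bsub>I (Suc (Suc i))\<^esub>}" for i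
    using res by (simp add: injective_resolution_def)
  have eps: "\<epsilon> \<in> module_hom A (regular_module A) (I 0)" and "inj_on \<epsilon> (carrier A)"
    and ker0: "\<epsilon> ` carrier A = {x \<in> carrier (I 0). d 0 x = \<zero>\<^bsub>I (Suc 0)\<^esub>}"
    using res by (simp_all add: injective_resolution_def)
  then have eps_inj: "a = b" if "\<epsilon> a = \<epsilon> b" "a \<in> carrier A" "b \<in> carrier A" for a b
    using that by (simp add: inj_on_def)
  have eps_c: "\<epsilon> a \<in> carrier (I 0)" and eps_d: "d 0 (\<epsilon> a) = \<zero>\<^bsub>I (Suc 0)\<^esub>" if "a \<in> carrier A" for a
    using that ker0 by blast+
  have eps_add: "\<epsilon> (a + b) = \<epsilon> a \<oplus>\<^bsub>I 0\<^esub> \<epsilon> b" if "a \<in> carrier A" "b \<in> carrier A" for a b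
    using module_homD(2)[OF eps, of a b] that by simp
  have eps_mult: "\<epsilon> (a * b) = a \<odot>\<^bsub>I 0\<^esub> \<epsilon> b" if "a \<in> carrier A" "b \<in> carrier A" for a b
    using module_homD(3)[OF eps, of a b] that by simp
  have lift: "\<exists>a\<in>carrier A. t = \<epsilon> a" if "t \<in> carrier (I 0)" "d 0 t = \<zero>\<^bsub>I (Suc 0)\<^esub>" for t
  proof -
    have "t \<in> \<epsilon> ` carrier A"
      unfolding ker0 using that by simp
    then show ?thesis by blast
  qed
  define J where "J = {f \<in> carrier A. fps_nth f 0 = 0}"
  have J: "ideal J A"
    unfolding J_def by (rule maximal_ideal)
  have JA: "a \<in> carrier A" "fps_nth a 0 = 0" if "a \<in> J" for a
    using that by (auto simp: J_def)
  have sh_fls: "fps_to_fls (pf_shift s a) = fls_shift (- s) (fps_to_fls a)" and sh_A: "pf_shift s a \<in> carrier A"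
    if "s \<in> pseudo_frob" "a \<in> J" for s a
    using pf_shift[OF insertI2[OF that(1)] JA[OF that(2)]] by auto
  have eqI: "a = b" if "fps_to_fls a = fps_to_fls b" for a b :: "'k fps"
    using that by (simp only: fps_to_fls_eq_iff)
  have "(\<lambda>a. \<epsilon> (pf_shift p a)) \<in> module_hom A (regular_module A\<lparr>carrier := J\<rparr>) (I 0)"
  proof (rule module_homI)
    fix a assume "a \<in> carrier (regular_module A\<lparr>carrier := J\<rparr>)"
    then have a: "a \<in> J" by simp
    show "\<epsilon> (pf_shift p a) \<in> carrier (I 0)"
      using eps_c sh_A[OF p a] by blast
    fix b assume "b \<in> carrier (regular_module A\<lparr>carrier := J\<rparr>)"
    then have b: "b \<in> J" by simp
    have "pf_shift p (a + b) = pf_shift p a + pf_shift p b"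
      by (simp add: pf_shift_def)
    then show "\<epsilon> (pf_shift p (a \<oplus>\<^bsub>regular_module A\<lparr>carrier := J\<rparr>\<^esub> b)) = \<epsilon> (pf_shift p a) \<oplus>\<^bsub>I 0\<^esub> \<epsilon> (pf_shift p b)"
      using eps_add sh_A[OF p a] sh_A[OF p b] by simp
  next
    fix c a assume c: "c \<in> carrier A" and "a \<in> carrier (regular_module A\<lparr>carrier := J\<rparr>)"
    then have a: "a \<in> J" by simp
    have "c * a \<in> J"
      using c a by (auto simp: J_def)
    then have "pf_shift p (c * a) = c * pf_shift p a"
      by (intro eqI) (simp add: sh_fls p a fls_times_fps_to_fls fls_shifted_times_simps)
    then show "\<epsilon> (pf_shift p (c \<odot>\<^bsub>regular_module A\<lparr>carrier := J\<rparr>\<^esub> a)) = c \<odot>\<^bsub>I 0\<^esub> \<epsilon> (pf_shift p a)"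
      using eps_mult[OF c sh_A[OF p a]] by simp
  qed
  \<comment> \<open>\<open>zp\<close> plays the part of t^p in \<open>I 0\<close>: its products with
    the maximal ideal are the images of those of t^p. Its image in \<open>I 1\<close> is the class
    of t^p in Ext^1(k, A).\<close>
  from injective_module_extend_ideal[OF inj J this] obtain zp where
    zp: "zp \<in> carrier (I 0)" "\<And>a. a \<in> J \<Longrightarrow> \<epsilon> (pf_shift p a) = a \<odot>\<^bsub>I 0\<^esub> zp"
    by blast
  define yp where "yp = d 0 zp"
  have yp: "yp \<in> carrier (I (Suc 0))"
    using module_homD(1)[OF d zp(1)] by (simp add: yp_def)
  have kill: "a \<odot>\<^bsub>I (Suc 0)\<^esub> yp = \<zero>\<^bsub>I (Suc 0)\<^esub>" if "a \<in> carrier A" "fps_nth a 0 = 0" for a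
  proof -
    have a: "a \<in> J"
      using that by (simp add: J_def)
    show ?thesis
      using module_homD(3)[OF d that(1) zp(1)] zp(2)[OF a] eps_d[OF sh_A[OF p a]] by (simp add: yp_def)
  qed
  define e where "e = cnd + nat \<bar>p\<bar> + nat \<bar>q\<bar>"
  have e: "e \<in> \<Gamma>" "int e + p \<in> GZ" "int e + q \<in> GZ"
    by (auto simp: e_def GZ_iff intro!: ge_cnd_in)
  define wp wq where "wp = nat (int e + p)" and "wq = nat (int e + q)"
  have wp: "int wp = int e + p" "wp \<in> \<Gamma>" and wq: "int wq = int e + q" "wq \<in> \<Gamma>"
    using e by (auto simp: wp_def wq_def GZ_iff)
  define S where "S = pf_set e {p, q}"
  have S: "monomial_set S"
    unfolding S_def by (rule monomial_set_pf_set) (use p q e in auto)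
  have wp_notin: "j + g \<noteq> wp" if "j \<in> S" "g \<in> \<Gamma>" "g > 0" for j g
    using pf_set_coefficient[of "{p, q}" p wp e j g] p q wp that by (simp add: S_def)
  have 1: "(\<lambda>f. fps_const (fps_nth f wp) \<odot>\<^bsub>I (Suc 0)\<^esub> yp) \<in>
      module_hom A (regular_module A\<lparr>carrier := monomial_ideal S\<rparr>) (I (Suc 0))"
    by (rule coefficient_hom[OF I S wp_notin yp kill])
  have "d (Suc 0) yp = \<zero>\<^bsub>I (Suc (Suc 0))\<^esub>"
    using exact[of 0] zp(1) by (auto simp: yp_def)
  then have 2: "\<forall>f\<in>monomial_ideal S. d (Suc 0) (fps_const (fps_nth f wp) \<odot>\<^bsub>I (Suc 0)\<^esub> yp) = \<zero>\<^bsub>I (Suc (Suc 0))\<^esub>"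
    using module_homD(3)[OF d _ yp] module.smult_r_null[OF I] by simp
  have ext: "extends_to_cycles I d (Suc 0) S"
    by (intro finite_resolution_extends[where I = I and d = d and n = n] inj d exact S) (use zero in blast)
  obtain y where y: "y \<in> carrier (I (Suc 0))" "d (Suc 0) y = \<zero>\<^bsub>I (Suc (Suc 0))\<^esub>"
    "\<forall>f\<in>monomial_ideal S. fps_const (fps_nth f wp) \<odot>\<^bsub>I (Suc 0)\<^esub> yp = f \<odot>\<^bsub>I (Suc 0)\<^esub> y"
    by (rule extends_to_cyclesE[where I = I and d = d and i = "Suc 0", OF ext 1 2])
  have "y \<in> d 0 ` carrier (I 0)"
    unfolding exact using y by simp
  then obtain z where z: "z \<in> carrier (I 0)" "d 0 z = y"
    by blast
  have inS: "e \<in> S" "wp \<in> S" "wq \<in> S"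
    using wp wq GZ_zero by (auto simp: S_def pf_set_def)
  have "p \<noteq> 0"
    using p GZ_zero by (auto simp: pseudo_frob_def)
  have act: "d 0 (fps_X ^ m \<odot>\<^bsub>I 0\<^esub> z) = (if m = wp then yp else \<zero>\<^bsub>I (Suc 0)\<^esub>)" if "m \<in> S" "m \<in> \<Gamma>" for m
  proof -
    have "d 0 (fps_X ^ m \<odot>\<^bsub>I 0\<^esub> z) = fps_X ^ m \<odot>\<^bsub>I (Suc 0)\<^esub> y"
      using module_homD(3)[OF d X_in_A[OF that(2)] z(1)] z(2) by simp
    also have "\<dots> = fps_const (fps_nth (fps_X ^ m) wp) \<odot>\<^bsub>I (Suc 0)\<^esub> yp"
      using bspec[OF y(3) X_in_monomial_ideal[OF that(1)]] by simp
    finally show ?thesis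
      using I1.smult_one[OF yp] I1.smult_l_null[OF yp] by auto
  qed
  have Xz: "fps_X ^ m \<odot>\<^bsub>I 0\<^esub> z \<in> carrier (I 0)" if "m \<in> \<Gamma>" for m
    using z(1) X_in_A[OF that] by simp
  obtain b where b: "b \<in> carrier A" "fps_X ^ e \<odot>\<^bsub>I 0\<^esub> z = \<epsilon> b"
    using lift[OF Xz[OF e(1)]] act[OF inS(1) e(1)] wp(1) \<open>p \<noteq> 0\<close> by auto
  have "wq \<noteq> wp"
    using wp(1) wq(1) pq by auto
  then obtain \<beta> where beta: "\<beta> \<in> carrier A" "fps_X ^ wq \<odot>\<^bsub>I 0\<^esub> z = \<epsilon> \<beta>"
    using lift[OF Xz[OF wq(2)]] act[OF inS(3) wq(2)] by auto
  have "d 0 (fps_X ^ wp \<odot>\<^bsub>I 0\<^esub> z \<ominus>\<^bsub>I 0\<^esub> zp) = \<zero>\<^bsub>I (Suc 0)\<^esub>"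
    using module_hom_minus[OF I I d Xz[OF wp(2)] zp(1)] act[OF inS(2) wp(2)] yp I1.M.r_neg[OF yp]
    by (simp add: yp_def a_minus_def)
  then obtain \<alpha> where alpha: "\<alpha> \<in> carrier A" "fps_X ^ wp \<odot>\<^bsub>I 0\<^esub> z \<ominus>\<^bsub>I 0\<^esub> zp = \<epsilon> \<alpha>"
    using lift[of "fps_X ^ wp \<odot>\<^bsub>I 0\<^esub> z \<ominus>\<^bsub>I 0\<^esub> zp"] Xz[OF wp(2)] zp(1) by auto
  then have alpha': "fps_X ^ wp \<odot>\<^bsub>I 0\<^esub> z = \<epsilon> \<alpha> \<oplus>\<^bsub>I 0\<^esub> zp"
    using Xz[OF wp(2)] zp(1) by (metis I0.M.a_assoc I0.M.l_neg I0.M.r_zero I0.M.a_inv_closed a_minus_def)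
  have xJ: "xc \<in> J"
    using xc by (simp add: J_def)
  \<comment> \<open>t^s is not in \<open>A\<close>, so \<open>t^w z\<close> cannot be written as t^s
    b directly; after multiplication by \<open>xc\<close> it can, since xc t^w = (t^s xc) t^e with
    t^s xc in \<open>A\<close>.\<close>
  have move: "xc \<odot>\<^bsub>I 0\<^esub> (fps_X ^ w \<odot>\<^bsub>I 0\<^esub> z) = \<epsilon> (pf_shift s xc * b)"
    if "s \<in> pseudo_frob" "int w = int e + s" "w \<in> \<Gamma>" for s w
  proof -
    have "xc \<odot>\<^bsub>I 0\<^esub> (fps_X ^ w \<odot>\<^bsub>I 0\<^esub> z) = (xc * fps_X ^ w) \<odot>\<^bsub>I 0\<^esub> z"
      using I0.smult_assoc1[OF xc(1) X_in_A[OF that(3)] z(1)] by simp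
    also have "\<dots> = (pf_shift s xc * fps_X ^ e) \<odot>\<^bsub>I 0\<^esub> z"
      using pf_shift_mult_X[OF that(1) xc(1,2) that(2)] by simp
    also have "\<dots> = pf_shift s xc \<odot>\<^bsub>I 0\<^esub> \<epsilon> b"
      using I0.smult_assoc1[OF sh_A[OF that(1) xJ] X_in_A[OF e(1)] z(1)] b(2) by simp
    finally show ?thesis
      using eps_mult[OF sh_A[OF that(1) xJ] b(1)] by simp
  qed
  have cancel: "f = fls_shift (- s) h" if "fps_to_fls xc * f = fls_shift (- s) (fps_to_fls xc) * h" for f h :: "'k fls" and s
  proof -
    have "fps_to_fls xc * f = fps_to_fls xc * fls_shift (- s) h"
      using that by (simp only: fls_shifted_times_simps)
    then show ?thesis
      using xc(3) by simp
  qed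
  have notin: "fls_nth (fps_to_fls f) s = 0" if "f \<in> carrier A" "s \<in> pseudo_frob" for f s
    using that by (auto simp: pseudo_frob_def GZ_iff carrier_A)
  show False
  proof (cases "fps_nth b 0 = 0")
    \<comment> \<open>\<alpha> = t^p (b - 1) would have the coefficient -1 at t^p, although p is
      outside \<Gamma>.\<close>
    case True
    have "\<epsilon> (pf_shift p xc * b) = \<epsilon> (xc * \<alpha>) \<oplus>\<^bsub>I 0\<^esub> \<epsilon> (pf_shift p xc)"
      using move[OF p wp] alpha' I0.smult_r_distr[OF xc(1) eps_c[OF alpha(1)] zp(1)] eps_mult[OF xc(1) alpha(1)]
        zp(2)[OF xJ] by simp
    then have "\<epsilon> (pf_shift p xc * b) = \<epsilon> (xc * \<alpha> + pf_shift p xc)"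
      using eps_add[OF A_mult_closed[OF xc(1) alpha(1)] sh_A[OF p xJ]] by simp
    then have "pf_shift p xc * b = xc * \<alpha> + pf_shift p xc"
      by (rule eps_inj) (use sh_A[OF p xJ] b alpha xc in auto)
    then have "xc * \<alpha> = pf_shift p xc * (b - 1)"
      by (simp add: algebra_simps)
    then have "fps_to_fls xc * fps_to_fls \<alpha> = fps_to_fls (pf_shift p xc) * fps_to_fls (b - 1)"
      by (simp only: flip: fls_times_fps_to_fls)
    then have "fps_to_fls \<alpha> = fls_shift (- p) (fps_to_fls (b - 1))"
      unfolding sh_fls[OF p xJ] by (rule cancel)
    then have "fls_nth (fps_to_fls \<alpha>) p = fls_nth (fls_shift (- p) (fps_to_fls (b - 1))) p"
      by (rule arg_cong)
    then show False
      using notin[OF alpha(1) p] True by simp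
  next
    \<comment> \<open>\<beta> = t^q b would have the nonzero constant term of b as its coefficient
      at t^q, although q is outside \<Gamma>.\<close>
    case False
    have "\<epsilon> (pf_shift q xc * b) = \<epsilon> (xc * \<beta>)"
      using move[OF q wq] beta eps_mult[OF xc(1) beta(1)] by simp
    then have "pf_shift q xc * b = xc * \<beta>"
      by (rule eps_inj) (use sh_A[OF q xJ] b beta xc in auto)
    then have "fps_to_fls xc * fps_to_fls \<beta> = fps_to_fls (pf_shift q xc) * fps_to_fls b"
      by (simp only: flip: fls_times_fps_to_fls)
    then have "fps_to_fls \<beta> = fls_shift (- q) (fps_to_fls b)"
      unfolding sh_fls[OF q xJ] by (rule cancel)
    then have "fls_nth (fps_to_fls \<beta>) q = fls_nth (fls_shift (- q) (fps_to_fls b)) q"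
      by (rule arg_cong)
    then show False
      using notin[OF beta(1) q] False by simp
  qed
qed

end

theorem theorem3:
  fixes \<Gamma> :: "nat set"
    and A :: "'k :: {alg_closed_field, field_char_0} fps ring"
    and \<omega> :: "('k fps, 'm) module"
  assumes "numerical_semigroup \<Gamma>"
    and "A = semigroup_ring \<Gamma>"
    and "canonical_module A \<omega>"
  shows "(\<exists>cov. connection base_field A \<omega> cov) \<longleftrightarrow> gorenstein A"
proof -
  interpret monomial_ring \<Gamma> A
    using assms by unfold_locales
  have M: "module A \<omega>"
    using assms(3) by (simp add: canonical_module_def maximal_cohen_macaulay_def)
  obtain \<Phi> where iso: "dual_iso \<omega> \<Phi>"
    using canonical_module_dual_iso[OF assms(3)] by blast
  \<comment> \<open>Characteristic zero keeps distinct pseudo-Frobenius numbers distinct in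
    k.\<close>
  have inj: "inj (of_int :: int \<Rightarrow> 'k)"
    by (simp add: inj_def)
  show ?thesis
  proof
    assume "\<exists>cov. connection base_field A \<omega> cov"
    then obtain cov where "connection base_field A \<omega> cov"
      by blast
    then have symmetric_semigroup
      using connection_imp_pseudo_frob_unique[OF M iso _ inj] pseudo_frob_unique_imp_symmetric by blast
    then show "gorenstein A"
      by (rule symmetric_imp_gorenstein)
  next
    assume "gorenstein A"
    then have symmetric_semigroup
      using gorenstein_imp_pseudo_frob_unique pseudo_frob_unique_imp_symmetric by blast
    then show "\<exists>cov. connection base_field A \<omega> cov"
      by (rule symmetric_dual_iso_imp_connection[OF M iso])
  qed
qed

end
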